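(* Let $\mathbb K$ be an algebraically closed field of characteristic zero, let $p,q$ be coprime positive integers with $n:=p+q>2$, and let $\mathfrak g=\mathfrak{sl}(n)$ over $\mathbb K$. Let $\mathfrak a$ be the derived algebra of a parabolic subalgebra of $\mathfrak g$ whose Levi factor consists of exactly two blocks, of sizes $p$ and $q$ (that is, $\mathfrak a$ is a truncated (bi)parabolic subalgebra of index one). Identify $\mathfrak g^*$ with $\mathfrak g$ through the Killing form, and let $\rho:\mathfrak g\cong\mathfrak g^*\rightarrow \mathfrak a^*$ be the restriction map. Then for every adapted pair $(h,\eta)$ for $\mathfrak a$ there exists a regular nilpotent element $y\in\mathfrak g$ such that $\rho(y)=\eta$. Equivalently, writing $\mathfrak k=\ker\rho$ and identifying $\eta$ with any chosen pre-image of it in $\mathfrak g$, the set $(\eta+\mathfrak k)\cap \mathscr N(\mathfrak g)_{reg}$ is non-empty.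
   Context: For a finite-dimensional Lie algebra $\mathfrak a$ and $\xi\in\mathfrak a^*$, let $\mathfrak a^\xi=\{a\in\mathfrak a\mid a\xi=0\}$ be the stabilizer under the co-adjoint action. The index of $\mathfrak a$ is $\min_{\xi\in\mathfrak a^*}\dim\mathfrak a^\xi$, and $\xi\in\mathfrak a^*$ is called regular if $\dim \mathfrak a^\xi=\text{index}\ \mathfrak a$. An adapted pair $(h,\eta)$ for $\mathfrak a$ consists of an element $h\in\mathfrak a$ and a regular element $\eta\in\mathfrak a^*$ such that $h\eta=-\eta$ with respect to the co-adjoint action. $\mathscr N(\mathfrak g)$ denotes the cone of ad-nilpotent elements of $\mathfrak g$, and $\mathscr N(\mathfrak g)_{reg}$ its subset of regular elements, i.e. the unique dense open adjoint orbit in $\mathscr N(\mathfrak g)$; for $\mathfrak g=\mathfrak{sl}(n)$ these are the nilpotent matrices with a single Jordan block. The truncated biparabolic subalgebras of index one are described in the paper as exactly the derived algebras of maximal parabolic subalgebras in type $A$ whose Levi factor has two blocks of coprime sizes. *)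

theory Defs
  imports "HOL-Analysis.Analysis" "HOL-Computational_Algebra.Computational_Algebra"
begin

section \<open>Matrix Lie algebras\<close>

definition mscale :: "'k::field \<Rightarrow> 'k^'n^'m \<Rightarrow> 'k^'n^'m" where
  "mscale c A = (\<chi> i j. c * A $ i $ j)"

interpretation matvs: vector_space "mscale :: 'k::field \<Rightarrow> 'k^'n^'m \<Rightarrow> 'k^'n^'m"
  by unfold_locales (simp_all add: mscale_def vec_eq_iff algebra_simps)

definition bracket :: "'k::field^'n^'n \<Rightarrow> 'k^'n^'n \<Rightarrow> 'k^'n^'n" where
  "bracket A B = A ** B - B ** A"

definition sl :: "('k::field^'n^'n) set" where
  "sl = {A. trace A = 0}"

definition lie_subalgebra :: "('k::field^'n^'n) set \<Rightarrow> ('k^'n^'n) set \<Rightarrow> bool" where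
  "lie_subalgebra a g \<longleftrightarrow> matvs.subspace a \<and> a \<subseteq> g \<and> (\<forall>x\<in>a. \<forall>y\<in>a. bracket x y \<in> a)"

definition lie_ideal :: "('k::field^'n^'n) set \<Rightarrow> ('k^'n^'n) set \<Rightarrow> bool" where
  "lie_ideal I a \<longleftrightarrow> matvs.subspace I \<and> I \<subseteq> a \<and> (\<forall>x\<in>a. \<forall>y\<in>I. bracket x y \<in> I)"

definition lie_product :: "('k::field^'n^'n) set \<Rightarrow> ('k^'n^'n) set \<Rightarrow> ('k^'n^'n) set" where
  "lie_product a b = matvs.span {bracket x y | x y. x \<in> a \<and> y \<in> b}"

definition derived_algebra :: "('k::field^'n^'n) set \<Rightarrow> ('k^'n^'n) set" where
  "derived_algebra a = lie_product a a"

definition lie_solvable :: "('k::field^'n^'n) set \<Rightarrow> bool" where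
  "lie_solvable a \<longleftrightarrow> (\<exists>k. (derived_algebra ^^ k) a = {0})"

definition lie_nilpotent :: "('k::field^'n^'n) set \<Rightarrow> bool" where
  "lie_nilpotent a \<longleftrightarrow> (\<exists>k. (lie_product a ^^ k) a = {0})"

section \<open>Parabolic subalgebras and Levi factors\<close>

definition borel_subalgebra :: "('k::field^'n^'n) set \<Rightarrow> ('k^'n^'n) set \<Rightarrow> bool" where
  "borel_subalgebra b g \<longleftrightarrow> lie_subalgebra b g \<and> lie_solvable b \<and>
     (\<forall>c. lie_subalgebra c g \<and> lie_solvable c \<and> b \<subseteq> c \<longrightarrow> c = b)"

definition parabolic_subalgebra :: "('k::field^'n^'n) set \<Rightarrow> ('k^'n^'n) set \<Rightarrow> bool" where
  "parabolic_subalgebra P g \<longleftrightarrow> lie_subalgebra P g \<and> (\<exists>b. borel_subalgebra b g \<and> b \<subseteq> P)"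

definition is_nilradical :: "('k::field^'n^'n) set \<Rightarrow> ('k^'n^'n) set \<Rightarrow> bool" where
  "is_nilradical N a \<longleftrightarrow> lie_ideal N a \<and> lie_nilpotent N \<and>
     (\<forall>I. lie_ideal I a \<and> lie_nilpotent I \<longrightarrow> I \<subseteq> N)"

text \<open>
  For a parabolic subalgebra of a semisimple Lie algebra the nilradical coincides with the
  nilpotent radical, and its subalgebra complements are exactly the Levi factors.
\<close>

definition levi_factor :: "('k::field^'n^'n) set \<Rightarrow> ('k^'n^'n) set \<Rightarrow> bool" where
  "levi_factor L P \<longleftrightarrow> lie_subalgebra L P \<and>
     (\<exists>N. is_nilradical N P \<and> L \<inter> N = {0} \<and> P = {x + y | x y. x \<in> L \<and> y \<in> N})"

text \<open>
  The trace-zero matrices that are block diagonal, with blocks of sizes \<open>p\<close> and \<open>q\<close>, in some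
  basis. The blocks are indexed by a set \<open>S\<close> of coordinates and its complement, so no ordering
  of the index type is needed.
\<close>

definition two_blocks :: "nat \<Rightarrow> nat \<Rightarrow> ('k::field^'n^'n) set \<Rightarrow> bool" where
  "two_blocks p q L \<longleftrightarrow> (\<exists>(T :: 'k^'n^'n) (S :: 'n set).
     invertible T \<and> card S = p \<and> card (- S) = q \<and>
     L = (\<lambda>A. T ** A ** matrix_inv T) `
           {A \<in> sl. \<forall>i j. (i \<in> S) \<noteq> (j \<in> S) \<longrightarrow> A $ i $ j = 0})"

section \<open>Co-adjoint action, index and adapted pairs\<close>

text \<open>
  Elements of the dual space are linear functions on \<open>a\<close>, extended by \<open>undefined\<close> outside
  of \<open>a\<close> so that equality of functions is equality of functionals on \<open>a\<close>.
\<close>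

definition dual :: "('k::field^'n^'n) set \<Rightarrow> ('k^'n^'n \<Rightarrow> 'k) set" where
  "dual a = {\<xi> \<in> extensional a.
     (\<forall>x\<in>a. \<forall>y\<in>a. \<xi> (x + y) = \<xi> x + \<xi> y) \<and> (\<forall>c. \<forall>x\<in>a. \<xi> (mscale c x) = c * \<xi> x)}"

definition coad :: "('k::field^'n^'n) set \<Rightarrow> 'k^'n^'n \<Rightarrow> ('k^'n^'n \<Rightarrow> 'k) \<Rightarrow> ('k^'n^'n \<Rightarrow> 'k)" where
  "coad a x \<xi> = (\<lambda>z\<in>a. - \<xi> (bracket x z))"

definition stabilizer :: "('k::field^'n^'n) set \<Rightarrow> ('k^'n^'n \<Rightarrow> 'k) \<Rightarrow> ('k^'n^'n) set" where
  "stabilizer a \<xi> = {x \<in> a. coad a x \<xi> = (\<lambda>z\<in>a. 0)}"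

definition lie_index :: "('k::field^'n^'n) set \<Rightarrow> nat" where
  "lie_index a = (LEAST d. \<exists>\<xi>\<in>dual a. d = matvs.dim (stabilizer a \<xi>))"

definition regular_functional :: "('k::field^'n^'n) set \<Rightarrow> ('k^'n^'n \<Rightarrow> 'k) \<Rightarrow> bool" where
  "regular_functional a \<xi> \<longleftrightarrow> \<xi> \<in> dual a \<and> matvs.dim (stabilizer a \<xi>) = lie_index a"

definition adapted_pair ::
    "('k::field^'n^'n) set \<Rightarrow> 'k^'n^'n \<Rightarrow> ('k^'n^'n \<Rightarrow> 'k) \<Rightarrow> bool" where
  "adapted_pair a h \<eta> \<longleftrightarrow> h \<in> a \<and> regular_functional a \<eta> \<and> coad a h \<eta> = (\<lambda>z\<in>a. - \<eta> z)"

section \<open>Killing form and regular nilpotent elements\<close>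

text \<open>The trace of an endomorphism of a finite-dimensional space \<open>V\<close> of matrices.\<close>

definition trace_on :: "('k::field^'n^'n) set \<Rightarrow> ('k^'n^'n \<Rightarrow> 'k^'n^'n) \<Rightarrow> 'k" where
  "trace_on V f = (let B = (SOME B. matvs.independent B \<and> matvs.span B = V)
                   in \<Sum>b\<in>B. matvs.representation B (f b) b)"

definition killing_form :: "('k::field^'n^'n) set \<Rightarrow> 'k^'n^'n \<Rightarrow> 'k^'n^'n \<Rightarrow> 'k" where
  "killing_form g x y = trace_on g (\<lambda>z. bracket x (bracket y z))"

text \<open>
  The identification of \<open>g\<close> with its dual through the Killing form of \<open>g\<close>, followed by
  restriction to \<open>a\<close>. With \<open>a = g\<close> this is the identification itself.
\<close>

definition rho :: "('k::field^'n^'n) set \<Rightarrow> ('k^'n^'n) set \<Rightarrow> 'k^'n^'n \<Rightarrow> ('k^'n^'n \<Rightarrow> 'k)" where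
  "rho g a y = (\<lambda>x\<in>a. killing_form g y x)"

definition ker_rho :: "('k::field^'n^'n) set \<Rightarrow> ('k^'n^'n) set \<Rightarrow> ('k^'n^'n) set" where
  "ker_rho g a = {y \<in> g. rho g a y = (\<lambda>x\<in>a. 0)}"

definition nilpotent_cone :: "('k::field^'n^'n) set \<Rightarrow> ('k^'n^'n) set" where
  "nilpotent_cone g = {y \<in> g. \<exists>k. \<forall>x\<in>g. (bracket y ^^ k) x = 0}"

definition nilpotent_cone_reg :: "('k::field^'n^'n) set \<Rightarrow> ('k^'n^'n) set" where
  "nilpotent_cone_reg g = {y \<in> nilpotent_cone g. regular_functional g (rho g g y)}"

end

(*
  Conjugating P to a block form with diagonal idempotents e, f of ranks p, q, a functional on a is
  represented by a matrix y modulo e gl f and the scalars on the two diagonal blocks. If its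
  stabilizer has dimension at most one and p > q, then the block C = f y e is surjective. Choosing
  a section s of C and conjugating by an element of 1 + e gl f one may assume f y f = 0, and then
  the functional has the same stabilizer as the functional on the parabolic of type (p - q, q)
  inside gl(e) given by e y e, where q now refers to the copy s C of f. The case p < q follows by
  transposition, so that the Euclidean algorithm ends at p = q = 1, where everything is explicit.

  Going up again, a regular nilpotent lift N on the block e extends to the regular nilpotent matrix
  N + C + N s, provided that the section s respects the flag ker N < ker N^2 < ... .
  The descent also yields a functional with one-dimensional stabilizer, so the index is at most one
  and every regular functional, hence in particular every adapted pair, is covered.
*)

theory Submission
  imports Defs
begin

text \<open>The delicate point is the scalar ambiguity. A functional on the derived algebra fixes
  the diagonal blocks of \<open>y\<close> only up to multiples of \<open>e\<close> and
  \<open>f\<close>, so an identity for the refined blocks \<open>e' = e - s C\<close> and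
  \<open>f' = s C\<close> comes with two scalars that must be turned into scalars for
  \<open>e\<close> and \<open>f\<close>. One auxiliary block does this: if \<open>M\<close> lies in
  the corner of \<open>e\<close>, with \<open>f' M e' = 0\<close>,
  \<open>e' M e' = \<alpha> e'\<close> and \<open>f' M f' = \<beta> f'\<close>, then
  \<open>v = \<alpha> s - M s\<close> satisfies \<open>v C = \<alpha> e - M\<close> and
  \<open>C v = (\<alpha> - \<beta>) f\<close>. The descent takes for \<open>M\<close> a commutator
  and extends stabilizing elements; the ascent takes the difference of a lift and the matrix it
  lifts, and corrects the lift by a conjugation. The block \<open>e gl f\<close>, which no
  functional sees, leaves room for the nilpotent extension. Regularity of the lift is defined
  through the index of \<open>sl\<close>, so a lower bound for all stabilizers in \<open>sl\<close>
  is needed as well. It comes from invariant flags, and this is where algebraic closedness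
  enters.\<close>

no_notation fps_nth (infixl "$" 75)

section \<open>Matrix algebra and idempotents\<close>

lemma matrix_diff_ldistrib: "(A :: 'k::ring_1^'n^'m) ** (B - C) = A ** B - A ** C"
  by (simp add: matrix_matrix_mult_def vec_eq_iff right_diff_distrib sum_subtractf)

lemma matrix_diff_rdistrib: "((A :: 'k::ring_1^'n^'m) - B) ** C = A ** C - B ** C"
  by (simp add: matrix_matrix_mult_def vec_eq_iff left_diff_distrib sum_subtractf)

lemma matrix_add_rdistrib: "((A :: 'k::ring_1^'n^'m) + B) ** C = A ** C + B ** C"
  by (simp add: matrix_matrix_mult_def vec_eq_iff distrib_right sum.distrib)

lemma matrix_neg_left: "(- (A :: 'k::ring_1^'n^'m)) ** B = - (A ** B)"
  by (simp add: matrix_matrix_mult_def vec_eq_iff sum_negf)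

lemma matrix_neg_right: "(A :: 'k::ring_1^'n^'m) ** (- B) = - (A ** B)"
  by (simp add: matrix_matrix_mult_def vec_eq_iff sum_negf)

lemma mscale_mult_left: "mscale c A ** B = mscale c (A ** B)"
  by (simp add: matrix_matrix_mult_def vec_eq_iff mscale_def sum_distrib_left mult.assoc)

lemma mscale_mult_right: "A ** mscale c B = mscale c (A ** B)"
  by (simp add: matrix_matrix_mult_def vec_eq_iff mscale_def sum_distrib_left mult.left_commute)

lemma matrix_zero_left [simp]: "(0 :: 'k::ring_1^'n^'m) ** A = 0"
  by (simp add: matrix_matrix_mult_def vec_eq_iff)

lemma matrix_zero_right [simp]: "(A :: 'k::ring_1^'n^'m) ** 0 = 0"
  by (simp add: matrix_matrix_mult_def vec_eq_iff)

lemma matrix_sum_right: "(A :: 'k::ring_1^'n^'m) ** (\<Sum>i\<in>I. F i) = (\<Sum>i\<in>I. A ** F i)"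
  by (induction I rule: infinite_finite_induct) (simp_all add: matrix_add_ldistrib)

lemma matrix_sum_left: "(\<Sum>i\<in>I. F i) ** (A :: 'k::ring_1^'n^'m) = (\<Sum>i\<in>I. F i ** A)"
  by (induction I rule: infinite_finite_induct) (simp_all add: matrix_add_rdistrib)

lemma mscale_mv: "mscale c A *v v = c *s (A *v v)"
  by (simp add: matrix_vector_mult_def vec_eq_iff mscale_def sum_distrib_left mult.assoc)

lemma mv_scale: "(A :: 'k::field^'n^'m) *v (c *s v) = c *s (A *v v)"
  by (rule vec.scale)

lemma trace_scale: "trace (mscale c A) = c * trace A"
  by (simp add: trace_def mscale_def sum_distrib_left)

lemma trace_zero [simp]: "trace (0 :: 'k::comm_ring_1^'n^'n) = 0"
  by (simp add: trace_def)

lemma trace_neg: "trace (- (A :: 'k::comm_ring_1^'n^'n)) = - trace A"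
  by (simp add: trace_def sum_negf)

lemma trace_transpose: "trace (transpose A) = trace A"
  by (simp add: trace_def transpose_def)

lemma transpose_add: "transpose (A + B) = transpose A + transpose B"
  by (simp add: transpose_def vec_eq_iff)

lemma transpose_diff: "transpose (A - B) = transpose A - transpose B"
  by (simp add: transpose_def vec_eq_iff)

lemma transpose_mscale: "transpose (mscale c A) = mscale c (transpose A)"
  by (simp add: transpose_def vec_eq_iff mscale_def)

lemma transpose_zero: "transpose 0 = 0"
  by (simp add: transpose_def vec_eq_iff)

lemmas matring = matrix_add_ldistrib matrix_add_rdistrib matrix_diff_ldistrib matrix_diff_rdistrib
  matrix_neg_left matrix_neg_right mscale_mult_left mscale_mult_right matrix_mul_assoc[symmetric]

lemmas mscale_distrib = matvs.scale_right_distrib matvs.scale_right_diff_distrib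
  matvs.scale_left_distrib matvs.scale_left_diff_distrib

lemmas trace_lin = trace_add trace_sub trace_scale trace_neg

lemma mult_assoc_eq: "A ** B = C \<Longrightarrow> A ** (B ** X) = C ** X"
  by (simp add: matrix_mul_assoc)

lemma matrix_eqI: "(\<And>v. A *v v = B *v v) \<Longrightarrow> A = (B :: 'k::field^'n^'m)"
  by (simp add: matrix_eq)

section \<open>Rank-one matrices and separating covectors\<close>

definition outer :: "'k::field^'m \<Rightarrow> 'k^'n \<Rightarrow> 'k^'n^'m" where
  "outer v w = (\<chi> i j. v $ i * w $ j)"

definition dotp :: "'k::field^'n \<Rightarrow> 'k^'n \<Rightarrow> 'k" where
  "dotp v w = (\<Sum>i\<in>UNIV. v $ i * w $ i)"

lemma outer_mv: "outer v w *v x = dotp w x *s v"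
  by (simp add: outer_def dotp_def matrix_vector_mult_def vec_eq_iff sum_distrib_left mult_ac)

lemma outer_mult_outer: "outer a b ** outer c d = mscale (dotp b c) (outer a d)"
  by (simp add: outer_def dotp_def matrix_matrix_mult_def mscale_def vec_eq_iff
      sum_distrib_left sum_distrib_right mult_ac)

lemma mult_outer: "A ** outer v w = outer (A *v v) w"
  by (simp add: outer_def matrix_matrix_mult_def matrix_vector_mult_def vec_eq_iff
      sum_distrib_left sum_distrib_right mult_ac)

lemma outer_mult: "outer v w ** A = outer v (w v* A)"
  by (simp add: outer_def matrix_matrix_mult_def vector_matrix_mult_def vec_eq_iff
      sum_distrib_left sum_distrib_right mult_ac)

lemma trace_outer: "trace (outer v w) = dotp w v"
  by (simp add: outer_def dotp_def trace_def mult.commute)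

lemma dotp_vm: "dotp (w v* A) v = dotp w (A *v v)"
  unfolding dotp_def vector_matrix_mult_def matrix_vector_mult_def
  by (simp add: sum_distrib_left sum_distrib_right mult_ac) (subst sum.swap, simp add: mult_ac)

lemma outer_eq_0_iff: "outer v w = 0 \<longleftrightarrow> v = 0 \<or> w = 0"
  by (auto simp: outer_def vec_eq_iff)

lemma dotp_commute: "dotp v w = dotp w v"
  by (simp add: dotp_def mult.commute)

lemma dotp_0 [simp]: "dotp 0 v = 0" "dotp v 0 = 0"
  by (simp_all add: dotp_def)

lemma exists_dotp_one: "(v :: 'k::field^'n) \<noteq> 0 \<Longrightarrow> \<exists>w. dotp w v = 1"
proof -
  assume "v \<noteq> 0"
  then obtain i where i: "v $ i \<noteq> 0" by (auto simp: vec_eq_iff)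
  have "dotp (axis i (1 / v $ i)) v = 1"
    by (simp add: dotp_def axis_def if_distrib if_distribR i cong: if_cong)
  then show ?thesis by blast
qed

lemma separating_functional:
  assumes W: "vec.subspace W" and w: "(w :: 'k::field^'n) \<notin> W"
  shows "\<exists>\<psi>. (\<forall>u\<in>W. dotp \<psi> u = 0) \<and> dotp \<psi> w = 1"
proof -
  obtain B where B: "B \<subseteq> W" "vec.independent B" "W \<subseteq> vec.span B"
    using vec.maximal_independent_subset by metis
  have "vec.span B = W" using B W by (simp add: vec.span_subspace)
  then have ind: "vec.independent (insert w B)" using B w
    by (simp add: vec.independent_insertI)
  obtain \<psi>0 where \<psi>0: "dotp \<psi>0 w = 1" using exists_dotp_one[of w] w vec.subspace_0[OF W] by metis
  \<comment> \<open>A covector with value 1 at \<open>w\<close> is pulled back along a map that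
    fixes \<open>w\<close> and kills \<open>W\<close>.\<close>
  obtain g where g: "Vector_Spaces.linear (*s) (*s) g" "\<forall>x\<in>insert w B. g x = (if x = w then w else 0)"
    using vec.linear_independent_extend[OF ind, of "\<lambda>x. if x = w then w else 0"] by blast
  define G where "G = matrix g"
  have G: "G *v x = g x" for x unfolding G_def by (rule matrix_works[OF g(1)])
  have 0: "G *v u = 0" if "u \<in> W" for u
  proof -
    have "u \<in> vec.span B" using that B by blast
    then show ?thesis
    proof (induction rule: vec.span_induct_alt)
      case base then show ?case by simp
    next
      case (step c x y)
      then have "x \<noteq> w" "x \<in> insert w B" using B w by auto
      then show ?case using step g(2) G by (simp add: algebra_simps mv_scale)
    qed
  qed
  show ?thesis
    by (rule exI[of _ "\<psi>0 v* G"]) (use \<psi>0 0 G g(2) in \<open>auto simp: dotp_vm\<close>)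
qed

section \<open>Rank and trace of idempotents\<close>

definition img :: "'k::field^'n^'n \<Rightarrow> ('k^'n) set" where
  "img e = range ((*v) e)"

definition rk :: "'k::field^'n^'n \<Rightarrow> nat" where
  "rk e = vec.dim (img e)"

lemma subspace_img: "vec.subspace (img e)"
  unfolding img_def using vec.subspace_image[OF vec.subspace_UNIV] .

lemma img_iff: "e ** e = e \<Longrightarrow> v \<in> img e \<longleftrightarrow> e *v v = v"
  unfolding img_def by (metis matrix_vector_mul_assoc rangeI image_iff)

text \<open>Splits a line off the image of \<open>e\<close>: as \<open>e\<close> fixes
  \<open>v\<close> from the left and \<open>w\<close> from the right, \<open>outer v w\<close> is an
  idempotent below \<open>e\<close>, and the difference is again idempotent. This is the induction
  step for the trace and the source of vectors adapted to a block.\<close>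

lemma idempotent_remove_rank_one:
  fixes e :: "'k::field^'n^'n"
  assumes e: "e ** e = e" and "e \<noteq> 0"
  obtains v w where "v \<noteq> 0" "e *v v = v" "w v* e = w" "dotp w v = 1"
    "(e - outer v w) ** (e - outer v w) = e - outer v w"
    "Suc (rk (e - outer v w)) = rk e"
proof -
  obtain u where "e *v u \<noteq> 0" using \<open>e \<noteq> 0\<close> by (metis matrix_eqI matrix_vector_mult_0)
  define v where "v = e *v u"
  have v: "v \<noteq> 0" "e *v v = v" unfolding v_def using \<open>e *v u \<noteq> 0\<close>
    by (auto simp: matrix_vector_mul_assoc e)
  obtain w0 where "dotp w0 v = 1" using exists_dotp_one[OF v(1)] by blast
  define w where "w = w0 v* e"
  have w: "w v* e = w" "dotp w v = 1" unfolding w_def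
    by (simp_all add: vector_matrix_mul_assoc e dotp_vm v \<open>dotp w0 v = 1\<close>)
  define d where "d = e - outer v w"
  have d: "d ** d = d" unfolding d_def
    by (simp add: matring e mult_outer outer_mult v w matrix_vector_mult_diff_rdistrib outer_mv outer_eq_0_iff)
  have imgd: "x \<in> img d \<longleftrightarrow> d *v x = x" for x by (rule img_iff[OF d])
  have imge: "x \<in> img e \<longleftrightarrow> e *v x = x" for x by (rule img_iff[OF e])
  have dv: "d *v v = 0" unfolding d_def
    by (simp add: algebra_simps outer_mv v w)
  have "img e = vec.span (insert v (img d))"
  proof
    show "img e \<subseteq> vec.span (insert v (img d))"
    proof
      fix x assume "x \<in> img e"
      then have "x = d *v x + dotp w x *s v" unfolding imge d_def
        by (simp add: algebra_simps outer_mv)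
      moreover have "d *v x \<in> img d" by (simp add: img_def)
      ultimately show "x \<in> vec.span (insert v (img d))"
        by (metis insertCI vec.span_add vec.span_base vec.span_scale)
    qed
    have ed: "e ** d = d" unfolding d_def by (simp add: matring e mult_outer v)
    have "insert v (img d) \<subseteq> img e"
      using v ed unfolding imge imgd by (auto simp: imge imgd) (metis imge imgd matrix_vector_mul_assoc)
    then show "vec.span (insert v (img d)) \<subseteq> img e"
      by (rule vec.span_minimal) (rule subspace_img)
  qed
  moreover have "v \<notin> vec.span (img d)"
    using dv imgd v(1) subspace_img vec.span_eq_iff by (metis)
  ultimately have "rk e = Suc (rk d)"
    unfolding rk_def by (simp add: vec.dim_insert)
  then show ?thesis using that v w d unfolding d_def by metis
qed

lemma trace_idempotent:
  fixes e :: "'k::field^'n^'n"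
  assumes "e ** e = e" shows "trace e = of_nat (rk e)"
  using assms
proof (induction "rk e" arbitrary: e)
  case 0
  show ?case
  proof (cases "e = 0")
    case True then show ?thesis using 0 by simp
  next
    case False
    then show ?thesis using idempotent_remove_rank_one[OF 0(2)] 0 by (metis nat.distinct(1))
  qed
next
  case (Suc m)
  then have "e \<noteq> 0" using vec.dim_eq_0 by (auto simp: rk_def img_def)
  then obtain v w where vw: "dotp w v = 1" "(e - outer v w) ** (e - outer v w) = e - outer v w"
    "Suc (rk (e - outer v w)) = rk e"
    using idempotent_remove_rank_one[OF Suc(3)] by metis
  have "trace (e - outer v w) = of_nat (rk (e - outer v w))"
    using Suc vw by (metis nat.inject)
  then show ?case using vw Suc(2)[symmetric] by (simp add: trace_sub trace_outer algebra_simps flip: vw(3))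
qed

text \<open>In characteristic zero the trace of an idempotent determines its rank, so ranks of
  transposes and of refined blocks are compared by trace computations.\<close>

lemma rk_eqI:
  fixes e :: "'k::field_char_0^'n^'n" and f :: "'k^'m^'m"
  assumes "e ** e = e" "f ** f = f" "trace e = trace f"
  shows "rk e = rk f"
  using assms trace_idempotent[of e] trace_idempotent[of f] by simp

section \<open>Nilpotent matrices\<close>

primrec mpow :: "'k::field^'n^'n \<Rightarrow> nat \<Rightarrow> 'k^'n^'n" where
  "mpow A 0 = mat 1"
| "mpow A (Suc k) = A ** mpow A k"

lemma mpow_add: "mpow A (i + j) = mpow A i ** mpow A j"
  by (induction i) (simp_all add: matrix_mul_assoc)

lemma mpow_commute: "mpow A k ** A = A ** mpow A k"
  by (induction k) (simp_all add: matrix_mul_assoc[symmetric])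

lemma mpow_mv_commute: "mpow A k *v (A *v v) = A *v (mpow A k *v v)"
  by (simp add: matrix_vector_mul_assoc mpow_commute)

lemma mpow_transpose: "mpow (transpose A) k = transpose (mpow A k)"
  by (induction k) (simp_all add: transpose_mat matrix_transpose_mul mpow_commute[symmetric])

lemma mpow_conj:
  assumes "W' ** W = mat 1" and "W ** W' = mat 1"
  shows "mpow (W ** A ** W') k = W ** mpow A k ** W'"
proof (induction k)
  case (Suc k)
  have "W ** A ** W' ** (W ** mpow A k ** W') = W ** A ** (W' ** W) ** mpow A k ** W'"
    by (simp add: matrix_mul_assoc)
  then show ?case using Suc assms by (simp add: matrix_mul_assoc)
qed (simp add: assms)

lemma mpow_eq_0_mono: "mpow A i = 0 \<Longrightarrow> i \<le> j \<Longrightarrow> mpow A j = 0"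
  using mpow_add[of A "j - i" i] by simp

section \<open>Kernel flags of a nilpotent matrix\<close>

definition kerp :: "('k::field^'n) set \<Rightarrow> 'k^'n^'n \<Rightarrow> nat \<Rightarrow> ('k^'n) set" where
  "kerp S N i = {v \<in> S. mpow N i *v v = 0}"

lemma subspace_kerp: "vec.subspace S \<Longrightarrow> vec.subspace (kerp S N i)"
  by (auto simp: vec.subspace_def kerp_def algebra_simps mv_scale)

lemma kerp_mono: "i \<le> j \<Longrightarrow> kerp S N i \<subseteq> kerp S N j"
proof
  fix v assume "i \<le> j" "v \<in> kerp S N i"
  moreover have "mpow N j = mpow N (j - i) ** mpow N i"
    using mpow_add[of N "j - i" i] \<open>i \<le> j\<close> by simp
  ultimately show "v \<in> kerp S N j"
    by (simp add: kerp_def matrix_vector_mul_assoc[symmetric])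
qed

lemma mpow_stable: "(\<And>v. v \<in> S \<Longrightarrow> N *v v \<in> S) \<Longrightarrow> v \<in> S \<Longrightarrow> mpow N i *v v \<in> S"
  by (induction i) (simp_all add: matrix_vector_mul_assoc[symmetric])

text \<open>For \<open>m < k\<close> the vector \<open>N^(k-1-m) w\<close> is killed by
  \<open>N^(m+1)\<close> but not by \<open>N^m\<close>, so the flag grows strictly up to step
  \<open>k\<close>.\<close>

lemma kerp_dim_ge:
  assumes S: "vec.subspace S" and st: "\<And>v. v \<in> S \<Longrightarrow> N *v v \<in> S"
    and w: "w \<in> S" "mpow N k *v w = 0" "mpow N (k - 1) *v w \<noteq> 0"
    and "i + j \<le> k"
  shows "vec.dim (kerp S N i) + j \<le> vec.dim (kerp S N (i + j))"
  using \<open>i + j \<le> k\<close>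
proof (induction j)
  case (Suc j)
  define x where "x = mpow N (k - 1 - (i + j)) *v w"
  have xS: "x \<in> S" unfolding x_def by (rule mpow_stable[OF st w(1)])
  have "mpow N (i + j) *v x = mpow N (k - 1) *v w"
    unfolding x_def matrix_vector_mul_assoc mpow_add[symmetric] using Suc.prems by simp
  moreover have "mpow N (Suc (i + j)) *v x = mpow N k *v w"
    unfolding x_def matrix_vector_mul_assoc mpow_add[symmetric] using Suc.prems by simp
  ultimately have "x \<in> kerp S N (Suc (i + j))" "x \<notin> kerp S N (i + j)"
    using w xS by (auto simp: kerp_def)
  then have "kerp S N (i + j) \<subset> kerp S N (Suc (i + j))"
    using kerp_mono[of "i + j" "Suc (i + j)" S N] by auto
  then have "vec.dim (kerp S N (i + j)) < vec.dim (kerp S N (Suc (i + j)))"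
    using vec.dim_psubset subspace_kerp[OF S] vec.span_eq_iff by metis
  then show ?case using Suc by simp
qed simp

text \<open>\<open>N^i\<close> maps step \<open>i + 1\<close> of the flag into the line, with kernel
  step \<open>i\<close>; hence each step adds at most one dimension.\<close>

lemma kerp_dim_le:
  assumes S: "vec.subspace S" and st: "\<And>v. v \<in> S \<Longrightarrow> N *v v \<in> S"
    and line: "kerp S N 1 \<subseteq> vec.span {v0}"
  shows "vec.dim (kerp S N i) \<le> i"
proof (induction i)
  case 0
  have "kerp S N 0 \<subseteq> {0}" by (auto simp: kerp_def)
  then show ?case using vec.dim_eq_0 by (metis le_zero_eq)
next
  case (Suc i)
  have 1: "mpow N i *v v \<in> vec.span {v0}" if "v \<in> kerp S N (Suc i)" for v
  proof -
    have "mpow N i *v v \<in> kerp S N 1" using that mpow_stable[OF st]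
      by (auto simp: kerp_def matrix_vector_mul_assoc)
    then show ?thesis using line by blast
  qed
  obtain a where a: "kerp S N (Suc i) \<subseteq> vec.span (insert a (kerp S N i))"
  proof (cases "kerp S N (Suc i) \<subseteq> kerp S N i")
    case True then show ?thesis using that vec.span_superset by blast
  next
    case False
    then obtain a where a: "a \<in> kerp S N (Suc i)" "mpow N i *v a \<noteq> 0" by (auto simp: kerp_def)
    obtain c where c: "mpow N i *v a = c *s v0" using 1[OF a(1)] by (auto simp: vec.span_singleton)
    with a have "c \<noteq> 0" by auto
    show ?thesis
    proof (rule that[of a], rule)
      fix v assume v: "v \<in> kerp S N (Suc i)"
      obtain d where d: "mpow N i *v v = d *s v0" using 1[OF v] by (auto simp: vec.span_singleton)
      have "v - (d / c) *s a \<in> S"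
        using v a S by (auto simp: kerp_def intro!: vec.subspace_diff vec.subspace_scale)
      then have "v - (d / c) *s a \<in> kerp S N i"
        using c d \<open>c \<noteq> 0\<close> by (simp add: kerp_def algebra_simps mv_scale)
      then show "v \<in> vec.span (insert a (kerp S N i))"
        unfolding vec.span_breakdown_eq using vec.span_base by blast
    qed
  qed
  have "vec.dim (kerp S N (Suc i)) \<le> vec.dim (insert a (kerp S N i))"
    by (rule vec.dim_mono[OF a])
  also have "\<dots> \<le> Suc (vec.dim (kerp S N i))" by (simp add: vec.dim_insert)
  finally show ?case using Suc by simp
qed

lemma cyclic_dim_le:
  assumes "vec.subspace S" "\<And>v. v \<in> S \<Longrightarrow> N *v v \<in> S"
    and "w \<in> S" "mpow N k *v w = 0" "mpow N (k - 1) *v w \<noteq> 0"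
  shows "k \<le> vec.dim S"
proof -
  have "k \<le> vec.dim (kerp S N k)"
    using kerp_dim_ge[OF assms, of 0 k] by simp
  also have "\<dots> \<le> vec.dim S" by (rule vec.dim_subset) (auto simp: kerp_def)
  finally show ?thesis .
qed

text \<open>The corner algebra \<open>e gl e\<close> stands for the endomorphisms of the image of
  \<open>e\<close>, so that blocks of every size live in one matrix type.\<close>

definition corner :: "'k::field^'n^'n \<Rightarrow> 'k^'n^'n \<Rightarrow> bool" where
  "corner e x \<longleftrightarrow> e ** x = x \<and> x ** e = x"

text \<open>If \<open>k\<close> is the dimension of the space on which \<open>N\<close> acts, this
  describes a single Jordan block.\<close>

definition reg_nilpotent :: "'k::field^'n^'n \<Rightarrow> nat \<Rightarrow> bool" where
  "reg_nilpotent N k \<longleftrightarrow> mpow N k = 0 \<and> mpow N (k - 1) \<noteq> 0"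

lemma reg_nilpotent_transpose: "reg_nilpotent (transpose N) k \<longleftrightarrow> reg_nilpotent N k"
  by (simp add: reg_nilpotent_def mpow_transpose) (metis transpose_transpose transpose_zero)

lemma corner_img: "corner e x \<Longrightarrow> x *v v \<in> img e"
  unfolding corner_def img_def by (metis matrix_vector_mul_assoc rangeI)

lemma corner_mpow:
  assumes x: "corner e x" and "k > 0" shows "corner e (mpow x k)"
proof -
  obtain m where k: "k = Suc m" using \<open>k > 0\<close> gr0_implies_Suc by blast
  have "e ** (x ** mpow x m) = x ** mpow x m"
    using x by (simp add: matrix_mul_assoc corner_def)
  moreover have "(mpow x m ** x) ** e = mpow x m ** x"
    using x by (simp add: matrix_mul_assoc[symmetric] corner_def)
  ultimately show ?thesis by (simp add: k corner_def mpow_commute)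
qed

text \<open>A chain of length \<open>rk e\<close> uses up the whole dimension of the image, which
  leaves only one dimension for the first kernel. The bound \<open>rk e \<ge> 2\<close> keeps
  \<open>mpow N (rk e - 1)\<close> inside the corner: \<open>mpow N 0\<close> is the full identity
  and not \<open>e\<close>.\<close>

lemma reg_nilpotent_ker_line:
  assumes e: "e ** e = e" and N: "corner e N" and "reg_nilpotent N (rk e)" and "rk e \<ge> 2"
  obtains v0 where "v0 \<noteq> 0" "v0 \<in> img e" "kerp (img e) N 1 = vec.span {v0}"
proof -
  let ?p = "rk e"
  have nil: "mpow N ?p = 0" "mpow N (?p - 1) \<noteq> 0" using assms by (auto simp: reg_nilpotent_def)
  obtain w0 where w0: "mpow N (?p - 1) *v w0 \<noteq> 0"
    using nil(2) by (metis matrix_eqI matrix_vector_mult_0)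
  have "mpow N (?p - 1) ** e = mpow N (?p - 1)"
    using corner_mpow[OF N, of "?p - 1"] assms(4) by (simp add: corner_def)
  then have w: "mpow N (?p - 1) *v (e *v w0) \<noteq> 0"
    using w0 by (simp add: matrix_vector_mul_assoc)
  define v0 where "v0 = mpow N (?p - 1) *v (e *v w0)"
  have st: "N *v v \<in> img e" for v by (rule corner_img[OF N])
  have we: "e *v w0 \<in> img e" by (simp add: img_def)
  have "vec.dim (kerp (img e) N 1) + (?p - 1) \<le> vec.dim (kerp (img e) N (1 + (?p - 1)))"
    using kerp_dim_ge[OF subspace_img st we _ w, of 1 "?p - 1"] nil assms(4) by simp
  also have "\<dots> \<le> ?p" unfolding rk_def by (rule vec.dim_subset) (auto simp: kerp_def)
  finally have d: "vec.dim (kerp (img e) N 1) \<le> 1" using assms(4) by simp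
  have v0S: "v0 \<in> img e" unfolding v0_def using mpow_stable[OF st we] .
  have "N *v v0 = mpow N (Suc (?p - 1)) *v (e *v w0)" unfolding v0_def
    by (simp add: matrix_vector_mul_assoc matrix_mul_assoc)
  then have v0k: "v0 \<in> kerp (img e) N 1" using nil assms(4) v0S by (simp add: kerp_def)
  have "v0 \<noteq> 0" using w v0_def by simp
  have "vec.span {v0} = kerp (img e) N 1"
  proof (rule vec.subspace_dim_equal)
    show "vec.span {v0} \<subseteq> kerp (img e) N 1"
      using v0k by (intro vec.span_minimal subspace_kerp[OF subspace_img]) simp
    show "vec.dim (kerp (img e) N 1) \<le> vec.dim (vec.span {v0})"
      using d \<open>v0 \<noteq> 0\<close> by simp
  qed (simp_all add: subspace_kerp[OF subspace_img])
  then show ?thesis using that \<open>v0 \<noteq> 0\<close> v0S by metis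
qed

text \<open>Two dimension counts: the kernel flag grows by at most one per step, so
  \<open>N^(rk e - 1)\<close> cannot vanish; and a vector on which the last nonzero power does not
  vanish generates a chain of length at most \<open>rk e\<close>.\<close>

lemma reg_nilpotent_if_ker_line:
  assumes e: "e ** e = e" and N: "corner e N" and nil: "mpow N m = 0"
    and line: "kerp (img e) N 1 \<subseteq> vec.span {v0}" and "rk e \<ge> 2"
  shows "reg_nilpotent N (rk e)"
proof -
  let ?p = "rk e"
  have st: "N *v v \<in> img e" for v by (rule corner_img[OF N])
  have full: "kerp (img e) N i = img e" if "mpow N i = 0" for i
    using that by (auto simp: kerp_def)
  have le: "vec.dim (kerp (img e) N i) \<le> i" for i
    by (rule kerp_dim_le[OF subspace_img st line])
  have 1: "mpow N (?p - 1) \<noteq> 0"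
    using full[of "?p - 1"] le[of "?p - 1"] assms(5) by (auto simp: rk_def)
  define k where "k = (LEAST k. mpow N k = 0)"
  have k: "mpow N k = 0" unfolding k_def by (rule LeastI[of _ m]) (rule nil)
  have "k \<noteq> 0"
  proof
    assume "k = 0"
    then have "(mat 1 :: 'a^'b^'b) = 0" using k by simp
    then show False using 1 mpow_add[of N "?p - 1" 0] by simp
  qed
  then have km: "mpow N (k - 1) \<noteq> 0" using not_less_Least[of "k - 1" "\<lambda>k. mpow N k = 0"] k_def by simp
  have "k \<le> ?p"
  proof (rule ccontr)
    assume "\<not> k \<le> ?p"
    then have "k - 1 > 0" using assms(5) by simp
    obtain w0 where w0: "mpow N (k - 1) *v w0 \<noteq> 0"
      using km by (metis matrix_eqI matrix_vector_mult_0)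
    have "mpow N (k - 1) ** e = mpow N (k - 1)"
      using corner_mpow[OF N, of "k - 1"] \<open>k - 1 > 0\<close> by (simp add: corner_def)
    then have w: "mpow N (k - 1) *v (e *v w0) \<noteq> 0"
      using w0 by (simp add: matrix_vector_mul_assoc)
    have we: "e *v w0 \<in> img e" by (simp add: img_def)
    have "k \<le> ?p" unfolding rk_def
      using cyclic_dim_le[OF subspace_img st we _ w] k by simp
    then show False using \<open>\<not> k \<le> ?p\<close> by simp
  qed
  then show ?thesis using 1 mpow_eq_0_mono[OF k] by (simp add: reg_nilpotent_def)
qed

text \<open>The section is built along the flag: a basis of \<open>C F_m\<close> is completed to one
  of \<open>C F_(m+1)\<close>, the section found so far is kept on the first part, and every new
  basis vector is lifted into \<open>F_(m+1)\<close>.\<close>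

lemma flag_section:
  fixes C :: "'k::field^'n^'n" and F :: "nat \<Rightarrow> ('k^'n) set"
  assumes F: "\<And>i. vec.subspace (F i)" and mono: "\<And>i. F i \<subseteq> F (Suc i)"
  shows "\<exists>s :: 'k^'n^'n. \<forall>i\<le>m. \<forall>w\<in>(*v) C ` F i. s *v w \<in> F i \<and> C *v (s *v w) = w"
proof (induction m)
  case 0
  obtain g where g: "g ` UNIV \<subseteq> F 0" "Vector_Spaces.linear (*s) (*s) g" "\<forall>v\<in>(*v) C ` F 0. C *v g v = v"
    using vec.linear_exists_right_inverse_on[OF matrix_vector_mul_linear_gen[of C] F[of 0]] by blast
  show ?case
    by (rule exI[of _ "matrix g"]) (use g in \<open>auto simp: matrix_works\<close>)
next
  case (Suc m)
  then obtain s where s: "\<And>i w. i \<le> m \<Longrightarrow> w \<in> (*v) C ` F i \<Longrightarrow> s *v w \<in> F i \<and> C *v (s *v w) = w"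
    by blast
  let ?U = "(*v) C ` F m" and ?V = "(*v) C ` F (Suc m)"
  have sub: "vec.subspace ?U" "vec.subspace ?V" by (intro vec.subspace_image F)+
  obtain B where B: "B \<subseteq> ?U" "vec.independent B" "?U \<subseteq> vec.span B"
    using vec.maximal_independent_subset by metis
  have "?U \<subseteq> ?V" using mono by blast
  then obtain B' where B': "B \<subseteq> B'" "B' \<subseteq> ?V" "vec.independent B'" "?V \<subseteq> vec.span B'"
    using vec.maximal_independent_subset_extend[OF order.trans[OF B(1) \<open>?U \<subseteq> ?V\<close>] B(2)] by blast
  define pre where "pre b = (if b \<in> B then s *v b else (SOME v. v \<in> F (Suc m) \<and> C *v v = b))" for b
  have pre: "pre b \<in> F (Suc m) \<and> C *v pre b = b" if "b \<in> B'" for b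
  proof (cases "b \<in> B")
    case True
    then show ?thesis using s[of m b] B mono by (auto simp: pre_def)
  next
    case False
    have "\<exists>v. v \<in> F (Suc m) \<and> C *v v = b" using that B' by force
    then show ?thesis using someI_ex[of "\<lambda>v. v \<in> F (Suc m) \<and> C *v v = b"] False
      by (simp add: pre_def)
  qed
  obtain g where g: "Vector_Spaces.linear (*s) (*s) g" "\<forall>b\<in>B'. g b = pre b"
    using vec.linear_independent_extend[OF B'(3), of pre] by blast
  define t where "t = matrix g"
  have t: "t *v b = pre b" if "b \<in> B'" for b
    using that g by (simp add: t_def matrix_works)
  have old: "t *v w = s *v w" if "w \<in> ?U" for w
  proof -
    have "w \<in> vec.span B" using that B by blast
    then show ?thesis
    proof (induction rule: vec.span_induct_alt)
      case (step c x y)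
      then have "t *v x = s *v x" using t B' by (auto simp: pre_def)
      then show ?case using step by (simp add: algebra_simps mv_scale)
    qed simp
  qed
  have new: "t *v w \<in> F (Suc m) \<and> C *v (t *v w) = w" if "w \<in> ?V" for w
  proof -
    have "w \<in> vec.span B'" using that B' by blast
    then show ?thesis
    proof (induction rule: vec.span_induct_alt)
      case base then show ?case by (simp add: vec.subspace_0[OF F])
    next
      case (step c x y)
      then show ?case using t[OF step(1)] pre[OF step(1)]
        by (simp add: algebra_simps mv_scale vec.subspace_add[OF F] vec.subspace_scale[OF F])
    qed
  qed
  show ?case
  proof (intro exI[of _ t] allI impI ballI)
    fix i w assume "i \<le> Suc m" and w: "w \<in> (*v) C ` F i"
    show "t *v w \<in> F i \<and> C *v (t *v w) = w"
    proof (cases "i = Suc m")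
      case True then show ?thesis using new w by simp
    next
      case False
      then have "i \<le> m" using \<open>i \<le> Suc m\<close> by simp
      have "F i \<subseteq> F m" using mono \<open>i \<le> m\<close> by (rule lift_Suc_mono_le)
      then have "w \<in> ?U" using w by blast
      then show ?thesis using old s[OF \<open>i \<le> m\<close> w] by simp
    qed
  qed
qed

section \<open>Orthogonal idempotents and the extension of a Jordan block\<close>

definition blocks :: "'k::field^'n^'n \<Rightarrow> 'k^'n^'n \<Rightarrow> bool" where
  "blocks e f \<longleftrightarrow> e ** e = e \<and> f ** f = f \<and> e ** f = 0 \<and> f ** e = 0"

lemma blocksD:
  assumes "blocks e f"
  shows "e ** e = e" "f ** f = f" "e ** f = 0" "f ** e = 0"
    "e ** (e ** X) = e ** X" "f ** (f ** X) = f ** X" "e ** (f ** X) = 0" "f ** (e ** X) = 0"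
  using assms by (auto simp: blocks_def matrix_mul_assoc)

lemma blocks_mv:
  assumes "blocks e f"
  shows "e *v (e *v v) = e *v v" "f *v (f *v v) = f *v v" "e *v (f *v v) = 0" "f *v (e *v v) = 0"
  using assms by (auto simp: blocks_def matrix_vector_mul_assoc)

lemma blocks_sum_idempotent: "blocks e f \<Longrightarrow> (e + f) ** (e + f) = e + f"
  by (simp add: matring blocksD)

lemma rk_sum:
  fixes e :: "'k::field_char_0^'n^'n"
  assumes "blocks e f" shows "rk (e + f) = rk e + rk f"
proof -
  have "of_nat (rk (e + f)) = (of_nat (rk e + rk f) :: 'k)"
    using trace_idempotent[OF blocks_sum_idempotent[OF assms]] trace_idempotent[of e]
      trace_idempotent[of f] assms by (simp add: trace_add blocks_def)
  then show ?thesis by (simp only: of_nat_eq_iff)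
qed

lemma reg_nilpotent_extend:
  fixes e f N C s0 :: "'k::field_char_0^'n^'n"
  assumes ef: "blocks e f" and N: "corner e N" and reg: "reg_nilpotent N (rk e)" and rk: "rk e \<ge> 2"
    and C: "f ** C = C" "C ** e = C" and s0: "e ** s0 = s0" "C ** s0 = f"
  obtains B where "e ** B = B" "B ** f = B" "reg_nilpotent (N + C + B) (rk e + rk f)"
proof -
  note efm = blocks_mv[OF ef]
  let ?F = "kerp (img e) N"
  have imge: "v \<in> img e \<longleftrightarrow> e *v v = v" for v by (rule img_iff[OF blocksD(1)[OF ef]])
  have Ff: "?F (rk e) = img e" using reg by (auto simp: kerp_def reg_nilpotent_def)
  \<comment> \<open>The given section \<open>s0\<close> serves to show that \<open>C\<close> is
    onto; it is replaced by a section that respects the kernels of the powers of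
    \<open>N\<close>.\<close>
  obtain t where t: "\<And>i w. i \<le> rk e \<Longrightarrow> w \<in> (*v) C ` ?F i \<Longrightarrow> t *v w \<in> ?F i \<and> C *v (t *v w) = w"
    using flag_section[where C = C and F = ?F and m = "rk e", OF subspace_kerp[OF subspace_img] kerp_mono]
    by auto
  define s where "s = t ** f"
  have sv: "s *v v = t *v (f *v v)" for v by (simp add: s_def matrix_vector_mul_assoc)
  have fC: "f *v (C *v v) = C *v v" for v using C by (simp add: matrix_vector_mul_assoc)
  have Ce: "C *v (e *v v) = C *v v" for v using C by (simp add: matrix_vector_mul_assoc)
  have eN: "e *v (N *v v) = N *v v" "N *v (e *v v) = N *v v" for v
    using N by (simp_all add: corner_def matrix_vector_mul_assoc)
  have Nf: "N *v (f *v v) = 0" for v by (metis eN(2) efm(3) vec.zero)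
  have Cf: "C *v (f *v v) = 0" for v by (metis Ce efm(3) vec.zero)
  have NC: "N *v (C *v v) = 0" "C *v (C *v v) = 0" for v using Nf Cf fC by metis+
  have eC: "e *v (C *v v) = 0" and fN: "f *v (N *v v) = 0" for v
    using efm(3)[of "C *v v"] efm(4)[of "N *v v"] fC[of v] eN(1)[of v] by simp_all
  have Cs0: "C *v (s0 *v v) = f *v v" for v using s0 by (simp add: matrix_vector_mul_assoc)
  have es0: "e *v (s0 *v v) = s0 *v v" for v using s0 by (simp add: matrix_vector_mul_assoc)
  have fv: "f *v v \<in> (*v) C ` img e" for v using Cs0 es0 by (metis image_eqI imge)
  have tf: "t *v (f *v v) \<in> img e \<and> C *v (t *v (f *v v)) = f *v v" for v
    using t[of "rk e" "f *v v"] fv Ff by simp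
  have es: "e *v (s *v v) = s *v v" "C *v (s *v v) = f *v v" for v
    using tf imge sv by auto
  have sF: "s *v (C *v v) \<in> ?F i" if "i \<le> rk e" "v \<in> ?F i" for i v
    using t[OF that(1), of "C *v v"] that(2) by (simp add: sv fC)
  define B where "B = N ** s"
  define y where "y = N + C + B"
  have yv: "y *v v = N *v v + C *v v + N *v (s *v v)" for v
    by (simp add: y_def B_def algebra_simps matrix_vector_mul_assoc)
  have sf: "s *v (f *v v) = s *v v" for v by (simp add: sv efm)
  have se: "s *v (e *v v) = 0" for v by (simp add: sv efm)
  have B: "e ** B = B" "B ** f = B"
    by (intro matrix_eqI, simp add: B_def matrix_vector_mul_assoc[symmetric] eN sf)+
  have cor: "corner (e + f) y" unfolding corner_def
    by (intro conjI matrix_eqI)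
      (simp_all add: matrix_vector_mul_assoc[symmetric] algebra_simps yv efm eN eC fN fC Ce Nf Cf NC sf se es)
  text \<open>With \<open>F\<^sub>i\<close> the kernels of the powers of \<open>N\<close>, two applications of \<open>y\<close> map
    \<open>F\<^sub>i + C F\<^sub>i\<close> into \<open>F\<^sub>i\<^sub>-\<^sub>1 + C F\<^sub>i\<^sub>-\<^sub>1\<close>, because \<open>s\<close> respects the flag.\<close>
  have nil: "mpow y (2 * i) *v (v + C *v v') = 0" if "i \<le> rk e" "v \<in> ?F i" "v' \<in> ?F i" for i v v'
    using that
  proof (induction i arbitrary: v v')
    case 0
    then show ?case by (simp add: kerp_def)
  next
    case (Suc i)
    have NF: "N *v u \<in> ?F i" if "u \<in> ?F (Suc i)" for u
      using that eN by (auto simp: kerp_def imge mpow_mv_commute matrix_vector_mul_assoc[symmetric])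
    define z where "z = N *v (s *v (C *v v'))"
    have z: "z \<in> ?F i" unfolding z_def by (intro NF sF Suc)
    define z' where "z' = N *v (s *v (C *v v))"
    have z': "z' \<in> ?F i" unfolding z'_def by (intro NF sF Suc)
    define x where "x = N *v v + z"
    have ev: "e *v v = v" using Suc.prems by (simp add: kerp_def imge)
    have sv0: "s *v v = 0" using se[of v] ev by simp
    have ex: "e *v x = x" by (simp add: x_def z_def algebra_simps eN)
    have sx0: "s *v x = 0" using se[of x] ex by simp
    have x: "x \<in> ?F i" unfolding x_def
      using NF[OF Suc.prems(2)] z vec.subspace_add[OF subspace_kerp[OF subspace_img]] by blast
    have y1: "y *v (v + C *v v') = x + C *v v"
      by (simp add: yv algebra_simps NC sv0 x_def z_def)
    have y2: "y *v (x + C *v v) = (N *v x + z') + C *v x"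
      by (simp add: yv algebra_simps NC sx0 z'_def)
    have "N *v x \<in> ?F i" using x kerp_mono[of i "Suc i" "img e" N] NF by auto
    then have "N *v x + z' \<in> ?F i"
      using z' vec.subspace_add[OF subspace_kerp[OF subspace_img]] by blast
    then have "mpow y (2 * i) *v ((N *v x + z') + C *v x) = 0"
      using Suc.IH x Suc.prems by simp
    moreover have "mpow y (2 * Suc i) *v u = mpow y (2 * i) *v (y *v (y *v u))" for u
      by (simp add: matrix_vector_mul_assoc[symmetric] mpow_mv_commute)
    ultimately show ?case using y1 y2 by simp
  qed
  have y0: "mpow y (2 * rk e) = 0"
  proof (rule matrix_eqI)
    fix v
    have "2 * rk e > 0" using rk by simp
    then have "mpow y (2 * rk e) ** (e + f) = mpow y (2 * rk e)"
      using corner_mpow[OF cor] by (simp add: corner_def)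
    then have "mpow y (2 * rk e) *v v = mpow y (2 * rk e) *v (e *v v + f *v v)"
      by (metis matrix_vector_mul_assoc matrix_vector_mult_add_rdistrib)
    moreover obtain v' where "v' \<in> img e" "f *v v = C *v v'" using fv by blast
    ultimately show "mpow y (2 * rk e) *v v = 0 *v v"
      using nil[of "rk e" "e *v v" v'] Ff by (simp add: img_def)
  qed
  obtain v0 where v0: "v0 \<noteq> 0" "v0 \<in> img e" "?F 1 = vec.span {v0}"
    using reg_nilpotent_ker_line[OF blocksD(1)[OF ef] N reg rk] by metis
  \<comment> \<open>The kernel of \<open>N\<close> is the first step of the flag, so
    \<open>s C\<close> preserves this line; \<open>C s = f\<close> then leaves only the factor
    1.\<close>
  have sC: "s *v (C *v v0) = v0" if "C *v v0 \<noteq> 0"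
  proof -
    have "s *v (C *v v0) \<in> ?F 1" using rk v0 vec.span_base by (intro sF) auto
    then obtain c where c: "s *v (C *v v0) = c *s v0" unfolding v0(3) by (auto simp: vec.span_singleton)
    have "C *v v0 = c *s (C *v v0)" using arg_cong[OF c, of "(*v) C"] by (simp add: es mv_scale fC)
    then have "c = 1" using that vec.scale_right_imp_eq[of "C *v v0" 1 c] by simp
    then show ?thesis using that c by simp
  qed
  \<comment> \<open>For \<open>x = v + w\<close> the \<open>f\<close>-part of \<open>y x = 0\<close>
    is \<open>C v = 0\<close>, and the rest is \<open>N (v + s w) = 0\<close>. Hence
    \<open>v + s w = c v0\<close>, and applying \<open>C\<close> gives \<open>w = c C v0\<close>. If
    \<open>C v0 = 0\<close> then \<open>w\<close> vanishes, otherwise \<open>v\<close> does.\<close>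
  have line: "kerp (img (e + f)) y 1 \<subseteq> vec.span {if C *v v0 = 0 then v0 else C *v v0}"
  proof
    fix x assume "x \<in> kerp (img (e + f)) y 1"
    then have x: "x = e *v x + f *v x" "y *v x = 0"
      using img_iff[OF blocks_sum_idempotent[OF ef]] by (auto simp: kerp_def algebra_simps)
    define v where "v = e *v x"
    define w where "w = f *v x"
    have vw: "x = v + w" "e *v v = v" "f *v w = w" "f *v v = 0" "e *v w = 0"
      using x(1) by (simp_all add: v_def w_def efm)
    have yx: "N *v (v + s *v w) + C *v v = 0"
      using x(2) vw Nf[of w] Cf[of w] se[of v] by (simp add: yv algebra_simps)
    have "C *v v = f *v (N *v (v + s *v w) + C *v v)"
      by (metis (no_types) eN(1) efm(4) fC matrix_vector_right_distrib add_0)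
    then have Cv: "C *v v = 0" using yx by simp
    then have "v + s *v w \<in> ?F 1" using yx vw by (simp add: kerp_def imge algebra_simps es)
    then obtain c where c: "v + s *v w = c *s v0" unfolding v0(3) by (auto simp: vec.span_singleton)
    have w: "w = c *s (C *v v0)"
      using arg_cong[OF c, of "(*v) C"] Cv by (simp add: algebra_simps mv_scale es vw)
    show "x \<in> vec.span {if C *v v0 = 0 then v0 else C *v v0}"
    proof (cases "C *v v0 = 0")
      case True
      then have "x = c *s v0" using w c vw(1) by simp
      then show ?thesis using True by (auto simp: vec.span_singleton)
    next
      case False
      then have "s *v w = c *s v0" using w sC by (simp add: mv_scale)
      then have "v = 0" using c by simp
      then have "x = c *s (C *v v0)" using w vw(1) by simp
      then show ?thesis using False by (auto simp: vec.span_singleton)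
    qed
  qed
  have "reg_nilpotent y (rk (e + f))"
    by (rule reg_nilpotent_if_ker_line[OF blocks_sum_idempotent[OF ef] cor y0 line])
      (simp add: rk_sum[OF ef] rk trans_le_add1)
  then show ?thesis using that B rk_sum[OF ef] unfolding y_def by metis
qed

section \<open>Stabilizers of functionals on a maximal parabolic\<close>

text \<open>Half of rank-nullity on a subspace, placed in the locale of pairs because it is applied
  to maps of vectors, to maps of matrices and to the evaluation of matrices at a vector.\<close>

lemma (in finite_dimensional_vector_space_pair) dim_le_kernel_image:
  assumes lf: "Vector_Spaces.linear s1 s2 f" and V: "vs1.subspace V"
  shows "vs1.dim V \<le> vs1.dim {v\<in>V. f v = 0} + vs2.dim (f ` V)"
proof -
  interpret lf: Vector_Spaces.linear s1 s2 f by fact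
  let ?K = "{v\<in>V. f v = 0}"
  obtain g where g: "g ` UNIV \<subseteq> V" "Vector_Spaces.linear s2 s1 g" "\<forall>w\<in>f ` V. f (g w) = w"
    using linear_exists_right_inverse_on[OF lf V] by blast
  interpret lg: Vector_Spaces.linear s2 s1 g by fact
  obtain B where B: "B \<subseteq> f ` V" "vs2.independent B" "f ` V \<subseteq> vs2.span B" "card B = vs2.dim (f ` V)"
    using vs2.basis_exists[of "f ` V"] by blast
  obtain A where A: "A \<subseteq> ?K" "vs1.independent A" "?K \<subseteq> vs1.span A" "card A = vs1.dim ?K"
    using vs1.basis_exists[of ?K] by blast
  have fin: "finite A" "finite B" using A B vs1.finiteI_independent vs2.finiteI_independent by auto
  have "V \<subseteq> vs1.span (A \<union> g ` B)"
  proof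
    fix v assume v: "v \<in> V"
    have "v - g (f v) \<in> ?K" using v g V by (auto simp: lf.diff intro!: vs1.subspace_diff)
    then have 1: "v - g (f v) \<in> vs1.span (A \<union> g ` B)"
      using A(3) vs1.span_mono[of A "A \<union> g ` B"] by blast
    have "f v \<in> vs2.span B" using v B by blast
    then have "g (f v) \<in> vs1.span (g ` B)" unfolding lg.span_image by blast
    then have 2: "g (f v) \<in> vs1.span (A \<union> g ` B)"
      using vs1.span_mono[of "g ` B" "A \<union> g ` B"] by blast
    show "v \<in> vs1.span (A \<union> g ` B)" using vs1.span_add[OF 1 2] by simp
  qed
  then have "vs1.dim V \<le> card (A \<union> g ` B)" using fin by (intro vs1.dim_le_card) auto
  also have "\<dots> \<le> card A + card (g ` B)" by (rule card_Un_le)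
  also have "\<dots> \<le> card A + card B" using card_image_le[OF fin(2)] by simp
  finally show ?thesis using A B by simp
qed

text \<open>For \<open>e + f = 1\<close> this is the stabilizer of the functional given by the trace form and \<open>y\<close> on
  the derived algebra of the parabolic \<open>f x e = 0\<close>. The corner condition allows the descent to stay
  inside one matrix algebra.\<close>

definition pstab :: "'k::field^'n^'n \<Rightarrow> 'k^'n^'n \<Rightarrow> 'k^'n^'n \<Rightarrow> ('k^'n^'n) set" where
  "pstab e f y = {x. corner (e + f) x \<and> f ** x ** e = 0 \<and> trace (e ** x) = 0 \<and> trace (f ** x) = 0 \<and>
     f ** bracket x y ** e = 0 \<and> (\<exists>\<alpha>. e ** bracket x y ** e = mscale \<alpha> e) \<and>
     (\<exists>\<beta>. f ** bracket x y ** f = mscale \<beta> f)}"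

text \<open>Dimension at most one, phrased elementwise: in this form it passes along linear maps by
  \<open>thin_transfer\<close>, and \<open>thin_iff_dim_le_1\<close> translates it back.\<close>

definition thin :: "('k::field^'n^'n) set \<Rightarrow> bool" where
  "thin S \<longleftrightarrow> (\<forall>x\<in>S. \<forall>x'\<in>S. \<exists>c d. (c \<noteq> 0 \<or> d \<noteq> 0) \<and> mscale c x + mscale d x' = 0)"

lemma corner_sum_mult:
  assumes "corner (e + f) x"
  shows "A ** x ** B = A ** x ** (e ** B) + A ** x ** (f ** B)"
    and "A ** x ** B = A ** e ** x ** B + A ** f ** x ** B"
proof -
  have "A ** x ** B = A ** (x ** (e + f)) ** B" "A ** x ** B = A ** ((e + f) ** x) ** B"
    using assms by (simp_all add: corner_def)
  then show "A ** x ** B = A ** x ** (e ** B) + A ** x ** (f ** B)"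
    and "A ** x ** B = A ** e ** x ** B + A ** f ** x ** B"
    by (simp_all add: matring)
qed

lemma corner_decomp:
  assumes "corner (e + f) x"
  shows "x = e ** x ** e + e ** x ** f + f ** x ** e + f ** x ** f"
proof -
  have "x = (e + f) ** (x ** (e + f))" using assms by (simp add: corner_def)
  then show ?thesis by (simp add: matring algebra_simps)
qed

text \<open>Because \<open>f x e = 0\<close>, the block \<open>e y f\<close> drops out of all three
  components, in accordance with its being invisible to the functional.\<close>

lemma bracket_blocks:
  assumes ef: "blocks e f" and x: "corner (e + f) x" and 0: "f ** x ** e = 0"
  shows "e ** bracket x y ** e = bracket (e ** x ** e) (e ** y ** e) + (e ** x ** f) ** (f ** y ** e)"
    and "f ** bracket x y ** e = (f ** x ** f) ** (f ** y ** e) - (f ** y ** e) ** (e ** x ** e)"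
    and "f ** bracket x y ** f = bracket (f ** x ** f) (f ** y ** f) - (f ** y ** e) ** (e ** x ** f)"
proof -
  have z: "f ** (x ** e) = 0" using 0 by (simp add: matring)
  have zz: "f ** (x ** (e ** z)) = 0" for z :: "'a^'b^'b"
    using 0 by (simp add: matrix_mul_assoc)
  have 1: "x ** (y ** z) = x ** (e ** (y ** z)) + x ** (f ** (y ** z))" for z
    using corner_sum_mult(1)[OF x, of "mat 1" "y ** z"] by simp
  have 2: "y ** (x ** z) = y ** (e ** (x ** z)) + y ** (f ** (x ** z))" for z
    using corner_sum_mult(2)[OF x, of y z] by (simp add: matring)
  show "e ** bracket x y ** e = bracket (e ** x ** e) (e ** y ** e) + (e ** x ** f) ** (f ** y ** e)"
    by (simp add: matring bracket_def 1[of e] 2[of e] z zz blocksD[OF ef])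
  show "f ** bracket x y ** e = (f ** x ** f) ** (f ** y ** e) - (f ** y ** e) ** (e ** x ** e)"
    by (simp add: matring bracket_def 1[of e] 2[of e] z zz blocksD[OF ef])
  show "f ** bracket x y ** f = bracket (f ** x ** f) (f ** y ** f) - (f ** y ** e) ** (e ** x ** f)"
    by (simp add: matring bracket_def 1[of f] 2[of f] z zz blocksD[OF ef])
qed

lemma trace_idem: "e ** e = e \<Longrightarrow> trace (e ** x ** e) = trace (e ** (x :: 'k::field^'n^'n))"
  by (subst trace_mul_sym) (simp add: matrix_mul_assoc)

lemma blocks_zero:
  assumes ef: "blocks e f"
  shows "e ** X = X \<Longrightarrow> f ** X = 0" "f ** X = X \<Longrightarrow> e ** X = 0"
    "X ** e = X \<Longrightarrow> X ** f = 0" "X ** f = X \<Longrightarrow> X ** e = 0"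
proof -
  show "f ** X = 0" if "e ** X = X" using blocksD(8)[OF ef, of X] that by simp
  show "e ** X = 0" if "f ** X = X" using blocksD(7)[OF ef, of X] that by simp
  show "X ** f = 0" if "X ** e = X"
    using matrix_mul_assoc[of X e f] that by (simp add: blocksD[OF ef])
  show "X ** e = 0" if "X ** f = X"
    using matrix_mul_assoc[of X f e] that by (simp add: blocksD[OF ef])
qed

text \<open>Coordinates for the stabilizer. With \<open>C = f y e\<close>, the middle equation says
  that \<open>C\<close> intertwines \<open>a\<close> and \<open>b\<close>. Once \<open>C\<close> has
  a right inverse, \<open>a\<close> determines \<open>b\<close>, and together with
  \<open>\<alpha>\<close> also \<open>U\<close>; the descent rests on this.\<close>

lemma pstabI:
  assumes ef: "blocks e f"
    and a: "e ** a = a" "a ** e = a" and U: "e ** U = U" "U ** f = U" and b: "f ** b = b" "b ** f = b"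
    and tr: "trace a = 0" "trace b = 0"
    and eqs: "bracket a (e ** y ** e) + U ** (f ** y ** e) = mscale \<alpha> e"
      "b ** (f ** y ** e) = (f ** y ** e) ** a"
      "bracket b (f ** y ** f) - (f ** y ** e) ** U = mscale \<beta> f"
  shows "a + U + b \<in> pstab e f y"
proof -
  let ?x = "a + U + b"
  have z: "f ** a = 0" "a ** f = 0" "f ** U = 0" "U ** e = 0" "e ** b = 0" "b ** e = 0"
    using a U b blocks_zero[OF ef] by simp_all
  have c: "corner (e + f) ?x" by (simp add: corner_def matring a U b z)
  have comp: "e ** ?x ** e = a" "e ** ?x ** f = U" "f ** ?x ** e = 0" "f ** ?x ** f = b"
    by (simp_all add: matring a U b z)
  have left: "e ** ?x = a + U" "f ** ?x = b" by (simp_all add: matring a U b z)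
  have trU: "trace U = 0" using trace_mul_sym[of U f] U z by simp
  show ?thesis
    unfolding pstab_def mem_Collect_eq bracket_blocks[OF ef c comp(3), of y] comp
    unfolding left
    using c eqs by (auto simp: trace_add tr trU)
qed

lemma pstabD:
  assumes ef: "blocks e f" and x: "x \<in> pstab e f y"
  obtains a U b \<alpha> \<beta> where "x = a + U + b" "a = e ** x ** e" "b = f ** x ** f" "U = e ** x ** f"
    "e ** a = a" "a ** e = a" "e ** U = U" "U ** f = U" "f ** b = b" "b ** f = b"
    "trace a = 0" "trace b = 0"
    "bracket a (e ** y ** e) + U ** (f ** y ** e) = mscale \<alpha> e"
    "b ** (f ** y ** e) = (f ** y ** e) ** a"
    "bracket b (f ** y ** f) - (f ** y ** e) ** U = mscale \<beta> f"
proof -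
  have c: "corner (e + f) x" and 0: "f ** x ** e = 0" using x by (auto simp: pstab_def)
  obtain \<alpha> \<beta> where "e ** bracket x y ** e = mscale \<alpha> e" "f ** bracket x y ** f = mscale \<beta> f"
    using x by (auto simp: pstab_def)
  moreover have "f ** bracket x y ** e = 0" "trace (e ** x) = 0" "trace (f ** x) = 0"
    using x by (auto simp: pstab_def)
  ultimately have eqs: "bracket (e ** x ** e) (e ** y ** e) + (e ** x ** f) ** (f ** y ** e) = mscale \<alpha> e"
    "(f ** x ** f) ** (f ** y ** e) - (f ** y ** e) ** (e ** x ** e) = 0"
    "bracket (f ** x ** f) (f ** y ** f) - (f ** y ** e) ** (e ** x ** f) = mscale \<beta> f"
    "trace (e ** x ** e) = 0" "trace (f ** x ** f) = 0"
    using bracket_blocks[OF ef c 0, of y] trace_idem[OF blocksD(1)[OF ef], of x]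
      trace_idem[OF blocksD(2)[OF ef], of x] by simp_all
  show ?thesis
  proof (rule that[of "e ** x ** e" "e ** x ** f" "f ** x ** f" \<alpha> \<beta>])
    show "x = e ** x ** e + e ** x ** f + f ** x ** f"
      using corner_decomp[OF c] 0 by simp
  qed (use eqs in \<open>simp_all add: matrix_mul_assoc[symmetric] blocksD[OF ef]\<close>)
qed

lemma corner_add: "corner e x \<Longrightarrow> corner e x' \<Longrightarrow> corner e (x + x')"
  by (simp add: corner_def matrix_add_ldistrib matrix_add_rdistrib)

lemma corner_mscale: "corner e x \<Longrightarrow> corner e (mscale c x)"
  by (simp add: corner_def mscale_mult_left mscale_mult_right)

lemma pstab_subspace: "matvs.subspace (pstab e f y)"
proof (rule matvs.subspaceI)
  show "0 \<in> pstab e f y"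
    by (auto simp: pstab_def corner_def bracket_def intro: exI[of _ 0])
next
  fix x x' assume "x \<in> pstab e f y" "x' \<in> pstab e f y"
  moreover have "bracket (x + x') y = bracket x y + bracket x' y"
    by (simp add: bracket_def matring)
  ultimately show "x + x' \<in> pstab e f y"
    by (auto simp: pstab_def corner_add matring trace_lin) (auto simp flip: matvs.scale_left_distrib)
next
  fix c x assume "x \<in> pstab e f y"
  moreover have "bracket (mscale c x) y = mscale c (bracket x y)"
    by (simp add: bracket_def matring mscale_distrib)
  ultimately show "mscale c x \<in> pstab e f y"
    by (auto simp: pstab_def corner_mscale matring trace_lin)
qed

lemma thin_transfer:
  assumes "thin S" and "\<And>x. x \<in> T \<Longrightarrow> \<exists>x'\<in>S. g x' = x"
    and "\<And>c d x x'. g (mscale c x + mscale d x') = mscale c (g x) + mscale d (g x')" and "g 0 = 0"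
  shows "thin T"
  unfolding thin_def
proof (intro ballI)
  fix x x' assume "x \<in> T" "x' \<in> T"
  then obtain u u' where u: "u \<in> S" "u' \<in> S" "g u = x" "g u' = x'" using assms by metis
  then obtain c d where "c \<noteq> 0 \<or> d \<noteq> 0" "mscale c u + mscale d u' = 0"
    using \<open>thin S\<close> unfolding thin_def by blast
  then show "\<exists>c d. (c \<noteq> 0 \<or> d \<noteq> 0) \<and> mscale c x + mscale d x' = 0"
    using assms(3,4) u by metis
qed

lemma blocks_transpose: "blocks e f \<Longrightarrow> blocks (transpose f) (transpose e)"
  by (simp add: blocks_def matrix_transpose_mul[symmetric] transpose_zero)

lemma corner_transpose: "corner e x \<Longrightarrow> corner (transpose e) (transpose x)"
  by (simp add: corner_def matrix_transpose_mul[symmetric])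

lemma transpose3: "transpose (A ** B ** (C :: 'k::field^'n^'n)) = transpose C ** transpose B ** transpose A"
  by (simp add: matrix_transpose_mul matrix_mul_assoc)

text \<open>Transposition reverses products, so it exchanges the roles of the two blocks and thereby
  their sizes, while a commutator of transposes is the transposed commutator up to sign.\<close>

lemma pstab_transpose:
  assumes "x \<in> pstab e f y"
  shows "transpose x \<in> pstab (transpose f) (transpose e) (transpose y)"
proof -
  have b: "bracket (transpose x) (transpose y) = transpose (- bracket x y)"
    by (simp add: bracket_def matrix_transpose_mul transpose_diff)
  have t: "transpose f ** transpose x = transpose (x ** f)" "transpose e ** transpose x = transpose (x ** e)"
    by (simp_all add: matrix_transpose_mul)
  have "transpose e ** transpose (- B) ** transpose f = transpose (- (f ** B ** e))"
    "transpose e ** transpose (- B) ** transpose e = transpose (- (e ** B ** e))"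
    "transpose f ** transpose (- B) ** transpose f = transpose (- (f ** B ** f))" for B
    by (simp_all only: transpose3[symmetric] matrix_neg_left matrix_neg_right)
  note neg = this
  obtain \<alpha> \<beta> where ab: "e ** bracket x y ** e = mscale \<alpha> e" "f ** bracket x y ** f = mscale \<beta> f"
    using assms by (auto simp: pstab_def)
  have x: "corner (e + f) x" "f ** x ** e = 0" "trace (e ** x) = 0" "trace (f ** x) = 0"
    "f ** bracket x y ** e = 0"
    using assms by (auto simp: pstab_def)
  have m: "transpose (- mscale c A) = mscale (- c) (transpose A)" for c and A :: "'a^'b^'b"
    by (simp add: transpose_def mscale_def vec_eq_iff)
  have "corner (transpose f + transpose e) (transpose x)"
    using corner_transpose[OF x(1)] by (simp add: transpose_add add.commute)
  moreover have "transpose e ** transpose x ** transpose f = 0"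
    unfolding transpose3[symmetric] x(2) transpose_zero ..
  moreover have "trace (transpose f ** transpose x) = 0" "trace (transpose e ** transpose x) = 0"
    using x(3,4) by (simp_all only: t trace_transpose trace_mul_sym[of x])
  ultimately show ?thesis
    unfolding pstab_def b neg mem_Collect_eq ab x m
    by (simp add: transpose_zero del: matvs.scale_minus_left matvs.scale_minus_right)
qed

lemma thin_pstab_transpose:
  assumes "thin (pstab e f y)"
  shows "thin (pstab (transpose f) (transpose e) (transpose y))"
proof (rule thin_transfer[OF assms])
  fix x assume "x \<in> pstab (transpose f) (transpose e) (transpose y)"
  from pstab_transpose[OF this] show "\<exists>x'\<in>pstab e f y. transpose x' = x"
    by (intro bexI[of _ "transpose x"]) simp_all
qed (simp_all add: transpose_add transpose_mscale transpose_zero)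

lemma rk_transpose:
  fixes e :: "'k::field_char_0^'n^'n"
  assumes "e ** e = e" shows "rk (transpose e) = rk e"
  by (rule rk_eqI) (use assms in \<open>simp_all add: matrix_transpose_mul[symmetric] trace_transpose\<close>)

lemma dim_ge_2_independent:
  fixes S :: "('k::field^'n) set"
  assumes S: "vec.subspace S" and "vec.dim S \<ge> 2"
  obtains v1 v2 where "v1 \<in> S" "v2 \<in> S" "v1 \<noteq> 0" "v2 \<notin> vec.span {v1}"
proof -
  have "\<not> S \<subseteq> {0}" using assms(2) vec.dim_eq_0[of S] by linarith
  then obtain v1 where v1: "v1 \<in> S" "v1 \<noteq> 0" by blast
  have "\<not> S \<subseteq> vec.span {v1}"
    using assms(2) vec.dim_mono[of S "{v1}"] vec.dim_singleton[of v1] by (auto split: if_splits)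
  then show ?thesis using that v1 by blast
qed

text \<open>If \<open>C\<close> misses part of the image of \<open>f\<close>, its rank is below
  \<open>rk f < rk e\<close>, so its kernel in the image of \<open>e\<close> has dimension at least
  two. A covector \<open>\<phi>\<close> vanishing on the image of \<open>C\<close> makes every
  \<open>outer v \<phi>\<close> with \<open>v\<close> in this kernel stabilizing, and two
  independent choices of \<open>v\<close> contradict thinness.\<close>

lemma thin_imp_right_inverse:
  fixes e f y :: "'k::field^'n^'n"
  assumes ef: "blocks e f" and thin: "thin (pstab e f y)" and gt: "rk f < rk e"
  obtains s where "e ** s = s" "s ** f = s" "(f ** y ** e) ** s = f"
proof -
  define C where "C = f ** y ** e"
  have C: "f ** C = C" "C ** e = C"
    by (simp_all add: C_def matrix_mul_assoc[symmetric] blocksD[OF ef])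
  let ?I = "(*v) C ` img e"
  have sub: "vec.subspace ?I" by (intro vec.subspace_image subspace_img)
  have imge: "v \<in> img e \<longleftrightarrow> e *v v = v" and imgf: "v \<in> img f \<longleftrightarrow> f *v v = v" for v
    by (rule img_iff, simp add: blocksD[OF ef])+
  have If: "?I \<subseteq> img f" using C by (auto simp: imgf matrix_vector_mul_assoc)
  have full: "img f \<subseteq> ?I"
  proof (rule ccontr)
    assume "\<not> img f \<subseteq> ?I"
    then obtain w where w: "w \<in> img f" "w \<notin> ?I" by blast
    obtain \<psi> where \<psi>: "\<forall>u\<in>?I. dotp \<psi> u = 0" "dotp \<psi> w = 1"
      using separating_functional[OF sub w(2)] by blast
    let ?K = "{v \<in> img e. C *v v = 0}"
    have "?I \<subset> img f" using If w by blast
    then have "vec.dim ?I < rk f" unfolding rk_def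
      using vec.dim_psubset[of ?I "img f"] vec.span_eq_iff sub subspace_img by metis
    moreover have "rk e \<le> vec.dim ?K + vec.dim ?I"
      unfolding rk_def by (rule vec.dim_le_kernel_image[OF matrix_vector_mul_linear_gen subspace_img])
    ultimately have K2: "vec.dim ?K \<ge> 2" using gt by simp
    have K1: "vec.subspace ?K"
      using subspace_img[of e] by (auto simp: vec.subspace_def algebra_simps mv_scale)
    obtain v1 v2 where v: "v1 \<in> ?K" "v2 \<in> ?K" "v1 \<noteq> 0" "v2 \<notin> vec.span {v1}"
      by (rule dim_ge_2_independent[OF K1 K2])
    \<comment> \<open>Multiplication by \<open>f\<close> puts \<open>outer v \<phi>\<close> into
      \<open>e gl f\<close> without changing the value at \<open>w\<close>, which lies in the image
      of \<open>f\<close>.\<close>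
    define \<phi> where "\<phi> = \<psi> v* f"
    have "\<phi> v* f = \<phi>" by (simp add: \<phi>_def vector_matrix_mul_assoc blocksD[OF ef])
    have "\<psi> v* C = 0"
    proof (rule ccontr)
      assume "\<psi> v* C \<noteq> 0"
      then obtain u where "dotp u (\<psi> v* C) = 1" using exists_dotp_one by blast
      then have "dotp \<psi> (C *v (e *v u)) = 1"
        using C by (simp add: dotp_commute[of u "\<psi> v* C"] dotp_vm matrix_vector_mul_assoc)
      moreover have "C *v (e *v u) \<in> ?I" by (auto simp: img_def)
      ultimately show False using \<psi> by simp
    qed
    then have "\<phi> v* C = 0" using C by (simp add: \<phi>_def vector_matrix_mul_assoc)
    have in_stab: "outer v \<phi> \<in> pstab e f y" if "v \<in> ?K" for v
    proof -
      have "0 + outer v \<phi> + 0 \<in> pstab e f y"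
        using that \<open>\<phi> v* f = \<phi>\<close> \<open>\<phi> v* C = 0\<close> C_def
        by (intro pstabI[OF ef, where \<alpha> = 0 and \<beta> = 0])
          (auto simp: bracket_def outer_mult mult_outer imge outer_eq_0_iff)
      then show ?thesis by simp
    qed
    obtain c d where cd: "c \<noteq> 0 \<or> d \<noteq> 0" "mscale c (outer v1 \<phi>) + mscale d (outer v2 \<phi>) = 0"
      using thin in_stab[OF v(1)] in_stab[OF v(2)] unfolding thin_def by blast
    have "dotp \<phi> w = 1" using w \<psi> by (simp add: \<phi>_def dotp_vm imgf)
    then have eq: "c *s v1 + d *s v2 = 0"
      using arg_cong[OF cd(2), of "\<lambda>A. A *v w"] by (simp add: algebra_simps mscale_mv outer_mv)
    have "d \<noteq> 0"
    proof
      assume "d = 0"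
      then show False using eq cd v(3) by simp
    qed
    have "d *s v2 = (- c) *s v1" using eq by (simp add: eq_neg_iff_add_eq_0 add.commute)
    then have "(1 / d) *s (d *s v2) = (1 / d) *s ((- c) *s v1)" by simp
    then have "v2 = (- c / d) *s v1" using \<open>d \<noteq> 0\<close> by (simp add: vec.scale_scale)
    moreover have "(- c / d) *s v1 \<in> vec.span {v1}"
      by (intro vec.span_scale vec.span_base) simp
    ultimately show False using v(4) by simp
  qed
  obtain g where g: "g ` UNIV \<subseteq> img e" "Vector_Spaces.linear (*s) (*s) g" "\<forall>w\<in>?I. C *v g w = w"
    using vec.linear_exists_right_inverse_on[OF matrix_vector_mul_linear_gen[of C] subspace_img[of e]]
    by blast
  define s where "s = matrix g ** f"
  have s: "s *v v = g (f *v v)" for v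
    by (simp add: s_def matrix_vector_mul_assoc[symmetric] matrix_works[OF g(2)])
  show ?thesis
  proof (rule that[of s])
    show "e ** s = s" using g(1) imge by (intro matrix_eqI) (auto simp: matrix_vector_mul_assoc[symmetric] s)
    show "s ** f = s" by (simp add: s_def matrix_mul_assoc[symmetric] blocksD[OF ef])
    show "f ** y ** e ** s = f"
      unfolding C_def[symmetric]
    proof (rule matrix_eqI)
      fix v have "f *v v \<in> ?I" using full by (auto simp: img_def)
      then have "C *v g (f *v v) = f *v v" using g(3) by blast
      then show "C ** s *v v = f *v v" by (simp add: matrix_vector_mul_assoc[symmetric] s)
    qed
  qed
qed

section \<open>Euclidean descent\<close>

text \<open>One step of the Euclidean algorithm: a section \<open>s\<close> of the off-diagonal block \<open>C\<close> splits the
  larger block \<open>e\<close> into \<open>e - s C\<close> and the copy \<open>s C\<close> of \<open>f\<close>.\<close>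

lemma refine_blocks:
  assumes ef: "blocks e f" and C: "f ** C = C" "C ** e = C"
    and s: "e ** s = s" "s ** f = s" "C ** s = f"
  shows "blocks (e - s ** C) (s ** C)" and "trace (s ** C) = trace f"
    and "trace (e - s ** C) = trace e - trace f"
proof -
  have sC: "e ** (s ** C) = s ** C" "(s ** C) ** e = s ** C" "(s ** C) ** (s ** C) = s ** C"
    by (simp_all add: matrix_mul_assoc[symmetric] C s mult_assoc_eq[OF s(3)] mult_assoc_eq[OF s(1)])
  then show "blocks (e - s ** C) (s ** C)"
    by (simp add: blocks_def matrix_diff_ldistrib matrix_diff_rdistrib blocksD[OF ef])
  show "trace (s ** C) = trace f" by (simp add: trace_mul_sym[of s] s)
  then show "trace (e - s ** C) = trace e - trace f" by (simp add: trace_sub)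
qed

lemma rk_refine:
  fixes e :: "'k::field_char_0^'n^'n"
  assumes ef: "blocks e f" and C: "f ** C = C" "C ** e = C"
    and s: "e ** s = s" "s ** f = s" "C ** s = f" and "rk f \<le> rk e"
  shows "rk (e - s ** C) = rk e - rk f" "rk (s ** C) = rk f"
proof -
  note b = refine_blocks[OF ef C s]
  show 1: "rk (s ** C) = rk f" by (rule rk_eqI) (use b in \<open>auto simp: blocks_def blocksD[OF ef]\<close>)
  have "rk (e - s ** C + s ** C) = rk (e - s ** C) + rk (s ** C)"
    by (rule rk_sum[OF b(1)])
  then show "rk (e - s ** C) = rk e - rk f" using 1 by simp
qed

text \<open>With \<open>u = s (f y f)\<close>, the matrix \<open>A\<close> is the
  \<open>e\<close>-block of \<open>(1 + u) y (1 - u)\<close>, whose \<open>f\<close>-block is zero.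
  Thinness is inherited because every element of the smaller stabilizer is the
  \<open>e\<close>-block of an element of the larger one.\<close>

lemma pstab_reduce:
  fixes e f y :: "'k::field^'n^'n"
  assumes ef: "blocks e f" and s: "e ** s = s" "s ** f = s" "(f ** y ** e) ** s = f"
    and thin: "thin (pstab e f y)"
  defines "C \<equiv> f ** y ** e"
  defines "A \<equiv> e ** y ** e + s ** (f ** y ** f) ** C"
  shows "thin (pstab (e - s ** C) (s ** C) A)"
proof (rule thin_transfer[OF thin])
  have C: "f ** C = C" "C ** e = C" by (simp_all add: C_def matring blocksD[OF ef])
  have Cs: "C ** s = f" using s(3) by (simp add: C_def)
  note CsX = mult_assoc_eq[OF Cs]
  define f' where "f' = s ** C"
  define e' where "e' = e - s ** C"
  have b': "blocks e' f'" unfolding e'_def f'_def by (rule refine_blocks(1)[OF ef C s(1,2) Cs])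
  have e'f': "e' + f' = e" by (simp add: e'_def f'_def)
  define a where "a = e ** y ** e"
  define d where "d = f ** y ** f"
  define u where "u = s ** d"
  have d: "f ** d = d" "d ** f = d" by (simp_all add: d_def matring blocksD[OF ef])
  have a: "e ** a = a" "a ** e = a" by (simp_all add: a_def matring blocksD[OF ef])
  have u: "e ** u = u" "u ** f = u" "C ** u = d"
    by (simp_all add: u_def matrix_mul_assoc s Cs d) (simp add: d matrix_mul_assoc[symmetric])
  have A: "A = a + u ** C" by (simp add: A_def a_def u_def d_def C_def)
  fix x assume "x \<in> pstab (e - s ** C) (s ** C) A"
  then have x: "x \<in> pstab e' f' A" by (simp add: e'_def f'_def)
  then have cx: "e ** x = x" "x ** e = x" and fxe: "f' ** x ** e' = 0"
    and trx: "trace (e' ** x) = 0" "trace (f' ** x) = 0"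
    by (auto simp: pstab_def corner_def e'f')
  define X where "X = bracket x A"
  obtain \<alpha> \<beta> where X: "f' ** X ** e' = 0" "e' ** X ** e' = mscale \<alpha> e'" "f' ** X ** f' = mscale \<beta> f'"
    using x by (auto simp: pstab_def X_def)
  have eA: "e ** A = A" "A ** e = A"
    by (simp_all add: A matrix_add_ldistrib matrix_add_rdistrib a matrix_mul_assoc u)
      (simp add: matrix_mul_assoc[symmetric] C)
  have eX: "e ** X = X" "X ** e = X"
    using cx eA unfolding X_def bracket_def
    by (simp_all add: matrix_diff_ldistrib matrix_diff_rdistrib matrix_mul_assoc)
      (simp_all add: matrix_mul_assoc[symmetric])
  have Cf': "C ** f' = C" by (simp add: f'_def CsX C)
  have f's: "f' ** s = s" by (simp add: f'_def matring Cs s)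
  have Ce': "C ** e' = 0" using Cf' e'f' C(2) by (simp add: e'_def f'_def matring)
  have Xe': "X ** e' = mscale \<alpha> e'"
  proof -
    have "X ** e' = (e' + f') ** X ** e'" by (simp add: e'f' eX)
    then show ?thesis using X by (simp add: matrix_add_rdistrib)
  qed
  \<comment> \<open>Forced by the intertwining relation \<open>b C = C x\<close>, multiplied by
    \<open>s\<close>. The relation itself holds because \<open>f' x e' = 0\<close> lets
    \<open>C x\<close> factor through \<open>f' = s C\<close>.\<close>
  define b where "b = C ** x ** s"
  have bC: "b ** C = C ** x"
  proof -
    have "C ** x ** e' = C ** (f' ** x ** e')"
      by (simp add: matrix_mul_assoc Cf')
    then have "C ** x ** e' = 0" by (simp add: fxe)
    moreover have "C ** x = C ** x ** e' + C ** x ** f'"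
      by (simp add: matrix_add_ldistrib[symmetric] e'f' matrix_mul_assoc[symmetric] cx)
    ultimately show ?thesis by (simp add: b_def f'_def matrix_mul_assoc)
  qed
  define v where "v = mscale \<alpha> s - X ** s"
  have vC: "v ** C = mscale \<alpha> e - X"
  proof -
    have "v ** C = mscale \<alpha> f' - X ** f'"
      by (simp add: v_def matrix_diff_rdistrib mscale_mult_left f'_def matrix_mul_assoc)
    also have "\<dots> = mscale \<alpha> (e - e') - X ** (e - e')" by (simp add: e'_def f'_def)
    also have "\<dots> = mscale \<alpha> e - X"
      by (simp add: matrix_diff_ldistrib Xe' eX mscale_distrib)
    finally show ?thesis .
  qed
  have Cv: "C ** v = mscale (\<alpha> - \<beta>) f"
  proof -
    have "C ** X ** s = C ** (f' ** X ** f') ** s"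
      by (simp add: matrix_mul_assoc Cf') (simp add: matrix_mul_assoc[symmetric] f's)
    also have "\<dots> = mscale \<beta> f"
      by (simp add: X mscale_mult_left mscale_mult_right Cf' Cs)
    finally show ?thesis
      by (simp add: v_def matrix_diff_ldistrib mscale_mult_right Cs matrix_mul_assoc mscale_distrib)
  qed
  \<comment> \<open>This is the \<open>e gl f\<close> block of
    \<open>(1 - u) (x + v + b) (1 + u)\<close>: the solution for the conjugated functional, carried
    back to \<open>y\<close>.\<close>
  define U where "U = v + x ** u - u ** b"
  have UC: "bracket x a + U ** C = mscale \<alpha> e"
  proof -
    have "U ** C = mscale \<alpha> e - X + x ** u ** C - u ** C ** x"
      by (simp add: U_def matrix_add_rdistrib matrix_diff_rdistrib vC)
        (simp add: matrix_mul_assoc[symmetric] bC)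
    moreover have "X = bracket x a + x ** u ** C - u ** C ** x"
      by (simp add: X_def A bracket_def matrix_add_rdistrib matrix_add_ldistrib matrix_mul_assoc)
    ultimately show ?thesis by simp
  qed
  have CU: "bracket b d - C ** U = mscale (\<beta> - \<alpha>) f"
  proof -
    have "C ** x ** u = b ** d"
      by (simp add: bC[symmetric] matrix_mul_assoc[symmetric] u)
    then have "C ** U = mscale (\<alpha> - \<beta>) f + b ** d - d ** b"
      by (simp add: U_def matrix_add_ldistrib matrix_diff_ldistrib Cv matrix_mul_assoc u)
    then show ?thesis by (simp add: bracket_def mscale_distrib)
  qed
  have b: "f ** b = b" "b ** f = b"
    by (simp_all add: b_def matrix_mul_assoc C) (simp add: matrix_mul_assoc[symmetric] s)
  have v: "e ** v = v" "v ** f = v"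
    by (simp_all add: v_def matrix_diff_ldistrib matrix_diff_rdistrib mscale_mult_left mscale_mult_right
        s matrix_mul_assoc eX) (simp add: matrix_mul_assoc[symmetric] s)
  have U: "e ** U = U" "U ** f = U"
    by (simp_all add: U_def matrix_diff_ldistrib matrix_diff_rdistrib matrix_add_ldistrib
        matrix_add_rdistrib v matrix_mul_assoc cx u) (simp add: matrix_mul_assoc[symmetric] u b)
  have "trace x = trace (e' ** x) + trace (f' ** x)"
    by (simp add: trace_add[symmetric] matrix_add_rdistrib[symmetric] e'f' cx)
  then have tx: "trace x = 0" by (simp add: trx)
  have "trace b = trace (s ** (C ** x))" by (simp add: b_def trace_mul_sym[of _ s])
  then have tb: "trace b = 0" using trx(2) by (simp add: f'_def matrix_mul_assoc)
  have mem: "x + U + b \<in> pstab e f y"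
    by (rule pstabI[OF ef cx U b tx tb, where \<alpha> = \<alpha> and \<beta> = "\<beta> - \<alpha>"])
      (use UC CU bC in \<open>simp_all add: C_def a_def d_def\<close>)
  have "e ** (x + U + b) ** e = x"
    using blocks_zero(4)[OF ef U(2)] blocks_zero(2)[OF ef b(1)]
    by (simp add: matrix_add_ldistrib matrix_add_rdistrib cx U)
  then show "\<exists>x'\<in>pstab e f y. e ** x' ** e = x" using mem by blast
qed (simp_all add: matring)

text \<open>Here the \<open>f\<close>-block of the functional is zero, and taking the
  \<open>e\<close>-block maps its stabilizer injectively into the smaller one: if
  \<open>a = 0\<close>, then \<open>b = b C s = 0\<close>, the scalar \<open>\<alpha>\<close>
  vanishes because \<open>e - s C \<noteq> 0\<close>, and finally
  \<open>U = U C s = 0\<close>.\<close>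

lemma thin_refine:
  fixes e f A C s :: "'k::field^'n^'n"
  assumes ef: "blocks e f" and C: "f ** C = C" "C ** e = C"
    and s: "e ** s = s" "s ** f = s" "C ** s = f"
    and A: "corner e A" and ne: "e - s ** C \<noteq> 0"
    and thin: "thin (pstab (e - s ** C) (s ** C) A)"
  shows "thin (pstab e f (A + C))"
  unfolding thin_def
proof (intro ballI)
  define f' where "f' = s ** C"
  define e' where "e' = e - s ** C"
  have b': "blocks e' f'" unfolding e'_def f'_def by (rule refine_blocks(1)[OF ef C s])
  have e'f': "e' + f' = e" by (simp add: e'_def f'_def)
  have Cf': "C ** f' = C" by (simp add: f'_def mult_assoc_eq[OF s(3)] C)
  have Ce': "C ** e' = 0" using Cf' e'f' C(2) by (simp add: e'_def f'_def matring)
  have eA: "e ** A = A" "A ** e = A" using A by (simp_all add: corner_def)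
  have z: "f ** A = 0" "e ** C = 0" "A ** f = 0" "C ** f = 0"
    using eA C blocks_zero[OF ef] by simp_all
  have y: "e ** (A + C) ** e = A" "f ** (A + C) ** e = C" "f ** (A + C) ** f = 0"
    by (simp_all add: matrix_add_ldistrib matrix_add_rdistrib eA C z)
  have red: "e ** x ** e \<in> pstab e' f' A"
    and inj: "e ** x ** e = 0 \<longrightarrow> x = 0" if xx: "x \<in> pstab e f (A + C)" for x
  proof -
    obtain a U b \<alpha> \<beta> where x: "x = a + U + b" "a = e ** x ** e" and "b = f ** x ** f" "U = e ** x ** f"
      and a: "e ** a = a" "a ** e = a" and U: "e ** U = U" "U ** f = U" and b: "f ** b = b" "b ** f = b"
      and tr: "trace a = 0" "trace b = 0"
      and eq: "bracket a A + U ** C = mscale \<alpha> e" "b ** C = C ** a"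
      "bracket b 0 - C ** U = mscale \<beta> f"
      by (rule pstabD[OF ef xx, unfolded y])
    have CU: "C ** U = mscale (- \<beta>) f" using eq(3) by (simp add: bracket_def minus_equation_iff)
    have 1: "f' ** a ** e' = 0"
    proof -
      have "f' ** a ** e' = s ** (b ** C) ** e'" by (simp add: f'_def eq(2) matrix_mul_assoc)
      also have "\<dots> = s ** b ** (C ** e')" by (simp add: matrix_mul_assoc)
      finally show ?thesis by (simp add: Ce')
    qed
    have t2: "trace (f' ** a) = 0"
    proof -
      have "trace (f' ** a) = trace (s ** (b ** C))" by (simp add: f'_def eq(2) matrix_mul_assoc)
      also have "\<dots> = trace (b ** C ** s)" by (rule trace_mul_sym)
      also have "b ** C ** s = b" by (simp add: matrix_mul_assoc[symmetric] s b)
      finally show ?thesis by (simp add: tr)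
    qed
    have "trace (e' ** a) + trace (f' ** a) = trace a"
      by (simp add: trace_add[symmetric] matrix_add_rdistrib[symmetric] e'f' a)
    then have t1: "trace (e' ** a) = 0" using t2 tr by simp
    have X: "bracket a A = mscale \<alpha> e - U ** C" using eq(1) by (simp add: algebra_simps)
    have ee: "e ** e' = e'" "e ** f' = f'" "f' ** e' = 0" "e' ** e' = e'"
      using blocksD[OF b'] by (simp_all add: e'f'[symmetric] matrix_add_rdistrib)
    have Xe': "bracket a A ** e' = mscale \<alpha> e'"
      by (simp add: X matrix_diff_rdistrib mscale_mult_left ee matrix_mul_assoc[symmetric] Ce')
    have f'X: "f' ** bracket a A = mscale \<alpha> f' + mscale \<beta> f'"
    proof -
      have "f' ** (U ** C) = s ** (C ** U) ** C" by (simp add: f'_def matrix_mul_assoc)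
      also have "\<dots> = - mscale \<beta> f'" by (simp add: CU mscale_mult_left mscale_mult_right s f'_def matrix_neg_left matrix_neg_right)
      finally have "f' ** (U ** C) = - mscale \<beta> f'" .
      moreover have "f' ** e = f'" by (simp add: f'_def matrix_mul_assoc[symmetric] C)
      ultimately show ?thesis by (simp add: X matrix_diff_ldistrib mscale_mult_right)
    qed
    have "a \<in> pstab e' f' A"
      unfolding pstab_def mem_Collect_eq
      using 1 t1 t2 f'X Xe' a
      by (auto simp: e'f' corner_def matrix_mul_assoc[symmetric] mscale_mult_right ee)
        (auto simp: matrix_mul_assoc matrix_add_rdistrib mscale_mult_left blocksD[OF b'] ee simp flip: mscale_distrib)
    then show "e ** x ** e \<in> pstab e' f' A" by (simp add: x(2)[symmetric])
    show "e ** x ** e = 0 \<longrightarrow> x = 0"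
    proof
      assume "e ** x ** e = 0"
      then have a0: "a = 0" using x(2) by simp
      then have "b ** C ** s = 0" using eq(2) by simp
      then have b0: "b = 0" by (simp add: matrix_mul_assoc[symmetric] s b)
      have "mscale \<alpha> e' = 0" using Xe' a0 by (simp add: bracket_def)
      then have "\<alpha> = 0" using ne by (simp add: e'_def)
      then have "U ** C ** s = 0" using eq(1) a0 by (simp add: bracket_def)
      then have "U = 0" by (simp add: matrix_mul_assoc[symmetric] s U)
      then show "x = 0" using x(1) a0 b0 by simp
    qed
  qed
  fix x x' assume xx: "x \<in> pstab e f (A + C)" "x' \<in> pstab e f (A + C)"
  obtain c d where cd: "c \<noteq> 0 \<or> d \<noteq> 0" "mscale c (e ** x ** e) + mscale d (e ** x' ** e) = 0"
    using thin red[OF xx(1)] red[OF xx(2)] unfolding thin_def e'_def f'_def by blast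
  have "mscale c x + mscale d x' \<in> pstab e f (A + C)"
    using xx pstab_subspace by (intro matvs.subspace_add matvs.subspace_scale) auto
  moreover have "e ** (mscale c x + mscale d x') ** e = 0"
    using cd(2) by (simp add: matring)
  ultimately have "mscale c x + mscale d x' = 0" using inj by blast
  then show "\<exists>c d. (c \<noteq> 0 \<or> d \<noteq> 0) \<and> mscale c x + mscale d x' = 0" using cd(1) by blast
qed

text \<open>When \<open>e + f = 1\<close>, the block conditions say that \<open>z\<close> and
  \<open>y\<close> define the same functional on the derived algebra; \<open>e z f\<close> is left
  free. The trace is recorded so that membership of \<open>z\<close> in \<open>sl\<close> can be
  read off at the end.\<close>

definition lifts :: "'k::field^'n^'n \<Rightarrow> 'k^'n^'n \<Rightarrow> 'k^'n^'n \<Rightarrow> 'k^'n^'n \<Rightarrow> bool" where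
  "lifts e f y z \<longleftrightarrow> corner (e + f) z \<and> trace z = trace y \<and> f ** z ** e = f ** y ** e \<and>
     (\<exists>\<alpha>. e ** z ** e = e ** y ** e + mscale \<alpha> e) \<and> (\<exists>\<beta>. f ** z ** f = f ** y ** f + mscale \<beta> f) \<and>
     reg_nilpotent z (rk e + rk f)"

lemma lifts_transpose:
  fixes e f y :: "'k::field_char_0^'n^'n"
  assumes ef: "blocks e f"
    and l: "lifts (transpose f) (transpose e) (transpose y) z"
  shows "lifts e f y (transpose z)"
proof -
  obtain z' where z': "z = transpose z'" by (metis transpose_transpose)
  have r: "rk (transpose f) = rk f" "rk (transpose e) = rk e"
    using ef by (simp_all add: rk_transpose blocks_def)
  have c: "corner (e + f) z'"
    using corner_transpose[of "transpose f + transpose e" z] l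
    by (simp add: lifts_def z' transpose_add add.commute)
  show ?thesis
    using l unfolding lifts_def z' transpose3[symmetric] transpose_mscale[symmetric]
      transpose_add[symmetric] transpose_eq_iff trace_transpose reg_nilpotent_transpose r transpose_transpose
    using c by (auto simp: add.commute)
qed

lemma corner_diff: "corner e x \<Longrightarrow> corner e x' \<Longrightarrow> corner e (x - x')"
  by (simp add: corner_def matrix_diff_ldistrib matrix_diff_rdistrib)

lemma corner_mult:
  assumes "corner e x" "corner e x'" shows "corner e (x ** x')"
proof -
  have "e ** (x ** x') = e ** x ** x'" "x ** x' ** e = x ** (x' ** e)" by (simp_all add: matrix_mul_assoc)
  then show ?thesis using assms by (simp add: corner_def)
qed

text \<open>With \<open>M = N - A\<close> in place of the commutator, \<open>v\<close> absorbs the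
  scalars and the free block by which \<open>N\<close> differs from \<open>A\<close>, while
  \<open>- u\<close> undoes the passage from \<open>y\<close> to \<open>A\<close>. Conjugation by
  \<open>1 + w\<close>, where \<open>w = v - u\<close>, does both and preserves regular
  nilpotency.\<close>

lemma lift_step:
  fixes e f y :: "'k::field_char_0^'n^'n"
  assumes ef: "blocks e f" and y: "corner (e + f) y"
    and s: "e ** s = s" "s ** f = s" "(f ** y ** e) ** s = f"
    and rk: "0 < rk f" "rk f < rk e"
  defines "C \<equiv> f ** y ** e"
  defines "A \<equiv> e ** y ** e + s ** (f ** y ** f) ** C"
  assumes N: "lifts (e - s ** C) (s ** C) A N"
  shows "\<exists>z. lifts e f y z"
proof -
  have C: "f ** C = C" "C ** e = C" by (simp_all add: C_def matring blocksD[OF ef])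
  have Cs: "C ** s = f" using s(3) by (simp add: C_def)
  note CsX = mult_assoc_eq[OF Cs]
  define f' where "f' = s ** C"
  define e' where "e' = e - s ** C"
  have b': "blocks e' f'" unfolding e'_def f'_def by (rule refine_blocks(1)[OF ef C s(1,2) Cs])
  have e'f': "e' + f' = e" by (simp add: e'_def f'_def)
  define a where "a = e ** y ** e"
  define d where "d = f ** y ** f"
  define u where "u = s ** d"
  have d: "f ** d = d" "d ** f = d" by (simp_all add: d_def matring blocksD[OF ef])
  have a: "e ** a = a" "a ** e = a" by (simp_all add: a_def matring blocksD[OF ef])
  have u: "e ** u = u" "u ** f = u" "C ** u = d"
    by (simp_all add: u_def matrix_mul_assoc s Cs d) (simp add: d matrix_mul_assoc[symmetric])
  have A: "A = a + u ** C" by (simp add: A_def a_def u_def d_def C_def)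
  have rke: "rk e' + rk f' = rk e"
    using rk_refine[OF ef C s(1,2) Cs] rk unfolding e'_def f'_def by simp
  obtain \<alpha> \<beta> where cN: "corner e N" and trN: "trace N = trace A" and NC: "f' ** N ** e' = f' ** A ** e'"
    and \<alpha>: "e' ** N ** e' = e' ** A ** e' + mscale \<alpha> e'"
    and \<beta>: "f' ** N ** f' = f' ** A ** f' + mscale \<beta> f'"
    and reg: "reg_nilpotent N (rk e)"
    using N[folded e'_def f'_def] unfolding lifts_def e'f' rke by blast
  have "trace A = trace a + trace d"
    by (simp add: A trace_add trace_mul_sym[of u] u)
  also have "\<dots> = trace y"
  proof -
    have "trace y = trace ((e + f) ** y)" using y by (simp add: corner_def)
    then show ?thesis
      by (simp add: matrix_add_rdistrib trace_add a_def d_def trace_idem blocksD[OF ef])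
  qed
  finally have trN: "trace N = trace y" using trN by simp
  \<comment> \<open>\<open>B\<close> lies in \<open>e gl f\<close>, so it does not affect the blocks
    that \<open>lifts\<close> compares, even after the conjugation by \<open>1 + w\<close>.\<close>
  obtain B where B: "e ** B = B" "B ** f = B" and regz: "reg_nilpotent (N + C + B) (rk e + rk f)"
    using reg_nilpotent_extend[OF ef cN reg _ C s(1) Cs] rk by auto
  define M where "M = N - A"
  have eA: "e ** A = A" "A ** e = A"
    by (simp_all add: A matrix_add_ldistrib matrix_add_rdistrib a matrix_mul_assoc u)
      (simp add: matrix_mul_assoc[symmetric] C)
  have eN: "e ** N = N" "N ** e = N" using cN by (simp_all add: corner_def)
  have eM: "e ** M = M" "M ** e = M" by (simp_all add: M_def matrix_diff_ldistrib matrix_diff_rdistrib eA eN)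
  have Me': "M ** e' = mscale \<alpha> e'"
  proof -
    have "M ** e' = (e' + f') ** M ** e'" by (simp add: e'f' eM)
    then show ?thesis using NC \<alpha>
      by (simp add: M_def matrix_diff_ldistrib matrix_diff_rdistrib matrix_add_rdistrib)
  qed
  have f'Mf': "f' ** M ** f' = mscale \<beta> f'"
    using \<beta> by (simp add: M_def matrix_diff_ldistrib matrix_diff_rdistrib)
  have Cf': "C ** f' = C" by (simp add: f'_def CsX C)
  have f's: "f' ** s = s" by (simp add: f'_def matring Cs s)
  define v where "v = mscale \<alpha> s - M ** s"
  have vC: "v ** C = mscale \<alpha> e - M"
  proof -
    have "v ** C = mscale \<alpha> f' - M ** f'"
      by (simp add: v_def matrix_diff_rdistrib mscale_mult_left f'_def matrix_mul_assoc)
    also have "\<dots> = mscale \<alpha> (e - e') - M ** (e - e')" by (simp add: e'_def f'_def)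
    also have "\<dots> = mscale \<alpha> e - M"
      by (simp add: matrix_diff_ldistrib Me' eM mscale_distrib)
    finally show ?thesis .
  qed
  have Cv: "C ** v = mscale (\<alpha> - \<beta>) f"
  proof -
    have "C ** M ** s = C ** (f' ** M ** f') ** s"
      by (simp add: matrix_mul_assoc Cf') (simp add: matrix_mul_assoc[symmetric] f's)
    also have "\<dots> = mscale \<beta> f"
      by (simp add: f'Mf' mscale_mult_left mscale_mult_right Cf' Cs)
    finally show ?thesis
      by (simp add: v_def matrix_diff_ldistrib mscale_mult_right Cs matrix_mul_assoc mscale_distrib)
  qed
  have v: "e ** v = v" "v ** f = v"
    by (simp_all add: v_def matrix_diff_ldistrib matrix_diff_rdistrib mscale_mult_left mscale_mult_right
        s matrix_mul_assoc eM) (simp add: matrix_mul_assoc[symmetric] s)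
  define w where "w = v - u"
  have w: "e ** w = w" "w ** f = w"
    by (simp_all add: w_def matrix_diff_ldistrib matrix_diff_rdistrib u v)
  have w0: "f ** w = 0" "w ** e = 0" using blocks_zero[OF ef] w by simp_all
  have ww: "w ** w = 0"
    using mult_assoc_eq[OF w(2), of w] w0 by simp
  define z0 where "z0 = N + C + B"
  define z where "z = (mat 1 + w) ** z0 ** (mat 1 - w)"
  have z0: "f ** z0 = C" "z0 ** e = N + C"
    using blocks_zero[OF ef] eN C B
    by (simp_all add: z0_def matrix_add_ldistrib matrix_add_rdistrib)
  have inv: "(mat 1 + w) ** (mat 1 - w) = mat 1" "(mat 1 - w) ** (mat 1 + w) = mat 1"
    by (simp_all add: matring ww)
  have cz0: "corner (e + f) z0"
    using blocks_zero[OF ef] eN C B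
    by (simp add: corner_def z0_def matrix_add_ldistrib matrix_add_rdistrib)
  have z_eq: "z = z0 + w ** z0 - z0 ** w - w ** z0 ** w"
    by (simp add: z_def matring algebra_simps)
  have cor: "corner (e + f) z"
  proof -
    have "corner (e + f) w" using w w0 by (simp add: corner_def matrix_add_ldistrib matrix_add_rdistrib)
    then show ?thesis unfolding z_eq using cz0
      by (intro corner_add corner_diff corner_mult)
  qed
  have tB: "trace B = 0" "trace C = 0"
    using trace_mul_sym[of B f] blocks_zero(1)[OF ef B(1)] B trace_mul_sym[of f C] blocks_zero(4)[OF ef]
      C blocks_zero(3)[OF ef C(2)] by simp_all
  have "trace z = trace ((mat 1 - w) ** ((mat 1 + w) ** z0))"
    unfolding z_def by (rule trace_mul_sym)
  then have trz: "trace z = trace y" by (simp add: matrix_mul_assoc inv z0_def trace_add trN tB)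
  have we: "z ** e = (mat 1 + w) ** (N + C)"
    unfolding z_def by (simp add: matrix_mul_assoc[symmetric] matrix_diff_rdistrib w0 z0)
  have wN: "w ** N = 0" using mult_assoc_eq[OF w(2), of N] blocks_zero(1)[OF ef eN(1)] by simp
  have ze: "z ** e = N + C + w ** C"
    unfolding we by (simp add: matrix_add_ldistrib matrix_add_rdistrib wN)
  have eC: "e ** C = 0" "f ** N = 0" using blocks_zero[OF ef] C eN by simp_all
  have fze: "f ** z ** e = f ** y ** e"
    by (simp add: matrix_mul_assoc[symmetric] ze matrix_add_ldistrib eC C mult_assoc_eq[OF w0(1)])
      (simp add: C_def matrix_mul_assoc[symmetric])
  have "e ** z ** e = N + w ** C"
    by (simp add: matrix_mul_assoc[symmetric] ze matrix_add_ldistrib eC eN mult_assoc_eq[OF w(1)])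
  also have "\<dots> = e ** y ** e + mscale \<alpha> e"
    by (simp add: w_def matrix_diff_rdistrib vC M_def A a_def)
  finally have eze: "e ** z ** e = e ** y ** e + mscale \<alpha> e" .
  have fz: "f ** z = C ** (mat 1 - w)"
    unfolding z_def by (simp add: matrix_mul_assoc matrix_add_ldistrib w0 z0)
  have "f ** z ** f = - (C ** w)"
    unfolding fz using blocks_zero(3)[OF ef C(2)]
    by (simp add: matrix_diff_ldistrib matrix_diff_rdistrib matrix_mul_assoc[symmetric] w)
  also have "\<dots> = f ** y ** f + mscale (\<beta> - \<alpha>) f"
    by (simp add: w_def matrix_diff_ldistrib Cv u mscale_distrib d_def)
  finally have fzf: "f ** z ** f = f ** y ** f + mscale (\<beta> - \<alpha>) f" .
  have "mpow z k = (mat 1 + w) ** mpow z0 k ** (mat 1 - w)" for k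
    unfolding z_def by (rule mpow_conj) (simp_all add: inv)
  moreover have "mpow z0 k = (mat 1 - w) ** ((mat 1 + w) ** mpow z0 k ** (mat 1 - w)) ** (mat 1 + w)" for k
  proof -
    have "(mat 1 - w) ** ((mat 1 + w) ** mpow z0 k ** (mat 1 - w)) ** (mat 1 + w) =
      ((mat 1 - w) ** (mat 1 + w)) ** mpow z0 k ** ((mat 1 - w) ** (mat 1 + w))"
      by (simp only: matrix_mul_assoc)
    then show ?thesis by (simp only: inv matrix_mul_lid matrix_mul_rid)
  qed
  ultimately have "mpow z k = 0 \<longleftrightarrow> mpow z0 k = 0" for k
    by (metis matrix_zero_left matrix_zero_right)
  then have "reg_nilpotent z (rk e + rk f)" using regz by (simp add: reg_nilpotent_def z0_def)
  then show ?thesis using cor trz fze eze fzf unfolding lifts_def by blast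
qed

section \<open>Rank-one blocks, the end of the Euclidean algorithm\<close>

lemma vm_outer: "u v* outer v w = dotp u v *s w"
  by (simp add: outer_def dotp_def vector_matrix_mult_def vec_eq_iff sum_distrib_left sum_distrib_right mult_ac)

lemma outer_scale_right: "outer v (c *s w) = mscale c (outer v w)"
  by (simp add: outer_def mscale_def vec_eq_iff mult_ac)

lemma rank_one_idempotent:
  fixes e :: "'k::field^'n^'n"
  assumes "e ** e = e" "rk e = 1"
  obtains v w where "e = outer v w" "dotp w v = 1" "v \<noteq> 0" "w \<noteq> 0"
proof -
  have "e \<noteq> 0" using assms(2) vec.dim_eq_0[of "img e"] by (auto simp: rk_def img_def)
  then obtain v w where vw: "v \<noteq> 0" "dotp w v = 1" "Suc (rk (e - outer v w)) = rk e"
    using idempotent_remove_rank_one[OF assms(1)] by metis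
  then have "img (e - outer v w) \<subseteq> {0}" using assms(2) vec.dim_eq_0 by (auto simp: rk_def)
  then have "(e - outer v w) *v x = 0 *v x" for x by (auto simp: img_def)
  then have "e - outer v w = 0" by (rule matrix_eqI)
  then have "e = outer v w" by simp
  moreover have "w \<noteq> 0" using vw(2) by auto
  ultimately show ?thesis using that vw by blast
qed

lemma rank_one_compress:
  fixes e :: "'k::field^'n^'n"
  assumes "e ** e = e" "rk e = 1"
  shows "e ** x ** e = mscale (trace (e ** x)) e"
proof -
  obtain v w where e: "e = outer v w" by (rule rank_one_idempotent[OF assms])
  show ?thesis by (simp add: e outer_mult vm_outer outer_scale_right trace_outer dotp_commute)
qed

text \<open>The corner of a rank-one idempotent consists of scalars, so the trace conditions kill
  both diagonal blocks and the line \<open>e gl f\<close> remains.\<close>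

lemma thin_rank_one:
  fixes e f :: "'k::field^'n^'n"
  assumes ef: "blocks e f" and rk: "rk e = 1" "rk f = 1"
  shows "thin (pstab e f 0)"
  unfolding thin_def
proof (intro ballI)
  obtain v w where e: "e = outer v w" by (rule rank_one_idempotent[OF blocksD(1)[OF ef] rk(1)])
  obtain v' w' where f: "f = outer v' w'" by (rule rank_one_idempotent[OF blocksD(2)[OF ef] rk(2)])
  have form: "\<exists>c. x = mscale c (outer v w')" if x: "x \<in> pstab e f 0" for x
  proof -
    have "x = e ** x ** e + e ** x ** f + f ** x ** e + f ** x ** f"
      by (rule corner_decomp) (use x in \<open>auto simp: pstab_def\<close>)
    also have "\<dots> = e ** x ** f"
      using x by (simp add: pstab_def rank_one_compress[OF blocksD(1)[OF ef] rk(1)]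
          rank_one_compress[OF blocksD(2)[OF ef] rk(2)])
    also have "\<dots> = mscale (dotp (w v* x) v') (outer v w')"
      by (simp add: e f outer_mult vm_outer outer_scale_right)
    finally show ?thesis by blast
  qed
  fix x x' assume "x \<in> pstab e f 0" "x' \<in> pstab e f 0"
  then obtain c c' where c: "x = mscale c (outer v w')" "x' = mscale c' (outer v w')"
    using form by metis
  show "\<exists>c d. (c \<noteq> 0 \<or> d \<noteq> 0) \<and> mscale c x + mscale d x' = 0"
  proof (cases "c = 0")
    case True
    then show ?thesis using c by (intro exI[of _ 1] exI[of _ 0]) simp
  next
    case False
    then show ?thesis using c
      by (intro exI[of _ "- c'"] exI[of _ c]) (simp add: mult.commute matvs.scale_left_distrib[symmetric])
  qed
qed

text \<open>The diagonal blocks are scalar and can be replaced by zero. If \<open>f y e\<close> is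
  nonzero, it is already a Jordan block of size two; if it is zero, a nonzero element of
  \<open>e gl f\<close> takes its place.\<close>

lemma lift_rank_one:
  fixes e f y :: "'k::field_char_0^'n^'n"
  assumes ef: "blocks e f" and rk: "rk e = 1" "rk f = 1"
    and y: "corner (e + f) y" "trace y = 0"
  shows "\<exists>z. lifts e f y z"
proof -
  obtain v w where e: "e = outer v w" "dotp w v = 1" "v \<noteq> 0" "w \<noteq> 0" by (rule rank_one_idempotent[OF blocksD(1)[OF ef] rk(1)])
  obtain v' w' where f: "f = outer v' w'" "dotp w' v' = 1" "v' \<noteq> 0" "w' \<noteq> 0" by (rule rank_one_idempotent[OF blocksD(2)[OF ef] rk(2)])
  define B where "B = (if f ** y ** e = 0 then outer v w' else 0)"
  have eB: "e ** B = B" "B ** f = B"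
  proof -
    have "e *v v = v" "w' v* f = w'" using e f by (simp_all add: outer_mv vm_outer)
    then show "e ** B = B" "B ** f = B" by (simp_all add: B_def mult_outer outer_mult)
  qed
  define z where "z = f ** y ** e + B"
  have C: "f ** (f ** y ** e) = f ** y ** e" "(f ** y ** e) ** e = f ** y ** e"
    by (simp_all add: matring blocksD[OF ef])
  have 0: "f ** B = 0" "B ** e = 0" "e ** (f ** y ** e) = 0" "(f ** y ** e) ** f = 0"
    using blocks_zero(1)[OF ef eB(1)] blocks_zero(4)[OF ef eB(2)] blocks_zero(2)[OF ef C(1)]
      blocks_zero(3)[OF ef C(2)] by blast+
  have "z ** z = 0"
  proof (cases "f ** y ** e = 0")
    case True
    have "B ** (f ** B) = B ** f ** B" by (rule matrix_mul_assoc)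
    then have "B ** B = 0" using eB 0 by simp
    then show ?thesis using True by (simp add: z_def)
  next
    case False
    have "(f ** y ** e) ** (e ** (f ** y ** e)) = (f ** y ** e) ** e ** (f ** y ** e)" by (rule matrix_mul_assoc)
    then show ?thesis using False C 0 by (simp add: z_def B_def)
  qed
  moreover have "z \<noteq> 0"
    using e f by (auto simp: z_def B_def outer_eq_0_iff)
  moreover have "rk e + rk f = Suc (Suc 0)" using rk by simp
  ultimately have "reg_nilpotent z (rk e + rk f)" by (simp add: reg_nilpotent_def)
  moreover have "corner (e + f) z"
    by (simp add: corner_def z_def matrix_add_ldistrib matrix_add_rdistrib eB C 0)
  moreover have "trace z = 0"
    using trace_mul_sym[of B f] trace_mul_sym[of f "f ** y ** e"] eB C 0
    by (simp add: z_def trace_add)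
  moreover have fz: "f ** z = f ** y ** e" and ze: "z ** e = f ** y ** e"
    by (simp_all add: z_def matrix_add_ldistrib matrix_add_rdistrib C 0)
  have "e ** z ** e = 0" using ze 0 by (simp add: matrix_mul_assoc[symmetric])
  then have "e ** z ** e = e ** y ** e + mscale (- trace (e ** y)) e"
    by (simp add: rank_one_compress[OF blocksD(1)[OF ef] rk(1)])
  moreover have "f ** z ** f = 0" using fz 0 by simp
  then have "f ** z ** f = f ** y ** f + mscale (- trace (f ** y)) f"
    by (simp add: rank_one_compress[OF blocksD(2)[OF ef] rk(2)])
  moreover have "f ** z ** e = f ** y ** e" by (simp add: fz C)
  ultimately show ?thesis unfolding lifts_def y(2) by blast
qed

text \<open>To construct a thin functional any off-diagonal block with a section will do. This one
  comes from embedding a basis of the image of \<open>f\<close> into a basis of the image of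
  \<open>e\<close>.\<close>

lemma exists_partial_isometry:
  fixes e f :: "'k::field^'n^'n"
  assumes ef: "blocks e f" and "rk f \<le> rk e"
  obtains C s where "f ** C = C" "C ** e = C" "e ** s = s" "s ** f = s" "C ** s = f"
proof -
  obtain Bf where Bf: "Bf \<subseteq> img f" "vec.independent Bf" "img f \<subseteq> vec.span Bf" "card Bf = rk f"
    unfolding rk_def using vec.basis_exists[of "img f"] by metis
  obtain Be where Be: "Be \<subseteq> img e" "vec.independent Be" "img e \<subseteq> vec.span Be" "card Be = rk e"
    unfolding rk_def using vec.basis_exists[of "img e"] by metis
  have spf: "vec.span Bf = img f" by (rule vec.span_subspace[OF Bf(1) Bf(3) subspace_img])
  have fin: "finite Bf" "finite Be" using Bf(2) Be(2) by (simp_all add: vec.finiteI_independent)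
  obtain h where h: "inj_on h Bf" "h ` Bf \<subseteq> Be"
    using card_le_inj[OF fin] Bf Be assms(2) by auto
  obtain g where g: "Vector_Spaces.linear (*s) (*s) g" "\<forall>b\<in>Bf. g b = h b"
    using vec.linear_independent_extend[OF Bf(2), of h] by blast
  interpret g: Vector_Spaces.linear "(*s)" "(*s)" g by fact
  have gB: "g ` Bf = h ` Bf" using g by auto
  have inj: "inj_on g (img f)"
    unfolding spf[symmetric]
    by (rule g.inj_on_span_independent_image)
      (use gB h g vec.independent_mono[OF Be(2) h(2)] in \<open>auto simp: inj_on_def\<close>)
  have ge: "g v \<in> img e" if "v \<in> img f" for v
  proof -
    have "g v \<in> g ` vec.span Bf" using that spf by blast
    then have "g v \<in> vec.span (h ` Bf)" by (simp add: g.span_image[symmetric] gB)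
    then show ?thesis using vec.span_minimal[OF _ subspace_img, of "h ` Bf" e] h Be by blast
  qed
  obtain g' where g': "g' ` UNIV \<subseteq> img f" "Vector_Spaces.linear (*s) (*s) g'" "\<forall>v\<in>img f. g' (g v) = v"
    using vec.linear_exists_left_inverse_on[OF g(1) subspace_img inj] by blast
  have imge: "v \<in> img e \<longleftrightarrow> e *v v = v" and imgf: "v \<in> img f \<longleftrightarrow> f *v v = v" for v
    by (rule img_iff, simp add: blocksD[OF ef])+
  have fi: "f *v v \<in> img f" for v by (simp add: img_def)
  define C where "C = matrix g' ** e"
  define s where "s = matrix g ** f"
  have Cv: "C *v v = g' (e *v v)" and sv: "s *v v = g (f *v v)" for v
    by (simp_all add: C_def s_def matrix_vector_mul_assoc[symmetric] matrix_works g g')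
  show ?thesis
  proof (rule that[of C s])
    show "f ** C = C" using g'(1) imgf by (intro matrix_eqI) (auto simp: matrix_vector_mul_assoc[symmetric] Cv)
    show "e ** s = s" using ge[OF fi] imge by (intro matrix_eqI) (auto simp: matrix_vector_mul_assoc[symmetric] sv)
    show "C ** e = C" "s ** f = s" by (simp_all add: C_def s_def matrix_mul_assoc[symmetric] blocksD[OF ef])
    show "C ** s = f"
      using ge[OF fi] imge g'(3) fi
      by (intro matrix_eqI) (simp add: matrix_vector_mul_assoc[symmetric] Cv sv)
  qed
qed

theorem exists_thin:
  fixes e f :: "'k::field_char_0^'n^'n"
  assumes "blocks e f" "coprime (rk e) (rk f)" "rk e > 0" "rk f > 0"
  shows "\<exists>y. corner (e + f) y \<and> thin (pstab e f y)"
  using assms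
proof (induction "rk e + rk f" arbitrary: e f rule: less_induct)
  case less
  \<comment> \<open>Stated for all pairs of the same total rank, so that it also applies to the
    transposed pair when \<open>rk e < rk f\<close>.\<close>
  have step: "\<exists>y. corner (e' + f') y \<and> thin (pstab e' f' y)"
    if ef: "blocks e' f'" and co: "coprime (rk e') (rk f')" and rk: "0 < rk f'" "rk f' < rk e'"
      and sum: "rk e' + rk f' = rk e + rk f" for e' f' :: "'k^'n^'n"
  proof -
    obtain C s where C: "f' ** C = C" "C ** e' = C" and s: "e' ** s = s" "s ** f' = s" "C ** s = f'"
      using exists_partial_isometry[OF ef] rk by auto
    have r: "rk (e' - s ** C) = rk e' - rk f'" "rk (s ** C) = rk f'"
      using rk_refine[OF ef C s] rk by auto
    have "coprime (rk e' - rk f') (rk f')"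
      using co rk by (simp add: coprime_iff_gcd_eq_1 gcd_diff1_nat)
    then have IH: "coprime (rk (e' - s ** C)) (rk (s ** C))" "0 < rk (e' - s ** C)" "0 < rk (s ** C)"
      "rk (e' - s ** C) + rk (s ** C) < rk e + rk f"
      using r rk sum by simp_all
    obtain A where A: "corner (e' - s ** C + s ** C) A" "thin (pstab (e' - s ** C) (s ** C) A)"
      using less.hyps[OF IH(4) refine_blocks(1)[OF ef C s] IH(1-3)] by blast
    have "e' - s ** C \<noteq> 0"
    proof
      assume "e' - s ** C = 0"
      then show False using r(1) rk vec.dim_eq_0 by (auto simp: rk_def img_def)
    qed
    then have "thin (pstab e' f' (A + C))" using thin_refine[OF ef C s] A by simp
    moreover have "corner (e' + f') (A + C)"
    proof -
      have a: "e' ** A = A" "A ** e' = A" using A by (simp_all add: corner_def)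
      show ?thesis using blocks_zero[OF ef] a C
        by (simp add: corner_def matrix_add_ldistrib matrix_add_rdistrib)
    qed
    ultimately show ?thesis by blast
  qed
  consider "rk f < rk e" | "rk e < rk f" | "rk e = rk f" by linarith
  then show ?case
  proof cases
    case 1 then show ?thesis using step less.prems by simp
  next
    case 2
    have r: "rk (transpose e) = rk e" "rk (transpose f) = rk f"
      using less.prems(1) by (simp_all add: rk_transpose blocks_def)
    obtain y where y: "corner (transpose f + transpose e) y" "thin (pstab (transpose f) (transpose e) y)"
      using step[OF blocks_transpose[OF less.prems(1)]] 2 less.prems by (auto simp: r coprime_commute add.commute)
    from thin_pstab_transpose[OF y(2)] corner_transpose[OF y(1)] show ?thesis
      by (auto simp: transpose_add add.commute)
  next
    case 3
    \<comment> \<open>Equal coprime numbers are 1: coprimality is what makes the descent end with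
      two lines.\<close>
    then have "rk e = 1" "rk f = 1" using less.prems by auto
    then show ?thesis using thin_rank_one[OF less.prems(1)]
      by (intro exI[of _ 0]) (simp add: corner_def)
  qed
qed

text \<open>In \<open>exists_thin\<close> the off-diagonal block is chosen; here it is given by
  \<open>y\<close>, thinness makes it onto, and \<open>pstab_reduce\<close> hands thinness on to the
  next step.\<close>

theorem exists_lift:
  fixes e f y :: "'k::field_char_0^'n^'n"
  assumes "blocks e f" "coprime (rk e) (rk f)" "rk e > 0" "rk f > 0"
    and "corner (e + f) y" "trace y = 0" "thin (pstab e f y)"
  shows "\<exists>z. lifts e f y z"
  using assms
proof (induction "rk e + rk f" arbitrary: e f y rule: less_induct)
  case less
  have step: "\<exists>z. lifts e' f' y' z"
    if ef: "blocks e' f'" and co: "coprime (rk e') (rk f')" and rk: "0 < rk f'" "rk f' < rk e'"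
      and sum: "rk e' + rk f' = rk e + rk f"
      and y: "corner (e' + f') y'" "trace y' = 0" "thin (pstab e' f' y')" for e' f' y' :: "'k^'n^'n"
  proof -
    obtain s where s: "e' ** s = s" "s ** f' = s" "(f' ** y' ** e') ** s = f'"
      using thin_imp_right_inverse[OF ef y(3) rk(2)] by metis
    define C where "C = f' ** y' ** e'"
    have C: "f' ** C = C" "C ** e' = C" by (simp_all add: C_def matring blocksD[OF ef])
    have Cs: "C ** s = f'" using s by (simp add: C_def)
    define A where "A = e' ** y' ** e' + s ** (f' ** y' ** f') ** C"
    have r: "rk (e' - s ** C) = rk e' - rk f'" "rk (s ** C) = rk f'"
      using rk_refine[OF ef C s(1,2) Cs] rk by auto
    have "coprime (rk e' - rk f') (rk f')"
      using co rk by (simp add: coprime_iff_gcd_eq_1 gcd_diff1_nat)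
    then have IH: "coprime (rk (e' - s ** C)) (rk (s ** C))" "0 < rk (e' - s ** C)" "0 < rk (s ** C)"
      "rk (e' - s ** C) + rk (s ** C) < rk e + rk f"
      using r rk sum by simp_all
    have cA: "corner (e' - s ** C + s ** C) A"
      by (simp add: corner_def A_def matrix_add_ldistrib matrix_add_rdistrib matrix_mul_assoc s blocksD[OF ef])
        (simp add: matrix_mul_assoc[symmetric] C blocksD[OF ef])
    have tA: "trace A = 0"
    proof -
      have "trace (s ** (f' ** y' ** f') ** C) = trace (C ** s ** (f' ** y' ** f'))"
        by (subst trace_mul_sym) (simp add: matrix_mul_assoc)
      also have "\<dots> = trace (f' ** y')" by (simp add: Cs matrix_mul_assoc blocksD[OF ef] trace_idem)
      finally have "trace A = trace ((e' + f') ** y')"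
        by (simp add: A_def trace_add trace_idem blocksD[OF ef] matrix_add_rdistrib)
      then show ?thesis using y by (simp add: corner_def)
    qed
    have tA': "thin (pstab (e' - s ** C) (s ** C) A)"
      using pstab_reduce[OF ef s y(3)] by (simp add: C_def A_def)
    obtain N where "lifts (e' - s ** C) (s ** C) A N"
      using less.hyps[OF IH(4) refine_blocks(1)[OF ef C s(1,2) Cs] IH(1-3) cA tA tA'] by blast
    then show ?thesis using lift_step[OF ef y(1) s rk] by (simp add: C_def A_def)
  qed
  consider "rk f < rk e" | "rk e < rk f" | "rk e = rk f" by linarith
  then show ?case
  proof cases
    case 1 then show ?thesis using step less.prems by simp
  next
    case 2
    have r: "rk (transpose e) = rk e" "rk (transpose f) = rk f"
      using less.prems(1) by (simp_all add: rk_transpose blocks_def)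
    have "corner (transpose f + transpose e) (transpose y)"
      using corner_transpose[OF less.prems(5)] by (simp add: transpose_add add.commute)
    then obtain z where "lifts (transpose f) (transpose e) (transpose y) z"
      using step[OF blocks_transpose[OF less.prems(1)] _ _ _ _ _ _ thin_pstab_transpose[OF less.prems(7)]]
        2 less.prems by (auto simp: r coprime_commute add.commute trace_transpose)
    then show ?thesis using lifts_transpose[OF less.prems(1)] by blast
  next
    case 3
    then have "rk e = 1" "rk f = 1" using less.prems by auto
    then show ?thesis using lift_rank_one less.prems by blast
  qed
qed

section \<open>Matrix units and finite-dimensionality of matrix spaces\<close>

definition mat_unit :: "'m \<Rightarrow> 'n \<Rightarrow> 'k::field^'n^'m" where
  "mat_unit i j = outer (axis i 1) (axis j 1)"

lemma mat_unit_nth: "mat_unit i j $ a $ b = (if a = i \<and> b = j then 1 else 0)"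
  by (simp add: mat_unit_def outer_def axis_def)

lemma matrix_expansion: "A = (\<Sum>i\<in>UNIV. \<Sum>j\<in>UNIV. mscale (A $ i $ j) (mat_unit i j))"
proof -
  have "(\<Sum>i\<in>UNIV. \<Sum>j\<in>UNIV. A $ i $ j * (if a = i \<and> b = j then 1 else 0)) = A $ a $ b" for a b
    by (subst sum.remove[of _ a], simp, simp)
      (subst sum.remove[of _ b], simp, simp, simp add: sum.neutral)
  then show ?thesis by (simp add: vec_eq_iff mscale_def mat_unit_nth)
qed

lemma mult_mat_unit_nth: "(A ** mat_unit i j) $ a $ b = (if b = j then A $ a $ i else 0)"
  by (simp add: matrix_matrix_mult_def mat_unit_nth if_distrib[of "(*) _"] cong: if_cong)

lemma mat_unit_mult_nth: "(mat_unit i j ** A) $ a $ b = (if a = i then A $ j $ b else 0)"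
  by (simp add: matrix_matrix_mult_def mat_unit_nth if_distrib[of "\<lambda>x. x * _"] cong: if_cong)

lemma trace_mult_mat_unit: "trace (A ** mat_unit i j) = A $ j $ i"
  by (simp add: trace_def mult_mat_unit_nth)

lemma trace_nondegenerate:
  fixes M :: "'k::field^'n^'m"
  assumes "\<And>z. trace (M ** z) = 0" shows "M = 0"
proof -
  have "M $ a $ b = 0" for a b using assms[of "mat_unit b a"] by (simp add: trace_mult_mat_unit)
  then show ?thesis by (simp add: vec_eq_iff)
qed

text \<open>The locale of finite-dimensional spaces takes a basis as a parameter; existence of one
  is shown by thinning out the matrix units.\<close>

definition mat_basis :: "('k::field^'n^'m) set" where
  "mat_basis = (SOME B. finite B \<and> matvs.independent B \<and> matvs.span B = UNIV)"

lemma mat_basis: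
  "finite (mat_basis :: ('k::field^'n^'m) set)"
  "matvs.independent (mat_basis :: ('k::field^'n^'m) set)"
  "matvs.span (mat_basis :: ('k::field^'n^'m) set) = UNIV"
proof -
  let ?S = "range (\<lambda>(i, j). mat_unit i j) :: ('k^'n^'m) set"
  obtain B where B: "B \<subseteq> ?S" "matvs.independent B" "?S \<subseteq> matvs.span B"
    using matvs.maximal_independent_subset[of ?S] by blast
  have "A \<in> matvs.span B" for A :: "'k^'n^'m"
    using B(3) by (subst matrix_expansion[of A]) (auto intro!: matvs.span_sum matvs.span_scale)
  then have "finite B \<and> matvs.independent B \<and> matvs.span B = UNIV"
    using B finite_subset[OF B(1)] by auto
  then have "finite (mat_basis :: ('k::field^'n^'m) set) \<and> matvs.independent (mat_basis :: ('k::field^'n^'m) set)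
    \<and> matvs.span (mat_basis :: ('k::field^'n^'m) set) = UNIV"
    unfolding mat_basis_def by (rule someI)
  then show "finite (mat_basis :: ('k::field^'n^'m) set)"
    "matvs.independent (mat_basis :: ('k::field^'n^'m) set)"
    "matvs.span (mat_basis :: ('k::field^'n^'m) set) = UNIV" by auto
qed

interpretation matfd: finite_dimensional_vector_space
  "mscale :: 'k::field \<Rightarrow> 'k^'n^'m \<Rightarrow> 'k^'n^'m" mat_basis
  by unfold_locales (rule mat_basis)+

interpretation matpair: finite_dimensional_vector_space_pair
  "mscale :: 'k::field \<Rightarrow> 'k^'n^'n \<Rightarrow> 'k^'n^'n" mat_basis "mscale :: 'k::field \<Rightarrow> 'k^'n^'n \<Rightarrow> 'k^'n^'n" mat_basis ..

interpretation matvec: finite_dimensional_vector_space_pair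
  "mscale :: 'k::field \<Rightarrow> 'k^'n^'n \<Rightarrow> 'k^'n^'n" mat_basis "(*s) :: 'k \<Rightarrow> 'k^'n \<Rightarrow> 'k^'n" cart_basis ..

interpretation matfun: vector_space_pair
  "mscale :: 'k::field \<Rightarrow> 'k^'n^'n \<Rightarrow> 'k^'n^'n" "(*) :: 'k \<Rightarrow> 'k \<Rightarrow> 'k" ..

section \<open>Invariant flags\<close>

definition pev :: "'k::field poly \<Rightarrow> 'k^'n^'n \<Rightarrow> 'k^'n^'n" where
  "pev p Y = (\<Sum>i\<le>degree p. mscale (coeff p i) (mpow Y i))"

lemma pev_bound: "degree p \<le> N \<Longrightarrow> pev p Y = (\<Sum>i\<le>N. mscale (coeff p i) (mpow Y i))"
  unfolding pev_def by (rule sum.mono_neutral_left) (auto simp: coeff_eq_0)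

lemma pev_linear_factor:
  "pev ([:- l, 1:] * q) Y = (Y - mscale l (mat 1)) ** pev q Y"
proof -
  let ?N = "degree q" and ?p = "[:- l, 1:] * q"
  have c: "coeff ?p i = coeff (pCons 0 q) i - l * coeff q i" for i
    by (simp add: algebra_simps)
  have "degree ?p \<le> Suc ?N" using degree_mult_le[of "[:- l, 1:]" q] by simp
  then have "pev ?p Y = (\<Sum>i\<le>Suc ?N. mscale (coeff ?p i) (mpow Y i))" by (rule pev_bound)
  also have "\<dots> = (\<Sum>i\<le>Suc ?N. mscale (coeff (pCons 0 q) i) (mpow Y i)) - mscale l (\<Sum>i\<le>Suc ?N. mscale (coeff q i) (mpow Y i))"
    unfolding c by (simp add: matvs.scale_left_diff_distrib sum_subtractf matvs.scale_sum_right
        matvs.scale_right_distrib del: sum.atMost_Suc)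
  also have "(\<Sum>i\<le>Suc ?N. mscale (coeff q i) (mpow Y i)) = pev q Y"
    by (rule pev_bound[symmetric]) simp
  also have "(\<Sum>i\<le>Suc ?N. mscale (coeff (pCons 0 q) i) (mpow Y i)) = Y ** pev q Y"
    unfolding sum.atMost_Suc_shift pev_def by (simp add: matrix_sum_right mscale_mult_right)
  finally show ?thesis by (simp add: matrix_diff_rdistrib mscale_mult_left)
qed

lemma exists_annihilating_poly:
  fixes Y :: "'k::field^'n^'n"
  obtains p where "p \<noteq> 0" "pev p Y = 0"
proof -
  have "\<exists>c::nat \<Rightarrow> 'k. (\<exists>i. i \<le> card (mat_basis :: ('k^'n^'n) set) \<and> c i \<noteq> 0) \<and>
    (\<Sum>i\<le>card (mat_basis :: ('k^'n^'n) set). mscale (c i) (mpow Y i)) = 0"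
    (is "\<exists>c. (\<exists>i. i \<le> ?N \<and> c i \<noteq> 0) \<and> _")
  \<comment> \<open>Equal powers are treated apart, since linear dependence of the set of powers
    does not count repetitions.\<close>
  proof (cases "inj_on (mpow Y) {..?N}")
    case True
    then have "card (mpow Y ` {..?N}) = Suc ?N" by (simp add: card_image)
    then have "matvs.dependent (mpow Y ` {..?N})"
      using matfd.independent_bound_general[of "mpow Y ` {..?N}"] matfd.dim_subset_UNIV[of "mpow Y ` {..?N}"]
      by (auto simp: matfd.dimension_def)
    then obtain u where u: "(\<Sum>v\<in>mpow Y ` {..?N}. mscale (u v) v) = 0" "\<exists>v\<in>mpow Y ` {..?N}. u v \<noteq> 0"
      unfolding matvs.dependent_finite[OF finite_imageI[OF finite_atMost]] by blast
    then show ?thesis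
      by (intro exI[of _ "\<lambda>i. u (mpow Y i)"]) (auto simp: sum.reindex[OF True])
  next
    case False
    then obtain i j where ij: "i \<le> ?N" "j \<le> ?N" "i \<noteq> j" "mpow Y i = mpow Y j"
      by (auto simp: inj_on_def)
    define c :: "nat \<Rightarrow> 'k" where "c a = (if a = i then 1 else 0) - (if a = j then 1 else 0)" for a
    have "(\<Sum>a\<le>?N. mscale (c a) (mpow Y a)) = (\<Sum>a\<le>?N. (if a = i then mpow Y a else 0) - (if a = j then mpow Y a else 0))"
      by (intro sum.cong) (auto simp: c_def)
    also have "\<dots> = 0" using ij by (simp add: sum_subtractf)
    finally show ?thesis using ij by (intro exI[of _ c]) (auto simp: c_def)
  qed
  then obtain c :: "nat \<Rightarrow> 'k" and i where c: "i \<le> card (mat_basis :: ('k^'n^'n) set)" "c i \<noteq> 0"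
    "(\<Sum>i\<le>card (mat_basis :: ('k^'n^'n) set). mscale (c i) (mpow Y i)) = 0" by blast
  let ?N = "card (mat_basis :: ('k^'n^'n) set)"
  define p where "p = (\<Sum>i\<le>?N. monom (c i) i)"
  have coeff: "coeff p j = (if j \<le> ?N then c j else 0)" for j
    by (simp add: p_def coeff_sum)
  have "p \<noteq> 0" using coeff[of i] c by auto
  moreover have "degree p \<le> ?N" by (rule degree_le) (simp add: coeff)
  then have "pev p Y = 0" using c(3) by (simp add: pev_bound coeff)
  ultimately show ?thesis using that by blast
qed

text \<open>Existence of an eigenvalue, in the form that suits hyperplanes. If every shift of
  \<open>Y\<close> mapped \<open>W\<close> onto itself, then so would every nonzero polynomial in
  \<open>Y\<close>, by splitting off roots; an annihilating polynomial does not.\<close>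

lemma exists_nonsurjective_shift:
  fixes Y :: "'k::alg_closed_field^'n^'n"
  assumes "W \<noteq> {0}" "vec.subspace W"
  shows "\<exists>l. (*v) (Y - mscale l (mat 1)) ` W \<noteq> W"
proof (rule ccontr)
  assume "\<not> ?thesis"
  then have surj: "(*v) (Y - mscale l (mat 1)) ` W = W" for l by blast
  have "(*v) (pev p Y) ` W = W" if "p \<noteq> 0" for p
    using that
  proof (induction "degree p" arbitrary: p)
    case 0
    then obtain c where p: "p = [:c:]" "c \<noteq> 0" by (metis degree_eq_zeroE pCons_0_0)
    have "pev p Y *v v = c *s v" for v by (simp add: p pev_def mscale_mv)
    moreover have "v \<in> (*s) c ` W" if "v \<in> W" for v
      using p that assms(2) by (intro image_eqI[of _ _ "(1 / c) *s v"]) (auto intro: vec.subspace_scale)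
    ultimately show ?case using assms(2) by (auto intro: vec.subspace_scale)
  next
    case (Suc m)
    obtain l where "poly p l = 0" using alg_closed_imp_poly_has_root[of p] Suc by auto
    then obtain q where q: "p = [:- l, 1:] * q" by (auto simp: poly_eq_0_iff_dvd)
    then have "q \<noteq> 0" using Suc by auto
    then have "degree p = Suc (degree q)" unfolding q by (subst degree_mult_eq) auto
    then have "(*v) (pev q Y) ` W = W" using Suc \<open>q \<noteq> 0\<close> by simp
    then have "(*v) (pev p Y) ` W = (*v) (Y - mscale l (mat 1)) ` W"
      unfolding q pev_linear_factor by (metis (no_types, lifting) image_cong image_image matrix_vector_mul_assoc)
    then show ?case using surj by simp
  qed
  moreover obtain p where "p \<noteq> 0" "pev p Y = 0" by (rule exists_annihilating_poly)
  ultimately have "(\<lambda>v. 0) ` W = W" by (metis (no_types, lifting) image_cong matrix_vector_mult_0)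
  then show False using assms vec.subspace_0 by auto
qed

text \<open>Every subspace between \<open>(Y - l) W\<close> and \<open>W\<close> is stable under
  \<open>Y\<close>, because \<open>Y v = (Y - l) v + l v\<close>. As \<open>(Y - l) W\<close> is
  proper for a suitable \<open>l\<close>, completing a basis yields such a hyperplane.\<close>

lemma exists_invariant_hyperplane:
  fixes Y :: "'k::alg_closed_field^'n^'n"
  assumes W: "vec.subspace W" "W \<noteq> {0}" and st: "\<And>v. v \<in> W \<Longrightarrow> Y *v v \<in> W"
  obtains H b where "vec.subspace H" "\<And>v. v \<in> H \<Longrightarrow> Y *v v \<in> H" "b \<notin> H" "W = vec.span (insert b H)"
proof -
  obtain l where l: "(*v) (Y - mscale l (mat 1)) ` W \<noteq> W"
    using exists_nonsurjective_shift[OF W(2,1)] by blast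
  have T: "(Y - mscale l (mat 1)) *v v = Y *v v - l *s v" for v
    by (simp add: algebra_simps mscale_mv)
  define U where "U = (*v) (Y - mscale l (mat 1)) ` W"
  have UW: "U \<subseteq> W" using W st by (auto simp: U_def T intro!: vec.subspace_diff vec.subspace_scale)
  have subU: "vec.subspace U" unfolding U_def by (rule vec.subspace_image[OF W(1)])
  obtain B where B: "B \<subseteq> U" "vec.independent B" "U \<subseteq> vec.span B"
    using vec.maximal_independent_subset[of U] by blast
  obtain B' where B': "B \<subseteq> B'" "B' \<subseteq> W" "vec.independent B'" "W \<subseteq> vec.span B'"
    using vec.maximal_independent_subset_extend[OF order.trans[OF B(1) UW] B(2)] by blast
  have "vec.span B = U" "vec.span B' = W"
    by (rule vec.span_subspace[OF B(1,3) subU], rule vec.span_subspace[OF B'(2,4) W(1)])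
  then have "B \<noteq> B'" using l U_def by auto
  then obtain b where b: "b \<in> B'" "b \<notin> B" using B'(1) by blast
  define H where "H = vec.span (B' - {b})"
  have "B \<subseteq> B' - {b}" using B' b by blast
  then have UH: "U \<subseteq> H" using B(3) vec.span_mono[of B "B' - {b}"] by (auto simp: H_def)
  have HW: "H \<subseteq> W" unfolding H_def by (rule vec.span_minimal[OF _ W(1)]) (use B'(2) in blast)
  show ?thesis
  proof (rule that[of H b])
    show "vec.subspace H" by (simp add: H_def)
    show "b \<notin> H" using B'(3) b by (auto simp: H_def vec.dependent_def)
    show "Y *v v \<in> H" if "v \<in> H" for v
    proof -
      have "Y *v v - l *s v \<in> H" using that HW UH T by (auto simp: U_def image_subset_iff)
      moreover have "l *s v \<in> H" using that by (simp add: H_def vec.span_scale)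
      ultimately have "(Y *v v - l *s v) + l *s v \<in> H" unfolding H_def by (rule vec.span_add)
      then show ?thesis by simp
    qed
    show "W = vec.span (insert b H)"
    proof
      have "B' - {b} \<subseteq> H" unfolding H_def by (rule vec.span_superset)
      then have "B' \<subseteq> insert b H" by blast
      then show "W \<subseteq> vec.span (insert b H)" using B'(4) vec.span_mono by (metis order.trans)
      have "insert b H \<subseteq> W" using HW b B'(2) by blast
      then show "vec.span (insert b H) \<subseteq> W" using W(1) by (rule vec.span_minimal)
    qed
  qed
qed

lemma exists_invariant_flag:
  fixes Y :: "'k::alg_closed_field^'n^'n"
  assumes "vec.subspace W" "\<And>v. v \<in> W \<Longrightarrow> Y *v v \<in> W" "vec.dim W = m"
  shows "\<exists>V. V m = W \<and> (\<forall>i\<le>m. vec.subspace (V i) \<and> (\<forall>v\<in>V i. Y *v v \<in> V i)) \<and>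
    (\<forall>i<m. \<exists>b. b \<notin> V i \<and> V (Suc i) = vec.span (insert b (V i)))"
  using assms
proof (induction m arbitrary: W)
  case 0
  then show ?case by (intro exI[of _ "\<lambda>_. W"]) auto
next
  case (Suc m)
  then have "W \<noteq> {0}" by (metis nat.distinct(1) vec.dim_eq_0 order_refl)
  then obtain H b where H: "vec.subspace H" "\<And>v. v \<in> H \<Longrightarrow> Y *v v \<in> H" "b \<notin> H" "W = vec.span (insert b H)"
    using exists_invariant_hyperplane[OF Suc.prems(1) _ Suc.prems(2)] by metis
  have "b \<notin> vec.span H" using H(1,3) by (metis vec.span_eq_iff)
  then have "vec.dim H = m" using Suc.prems(3) H(4) by (simp add: vec.dim_insert)
  from Suc.IH[OF H(1,2) this] obtain V where V: "V m = H"
    "\<forall>i\<le>m. vec.subspace (V i) \<and> (\<forall>v\<in>V i. Y *v v \<in> V i)"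
    "\<forall>i<m. \<exists>b. b \<notin> V i \<and> V (Suc i) = vec.span (insert b (V i))" by blast
  show ?case
  proof (intro exI[of _ "V(Suc m := W)"] conjI allI impI)
    show "(V(Suc m := W)) (Suc m) = W" by simp
    fix i assume "i \<le> Suc m"
    then show "vec.subspace ((V(Suc m := W)) i)" using V Suc.prems by (auto simp: le_Suc_eq)
    show "\<forall>v\<in>(V(Suc m := W)) i. Y *v v \<in> (V(Suc m := W)) i"
      using V Suc.prems \<open>i \<le> Suc m\<close> by (auto simp: le_Suc_eq)
  next
    fix i assume "i < Suc m"
    then show "\<exists>b. b \<notin> (V(Suc m := W)) i \<and> (V(Suc m := W)) (Suc i) = vec.span (insert b ((V(Suc m := W)) i))"
      using V H by (auto simp: less_Suc_eq)
  qed
qed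

lemma linear_bracket: "Vector_Spaces.linear mscale mscale (bracket Y)"
  by unfold_locales (simp_all add: bracket_def matring mscale_distrib)

text \<open>Relative to an invariant flag, \<open>bracket Y\<close> maps triangular matrices to
  strictly triangular ones. The two spaces differ in dimension by at least \<open>CARD('n)\<close>,
  so the kernel is at least that large.\<close>

lemma dim_centralizer:
  fixes Y :: "'k::alg_closed_field^'n^'n"
  shows "CARD('n) \<le> matvs.dim {x. bracket Y x = 0}"
proof -
  let ?n = "CARD('n)"
  obtain V where V: "\<forall>i\<le>?n. vec.subspace (V i) \<and> (\<forall>v\<in>V i. Y *v v \<in> V i)"
    "\<forall>i<?n. \<exists>b. b \<notin> V i \<and> V (Suc i) = vec.span (insert b (V i))"
    using exists_invariant_flag[OF vec.subspace_UNIV, of Y ?n] by (auto simp: vec_dim_card card_cart_basis)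
  have subV: "vec.subspace (V i)" if "i \<le> ?n" for i using V that by blast
  have stV: "Y *v v \<in> V i" if "i \<le> ?n" "v \<in> V i" for i v using V that by blast
  have mono: "V i \<subseteq> V j" if "i \<le> j" "j \<le> ?n" for i j
    using that
  proof (induction j)
    case (Suc j)
    have "V j \<subseteq> V (Suc j)" using V(2) Suc.prems vec.span_superset by (metis Suc_le_lessD insert_subset)
    then show ?case using Suc by (auto simp: le_Suc_eq)
  qed simp
  \<comment> \<open>\<open>Bk 0\<close> consists of the triangular matrices and \<open>Bk ?n\<close>
    of the strictly triangular ones; in between, the first \<open>k\<close> diagonal entries
    vanish.\<close>
  define Bk where "Bk k = {x :: 'k^'n^'n. (\<forall>i\<le>?n. \<forall>v\<in>V i. x *v v \<in> V i) \<and> (\<forall>i<k. \<forall>v\<in>V (Suc i). x *v v \<in> V i)}" for k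
  have sub: "matvs.subspace (Bk k)" if "k \<le> ?n" for k
  proof (rule matvs.subspaceI)
    show "0 \<in> Bk k" using that subV by (simp add: Bk_def vec.subspace_0)
    show "x + y \<in> Bk k" if "x \<in> Bk k" "y \<in> Bk k" for x y
      using that \<open>k \<le> ?n\<close> subV by (simp add: Bk_def matrix_vector_mult_add_rdistrib vec.subspace_add)
    show "mscale c x \<in> Bk k" if "x \<in> Bk k" for c x
      using that \<open>k \<le> ?n\<close> subV by (simp add: Bk_def mscale_mv vec.subspace_scale)
  qed
  have "matvs.dim (Bk k) + k \<le> matvs.dim (Bk 0)" if "k \<le> ?n" for k
    using that
  proof (induction k)
    case (Suc k)
    then have "k < ?n" by simp
    obtain b where b: "b \<notin> V k" "V (Suc k) = vec.span (insert b (V k))" using V(2) \<open>k < ?n\<close> by blast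
    obtain \<psi> where \<psi>: "\<forall>u\<in>V k. dotp \<psi> u = 0" "dotp \<psi> b = 1"
      using separating_functional[OF subV b(1)] \<open>k < ?n\<close> by auto
    have bV: "b \<in> V (Suc k)" unfolding b(2) by (rule vec.span_base) simp
    \<comment> \<open>\<open>outer b \<psi>\<close> is triangular with a single nonzero diagonal
      entry, the one that distinguishes \<open>Bk k\<close> from \<open>Bk (Suc k)\<close>.\<close>
    have "outer b \<psi> *v v \<in> V i" if "i \<le> ?n" "v \<in> V i" for i v
    proof (cases "i \<le> k")
      case True
      then have "v \<in> V k" using mono[of i k] that \<open>k < ?n\<close> by auto
      then show ?thesis using \<psi> subV[OF that(1)] by (simp add: outer_mv vec.subspace_0)
    next
      case False
      then have "b \<in> V i" using bV mono[of "Suc k" i] that by auto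
      then show ?thesis using subV[OF that(1)] by (simp add: outer_mv vec.subspace_scale)
    qed
    moreover have "outer b \<psi> *v v \<in> V i" if "i < k" "v \<in> V (Suc i)" for i v
    proof -
      have "v \<in> V k" using mono[of "Suc i" k] that \<open>k < ?n\<close> by auto
      then show ?thesis using \<psi> subV[of i] that \<open>k < ?n\<close> by (simp add: outer_mv vec.subspace_0)
    qed
    ultimately have "outer b \<psi> \<in> Bk k" unfolding Bk_def by blast
    moreover have "outer b \<psi> \<notin> Bk (Suc k)"
    proof
      assume "outer b \<psi> \<in> Bk (Suc k)"
      then have "outer b \<psi> *v b \<in> V k" using bV unfolding Bk_def by blast
      then show False using b(1) \<psi>(2) by (simp add: outer_mv)
    qed
    moreover have "Bk (Suc k) \<subseteq> Bk k" by (auto simp: Bk_def)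
    ultimately have "Bk (Suc k) \<subset> Bk k" by blast
    then have "matvs.dim (Bk (Suc k)) < matvs.dim (Bk k)"
      using matfd.dim_psubset matvs.span_eq_iff sub Suc.prems by (metis Suc_leD)
    then show ?case using Suc by simp
  qed simp
  from this[of ?n] have 1: "matvs.dim (Bk ?n) + ?n \<le> matvs.dim (Bk 0)" by simp
  have "bracket Y x \<in> Bk ?n" if x: "x \<in> Bk 0" for x
  proof -
    have xV: "x *v v \<in> V i" if "i \<le> ?n" "v \<in> V i" for i v using x that by (auto simp: Bk_def)
    have br: "bracket Y x *v v = Y *v (x *v v) - x *v (Y *v v)" for v
      by (simp add: bracket_def algebra_simps matrix_vector_mul_assoc)
    have "bracket Y x *v v \<in> V i" if "i \<le> ?n" "v \<in> V i" for i v
      unfolding br using that by (intro vec.subspace_diff subV stV xV) auto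
    moreover have "bracket Y x *v u \<in> V i" if i: "i < ?n" and u: "u \<in> V (Suc i)" for i u
    proof -
      obtain b where b: "b \<notin> V i" "V (Suc i) = vec.span (insert b (V i))" using V(2) i by blast
      have i': "i \<le> ?n" "Suc i \<le> ?n" using i by auto
      note sV = subV[OF i'(1)]
      have spV: "vec.span (V i) = V i" using sV by simp
      have dec: "\<exists>k. v - k *s b \<in> V i" if "v \<in> V (Suc i)" for v
        using that unfolding b(2) vec.span_breakdown_eq spV .
      have bV: "b \<in> V (Suc i)" unfolding b(2) by (rule vec.span_base) simp
      obtain l where l: "Y *v b - l *s b \<in> V i" using dec[OF stV[OF i'(2) bV]] by blast
      obtain c where m: "x *v b - c *s b \<in> V i" using dec[OF xV[OF i'(2) bV]] by blast
      obtain k where k: "u - k *s b \<in> V i" using dec[OF u] by blast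
      \<comment> \<open>Modulo \<open>V i\<close>, both \<open>Y\<close> and \<open>x\<close> act on
        \<open>b\<close> by scalars, \<open>l\<close> and \<open>c\<close>; scalars commute, so the
        multiple of \<open>b\<close> cancels.\<close>
      have "bracket Y x *v b = (c *s (Y *v b - l *s b) + Y *v (x *v b - c *s b))
        - (l *s (x *v b - c *s b) + x *v (Y *v b - l *s b))"
        by (simp add: br algebra_simps mv_scale vec.scale_right_diff_distrib mult.commute)
      moreover have "\<dots> \<in> V i"
        by (intro vec.subspace_diff[OF sV] vec.subspace_add[OF sV] vec.subspace_scale[OF sV]
            stV[OF i'(1)] xV[OF i'(1)] l m)
      ultimately have bb: "bracket Y x *v b \<in> V i" by simp
      have "bracket Y x *v (u - k *s b) \<in> V i"
        unfolding br by (intro vec.subspace_diff[OF sV] stV[OF i'(1)] xV[OF i'(1)] k)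
      then have "bracket Y x *v (u - k *s b) + k *s (bracket Y x *v b) \<in> V i"
        using bb sV by (intro vec.subspace_add vec.subspace_scale) auto
      then show ?thesis by (simp add: algebra_simps mv_scale)
    qed
    ultimately show ?thesis unfolding Bk_def by blast
  qed
  then have "matvs.dim (bracket Y ` Bk 0) \<le> matvs.dim (Bk ?n)" by (intro matfd.dim_subset) auto
  moreover have "matvs.dim (Bk 0) \<le> matvs.dim {x \<in> Bk 0. bracket Y x = 0} + matvs.dim (bracket Y ` Bk 0)"
    by (rule matpair.dim_le_kernel_image[OF linear_bracket sub]) simp
  moreover have "matvs.dim {x \<in> Bk 0. bracket Y x = 0} \<le> matvs.dim {x. bracket Y x = 0}"
    by (rule matfd.dim_subset) auto
  ultimately show ?thesis using 1 by simp
qed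

section \<open>Regular nilpotent elements and the Killing form\<close>

lemma trace_bracket: "trace (Y ** bracket x z) = trace (bracket Y x ** z)"
proof -
  have "trace (Y ** (z ** x)) = trace (x ** (Y ** z))"
    using trace_mul_sym[of "Y ** z" x] by (simp add: matrix_mul_assoc)
  then show ?thesis by (simp add: bracket_def matring trace_sub)
qed

lemma trace_bracket_0: "trace (bracket x y) = 0"
  by (simp add: bracket_def trace_sub trace_mul_sym[of x y])

lemma subspace_sl: "matvs.subspace sl"
  by (auto simp: sl_def matvs.subspace_def trace_lin)

lemma functional_representation:
  assumes a: "matvs.subspace a" and \<xi>: "\<xi> \<in> dual a"
  shows "\<exists>Y. \<forall>z\<in>a. \<xi> z = trace (Y ** z)"
proof -
  obtain B where B: "B \<subseteq> a" "matvs.independent B" "a \<subseteq> matvs.span B"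
    using matvs.maximal_independent_subset[of a] by blast
  obtain g where g: "Vector_Spaces.linear mscale (*) g" "\<forall>b\<in>B. g b = \<xi> b"
    using matfun.linear_independent_extend[OF B(2), of \<xi>] by blast
  interpret g: Vector_Spaces.linear mscale "(*)" g by fact
  have sp: "matvs.span B = a" by (rule matvs.span_subspace[OF B(1,3) a])
  have \<xi>lin: "\<xi> (x + y) = \<xi> x + \<xi> y" "\<xi> (mscale c x) = c * \<xi> x" if "x \<in> a" "y \<in> a" for x y c
    using \<xi> that by (auto simp: dual_def)
  have "z \<in> a \<and> g z = \<xi> z" if "z \<in> matvs.span B" for z
    using that
  proof (induction rule: matvs.span_induct_alt)
    case base
    have "\<xi> (mscale 0 0) = 0 * \<xi> 0" using matvs.subspace_0[OF a] by (intro \<xi>lin) auto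
    then show ?case using matvs.subspace_0[OF a] by (simp add: g.zero)
  next
    case (step c x y)
    then have "x \<in> a" using B by blast
    then have m: "mscale c x \<in> a" by (rule matvs.subspace_scale[OF a])
    have "g (mscale c x + y) = \<xi> (mscale c x) + \<xi> y"
      using step g(2) \<xi>lin(2)[OF \<open>x \<in> a\<close> \<open>x \<in> a\<close>] by (simp add: g.add g.scale)
    then show ?case using \<xi>lin(1)[OF m, of y] step m matvs.subspace_add[OF a] by auto
  qed
  then have g\<xi>: "g z = \<xi> z" if "z \<in> a" for z using that sp by blast
  \<comment> \<open>The indices are exchanged because the trace form pairs
    \<open>mat_unit i j\<close> with the entry in row \<open>j\<close> and column
    \<open>i\<close>.\<close>
  define Y :: "'a^'b^'b" where "Y = (\<chi> i j. g (mat_unit j i))"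
  have "g z = trace (Y ** z)" for z
  proof -
    have "g z = g (\<Sum>i\<in>UNIV. \<Sum>j\<in>UNIV. mscale (z $ i $ j) (mat_unit i j))"
      using matrix_expansion[of z] by simp
    also have "\<dots> = (\<Sum>i\<in>UNIV. \<Sum>j\<in>UNIV. z $ i $ j * Y $ j $ i)"
      by (simp add: g.sum g.scale Y_def)
    also have "\<dots> = trace (Y ** z)"
      unfolding trace_def matrix_matrix_mult_def by (subst sum.swap) (simp add: mult.commute)
    finally show ?thesis .
  qed
  then show ?thesis using g\<xi> by metis
qed

lemma trace_functional_dual:
  assumes "matvs.subspace a" shows "(\<lambda>z\<in>a. c * trace (Y ** z)) \<in> dual a"
  using assms
  by (auto simp: dual_def matring trace_lin distrib_left mult.left_commute
      matvs.subspace_add matvs.subspace_scale)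

lemma stabilizer_trace_functional:
  fixes a :: "('k::field^'n^'n) set"
  assumes "c \<noteq> 0" and "\<And>x z. x \<in> a \<Longrightarrow> z \<in> a \<Longrightarrow> bracket x z \<in> a"
  shows "x \<in> stabilizer a (\<lambda>z\<in>a. c * trace (Y ** z)) \<longleftrightarrow>
    x \<in> a \<and> (\<forall>z\<in>a. trace (bracket Y x ** z) = 0)"
proof -
  have "coad a x (\<lambda>z\<in>a. c * trace (Y ** z)) = (\<lambda>z\<in>a. - c * trace (bracket Y x ** z))" if "x \<in> a"
    using that assms(2) by (auto simp: coad_def trace_bracket fun_eq_iff)
  then show ?thesis using \<open>c \<noteq> 0\<close> by (auto simp: stabilizer_def fun_eq_iff restrict_def) 
qed

text \<open>Basis independence of the trace for endomorphisms of the space of all matrices: the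
  right-hand side is the trace in the basis of matrix units.\<close>

lemma trace_on_full_basis:
  fixes f :: "'k::field^'n^'n \<Rightarrow> 'k^'n^'n"
  assumes f: "Vector_Spaces.linear mscale mscale f" and B: "matvs.independent B" "matvs.span B = UNIV"
  shows "(\<Sum>b\<in>B. matvs.representation B (f b) b) = (\<Sum>i\<in>UNIV. \<Sum>j\<in>UNIV. f (mat_unit i j) $ i $ j)"
proof -
  interpret f: Vector_Spaces.linear mscale mscale f by fact
  have fin: "finite B" by (rule matfd.finiteI_independent[OF B(1)])
  have sp: "x \<in> matvs.span B" for x using B(2) by simp
  have fb: "matvs.representation B (f b) b' = (\<Sum>i\<in>UNIV. \<Sum>j\<in>UNIV. b $ i $ j * matvs.representation B (f (mat_unit i j)) b')" for b b'
  proof -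
    have "f b = (\<Sum>i\<in>UNIV. \<Sum>j\<in>UNIV. mscale (b $ i $ j) (f (mat_unit i j)))"
      by (subst matrix_expansion[of b]) (simp add: f.sum f.scale)
    then show ?thesis
      by (simp add: matvs.representation_sum[OF B(1) sp] matvs.representation_scale[OF B(1) sp])
  qed
  have "(\<Sum>b\<in>B. matvs.representation B (f b) b) =
    (\<Sum>b\<in>B. \<Sum>i\<in>UNIV. \<Sum>j\<in>UNIV. b $ i $ j * matvs.representation B (f (mat_unit i j)) b)"
    by (rule sum.cong[OF refl]) (rule fb)
  also have "\<dots> = (\<Sum>i\<in>UNIV. \<Sum>j\<in>UNIV. \<Sum>b\<in>B. b $ i $ j * matvs.representation B (f (mat_unit i j)) b)"
    by (subst sum.swap) (intro sum.cong refl, rule sum.swap)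
  also have "\<dots> = (\<Sum>i\<in>UNIV. \<Sum>j\<in>UNIV. (\<Sum>b\<in>B. mscale (matvs.representation B (f (mat_unit i j)) b) b) $ i $ j)"
    by (simp add: mscale_def mult.commute)
  also have "\<dots> = (\<Sum>i\<in>UNIV. \<Sum>j\<in>UNIV. f (mat_unit i j) $ i $ j)"
    by (simp add: matvs.sum_representation_eq[OF B(1) sp fin])
  finally show ?thesis .
qed

text \<open>The composite of the two brackets kills the identity and has values in
  \<open>sl\<close>, so its trace on \<open>sl\<close> equals its trace on all matrices. There the
  matrix units give it explicitly, and the products of \<open>trace x\<close> and
  \<open>trace y\<close> vanish.\<close>

lemma killing_form_sl:
  fixes x y :: "'k::field_char_0^'n^'n"
  assumes "x \<in> sl" "y \<in> sl"
  shows "killing_form sl x y = 2 * of_nat CARD('n) * trace (x ** y)"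
proof -
  define f where "f z = bracket x (bracket y z)" for z :: "'k^'n^'n"
  have f: "Vector_Spaces.linear mscale mscale f" unfolding f_def
    using Vector_Spaces.linear_compose[OF linear_bracket linear_bracket] by (simp add: o_def)
  obtain B0 :: "('k^'n^'n) set" where "B0 \<subseteq> sl" "matvs.independent B0" "sl \<subseteq> matvs.span B0"
    using matvs.maximal_independent_subset[of sl] by blast
  then have "matvs.independent B0 \<and> matvs.span B0 = sl"
    using matvs.span_subspace subspace_sl by metis
  define B :: "('k^'n^'n) set" where "B = (SOME B. matvs.independent B \<and> matvs.span B = sl)"
  have B: "matvs.independent B" "matvs.span B = sl"
    unfolding B_def using someI[of "\<lambda>B. matvs.independent B \<and> matvs.span B = sl"]
      \<open>matvs.independent B0 \<and> matvs.span B0 = sl\<close> by blast+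
  have n0: "of_nat CARD('n) \<noteq> (0 :: 'k)" by simp
  have one: "mat 1 \<notin> matvs.span B" unfolding B sl_def by (simp add: trace_I)
  have B': "matvs.independent (insert (mat 1) B)" by (rule matvs.independent_insertI[OF one B(1)])
  have span': "matvs.span (insert (mat 1) B) = UNIV"
  proof -
    have "A \<in> matvs.span (insert (mat 1) B)" for A :: "'k^'n^'n"
      unfolding matvs.span_breakdown_eq B(2)
      by (rule exI[of _ "trace A / of_nat CARD('n)"]) (simp add: sl_def trace_lin trace_I)
    then show ?thesis by blast
  qed
  have fin: "finite B" by (rule matfd.finiteI_independent[OF B(1)])
  have "f b \<in> matvs.span B" for b unfolding B f_def sl_def by (simp add: trace_bracket_0)
  then have "matvs.representation (insert (mat 1) B) (f b) = matvs.representation B (f b)" for b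
    by (intro matvs.representation_extend[OF B']) auto
  moreover have "f (mat 1) = 0" by (simp add: f_def bracket_def)
  moreover have "mat 1 \<notin> B" using one matvs.span_base by blast
  ultimately have "(\<Sum>b\<in>B. matvs.representation B (f b) b) =
    (\<Sum>b\<in>insert (mat 1) B. matvs.representation (insert (mat 1) B) (f b) b)"
    using fin by (simp add: matvs.representation_zero)
  also have "\<dots> = (\<Sum>i\<in>UNIV. \<Sum>j\<in>UNIV. f (mat_unit i j) $ i $ j)"
    by (rule trace_on_full_basis[OF f B' span'])
  also have "\<dots> = (\<Sum>i\<in>UNIV. \<Sum>j\<in>UNIV. (x ** y) $ i $ i - x $ i $ i * y $ j $ j - y $ i $ i * x $ j $ j + (y ** x) $ j $ j)"
  proof (intro sum.cong refl)
    fix i j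
    have xEy: "(A ** (mat_unit i j ** C)) $ i $ j = A $ i $ i * C $ j $ j" for A C :: "'k^'n^'n"
      by (simp add: matrix_matrix_mult_def[of A] mat_unit_mult_nth if_distrib[of "(*) _"] cong: if_cong)
    have "f (mat_unit i j) = (x ** y) ** mat_unit i j - x ** (mat_unit i j ** y) - y ** (mat_unit i j ** x) + mat_unit i j ** (y ** x)"
      by (simp add: f_def bracket_def matring algebra_simps)
    then show "f (mat_unit i j) $ i $ j = (x ** y) $ i $ i - x $ i $ i * y $ j $ j - y $ i $ i * x $ j $ j + (y ** x) $ j $ j"
      by (simp add: xEy mult_mat_unit_nth mat_unit_mult_nth)
  qed
  also have "\<dots> = of_nat CARD('n) * trace (x ** y) - trace x * trace y - trace y * trace x + of_nat CARD('n) * trace (y ** x)"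
    by (simp add: sum.distrib sum_subtractf trace_def sum_distrib_left sum_distrib_right)
      (simp add: sum_distrib_left[symmetric] sum_distrib_right[symmetric])
  also have "\<dots> = 2 * of_nat CARD('n) * trace (x ** y)"
    using assms by (simp add: sl_def trace_mul_sym[of y x])
  finally show ?thesis by (simp add: killing_form_def trace_on_def Let_def B_def[symmetric] f_def)
qed

lemma rho_sl:
  fixes y :: "'k::field_char_0^'n^'n"
  assumes "y \<in> sl" "a \<subseteq> sl"
  shows "rho sl a y = (\<lambda>z\<in>a. 2 * of_nat CARD('n) * trace (y ** z))"
  using assms by (auto simp: rho_def killing_form_sl fun_eq_iff)

text \<open>Testing against \<open>sl\<close> suffices, since a commutator is orthogonal to the
  scalars for the trace form.\<close>

lemma centralizer_of_functional:
  fixes Y :: "'k::field_char_0^'n^'n"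
  assumes "\<And>z. z \<in> sl \<Longrightarrow> trace (bracket Y x ** z) = 0"
  shows "bracket Y x = 0"
proof -
  let ?M = "bracket Y x"
  show ?thesis
  proof (rule trace_nondegenerate)
    fix z :: "'k^'n^'n"
    have "z - mscale (trace z / of_nat CARD('n)) (mat 1) \<in> sl"
      by (simp add: sl_def trace_lin trace_I)
    then have "trace (?M ** (z - mscale (trace z / of_nat CARD('n)) (mat 1))) = 0" by (rule assms)
    then show "trace (?M ** z) = 0"
      by (simp add: matrix_diff_ldistrib mscale_mult_right trace_lin trace_bracket_0)
  qed
qed

lemma bracket_in_sl: "bracket x z \<in> sl"
  by (simp add: sl_def trace_bracket_0)

text \<open>The centralizer in all matrices is spanned by its traceless part and the identity, so
  passing to \<open>sl\<close> costs at most one dimension.\<close>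

lemma stabilizer_sl_dim_ge:
  fixes \<xi> :: "'k::{alg_closed_field, field_char_0}^'n^'n \<Rightarrow> 'k"
  assumes "\<xi> \<in> dual sl"
  shows "CARD('n) - 1 \<le> matvs.dim (stabilizer sl \<xi>)"
proof -
  obtain Y where Y: "\<forall>z\<in>sl. \<xi> z = trace (Y ** z)"
    using functional_representation[OF subspace_sl assms] by blast
  have "\<xi> = (\<lambda>z\<in>sl. 1 * trace (Y ** z))"
    using Y assms by (auto simp: dual_def extensional_def fun_eq_iff)
  then have stab: "x \<in> stabilizer sl \<xi>" if "x \<in> sl" "bracket Y x = 0" for x
    using stabilizer_trace_functional[of 1 sl x Y, OF one_neq_zero bracket_in_sl] that by simp
  let ?Z = "{x. bracket Y x = 0}"
  have subZ: "matvs.subspace ?Z"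
    by (auto simp: matvs.subspace_def bracket_def matring mscale_distrib simp flip: mscale_distrib)
  define k :: "'k^'n^'n" where "k = mat 1"
  have "?Z \<subseteq> matvs.span (insert k (stabilizer sl \<xi>))"
  proof
    fix x assume x: "x \<in> ?Z"
    let ?c = "trace x / of_nat CARD('n)"
    have "x - mscale ?c k \<in> sl" by (simp add: k_def sl_def trace_lin trace_I)
    moreover have "bracket Y (x - mscale ?c k) = 0"
      using x by (simp add: k_def bracket_def matring)
    ultimately have "x - mscale ?c k \<in> matvs.span (stabilizer sl \<xi>)" using stab matvs.span_base by blast
    then show "x \<in> matvs.span (insert k (stabilizer sl \<xi>))"
      unfolding matvs.span_breakdown_eq by blast
  qed
  then have "matvs.dim ?Z \<le> matvs.dim (insert k (stabilizer sl \<xi>))" by (rule matfd.dim_mono)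
  also have "\<dots> \<le> Suc (matvs.dim (stabilizer sl \<xi>))" by (simp add: matfd.dim_insert)
  finally show ?thesis using dim_centralizer[of Y] by simp
qed

text \<open>A vector \<open>v\<close> not killed by \<open>y^(n-1)\<close>, \<open>n\<close> the
  size, is cyclic, so a matrix commuting with \<open>y\<close> is determined by its value at
  \<open>v\<close>. On \<open>sl\<close> this evaluation is not onto: only the identity commutes
  with \<open>y\<close> and has value \<open>v\<close>, and its trace is not zero.\<close>

lemma centralizer_reg_nilpotent_dim_le:
  fixes y :: "'k::field_char_0^'n^'n"
  assumes y: "reg_nilpotent y CARD('n)"
  shows "matvs.dim {x \<in> sl. bracket y x = 0} \<le> CARD('n) - 1"
proof -
  let ?n = "CARD('n)" and ?S = "{x \<in> sl. bracket y x = 0}"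
  obtain v where v: "mpow y (?n - 1) *v v \<noteq> 0"
    using y by (metis matrix_eqI matrix_vector_mult_0 reg_nilpotent_def)
  have sub: "matvs.subspace ?S"
    by (auto simp: matvs.subspace_def bracket_def sl_def trace_lin matring simp flip: mscale_distrib)
  have full: "K = UNIV" if "?n \<le> vec.dim K" "vec.subspace K" for K :: "('k^'n) set"
    using that by (intro vec.subspace_dim_equal) (auto simp: vec_dim_card card_cart_basis)
  have inj: "x = 0" if x: "bracket y x = 0" "x *v v = 0" for x
  proof -
    let ?K = "{u. x *v u = 0}"
    have c: "x *v (y *v u) = y *v (x *v u)" for u
      using x(1) by (simp add: bracket_def matrix_vector_mul_assoc)
    have "?n \<le> vec.dim ?K"
    proof (rule cyclic_dim_le)
      show "vec.subspace ?K" by (auto simp: vec.subspace_def algebra_simps mv_scale)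
      show "y *v u \<in> ?K" if "u \<in> ?K" for u using that by (simp add: c)
      show "mpow y ?n *v v = 0" using y by (simp add: reg_nilpotent_def)
    qed (use x v in auto)
    moreover have "vec.subspace ?K" by (auto simp: vec.subspace_def algebra_simps mv_scale)
    ultimately have "?K = UNIV" by (rule full)
    then have "x *v u = 0 *v u" for u by auto
    then show "x = 0" by (rule matrix_eqI)
  qed
  have lin: "Vector_Spaces.linear mscale (*s) (\<lambda>x. x *v v)"
    by unfold_locales (simp_all add: algebra_simps mscale_mv)
  have 1: "matvs.dim ?S \<le> matvs.dim {x \<in> ?S. x *v v = 0} + vec.dim ((\<lambda>x. x *v v) ` ?S)"
    by (rule matvec.dim_le_kernel_image[OF lin sub])
  have "{x \<in> ?S. x *v v = 0} \<subseteq> {0}" using inj by blast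
  then have 2: "matvs.dim {x \<in> ?S. x *v v = 0} = 0" unfolding matfd.dim_eq_0 .
  have "vec.dim ((\<lambda>x. x *v v) ` ?S) < ?n"
  proof (rule ccontr)
    assume "\<not> ?thesis"
    then have "?n \<le> vec.dim ((\<lambda>x. x *v v) ` ?S)" by simp
    moreover have "vec.subspace ((\<lambda>x. x *v v) ` ?S)"
      using lin sub by (rule matvec.linear_subspace_image)
    ultimately have "(\<lambda>x. x *v v) ` ?S = UNIV" by (rule full)
    then have "v \<in> (\<lambda>x. x *v v) ` ?S" by simp
    then obtain x where x: "x \<in> ?S" "x *v v = v" by auto
    have "x - mat 1 = 0"
      by (rule inj) (use x in \<open>simp_all add: bracket_def matring algebra_simps\<close>)
    then show False using x(1) by (simp add: sl_def trace_I)
  qed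
  then show ?thesis using 1 unfolding 2 by linarith
qed

text \<open>The \<open>m\<close>-fold bracket is a combination of the terms \<open>y^i x y^j\<close>
  with \<open>i + j = m\<close>.\<close>

lemma ad_nilpotent:
  assumes "\<And>i j. i + j \<ge> m \<Longrightarrow> mpow y i ** x ** mpow y j = 0"
  shows "(bracket y ^^ m) x = 0"
  using assms
proof (induction m arbitrary: x)
  case 0
  then show ?case using "0"[of 0 0] by simp
next
  case (Suc m)
  have "(bracket y ^^ m) (bracket y x) = 0"
  proof (rule Suc.IH)
    fix i j assume "m \<le> i + j"
    then have "mpow y (Suc i) ** x ** mpow y j = 0" "mpow y i ** x ** mpow y (Suc j) = 0"
      by (intro Suc.prems, simp)+
    then show "mpow y i ** bracket y x ** mpow y j = 0"
      by (simp add: bracket_def matring mpow_commute[symmetric])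
  qed
  then show ?case by (simp add: funpow_swap1)
qed

text \<open>The index of \<open>sl\<close> is settled here: \<open>CARD('n) - 1\<close> bounds every
  stabilizer from below, and \<open>y\<close> attains the bound.\<close>

lemma reg_nilpotent_in_cone:
  fixes y :: "'k::{alg_closed_field, field_char_0}^'n^'n"
  assumes y: "reg_nilpotent y CARD('n)" and "trace y = 0"
  shows "y \<in> nilpotent_cone_reg sl"
proof -
  let ?n = "CARD('n)"
  have ysl: "y \<in> sl" using assms(2) by (simp add: sl_def)
  have "(bracket y ^^ (2 * ?n)) x = 0" for x
  proof (rule ad_nilpotent)
    fix i j assume "2 * ?n \<le> i + j"
    then have "?n \<le> i \<or> ?n \<le> j" by linarith
    then have "mpow y i = 0 \<or> mpow y j = 0"
      using y mpow_eq_0_mono by (auto simp: reg_nilpotent_def)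
    then show "mpow y i ** x ** mpow y j = 0" by auto
  qed
  then have cone: "y \<in> nilpotent_cone sl" using ysl by (auto simp: nilpotent_cone_def)
  let ?\<xi> = "\<lambda>z\<in>sl. 2 * of_nat CARD('n) * trace (y ** z)"
  have \<xi>: "rho sl sl y = ?\<xi>" by (rule rho_sl[OF ysl order_refl])
  have dual: "?\<xi> \<in> dual sl" by (rule trace_functional_dual[OF subspace_sl])
  have "2 * of_nat CARD('n) \<noteq> (0 :: 'k)" by simp
  then have "stabilizer sl ?\<xi> \<subseteq> {x \<in> sl. bracket y x = 0}"
    using stabilizer_trace_functional[of "2 * of_nat CARD('n)" sl _ y] bracket_in_sl
      centralizer_of_functional[of y] by blast
  then have "matvs.dim (stabilizer sl ?\<xi>) \<le> ?n - 1"
    using matfd.dim_subset centralizer_reg_nilpotent_dim_le[OF y] order.trans by blast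
  then have d: "matvs.dim (stabilizer sl ?\<xi>) = ?n - 1"
    using stabilizer_sl_dim_ge[OF dual] by simp
  have "lie_index (sl :: ('k^'n^'n) set) = ?n - 1"
    unfolding lie_index_def
    by (rule Least_equality) (use d dual stabilizer_sl_dim_ge in force)+
  then show ?thesis using cone dual d by (simp add: nilpotent_cone_reg_def regular_functional_def \<xi>)
qed

section \<open>Maximal parabolic subalgebras\<close>

definition coord_proj :: "'n set \<Rightarrow> 'k::field^'n^'n" where
  "coord_proj S = (\<chi> i j. if i = j \<and> i \<in> S then 1 else 0)"

lemma coord_proj_mult_nth: "(coord_proj S ** A) $ i $ j = (if i \<in> S then A $ i $ j else 0)"
proof -
  have "(\<Sum>k\<in>UNIV. (if i = k \<and> i \<in> S then 1 else 0) * A $ k $ j) =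
      (\<Sum>k\<in>UNIV. if k = i then (if i \<in> S then A $ i $ j else 0) else 0)"
    by (intro sum.cong) auto
  then show ?thesis by (simp add: coord_proj_def matrix_matrix_mult_def)
qed

lemma mult_coord_proj_nth: "(A ** coord_proj S) $ i $ j = (if j \<in> S then A $ i $ j else 0)"
proof -
  have "(\<Sum>k\<in>UNIV. A $ i $ k * (if k = j \<and> k \<in> S then 1 else 0)) =
      (\<Sum>k\<in>UNIV. if k = j then (if j \<in> S then A $ i $ j else 0) else 0)"
    by (intro sum.cong) auto
  then show ?thesis by (simp add: coord_proj_def matrix_matrix_mult_def)
qed

text \<open>Replaces the basis change \<open>T\<close> and the coordinate set \<open>S\<close> by
  two idempotents, the conjugated coordinate projections, in which all later statements are
  phrased.\<close>

lemma two_blocks_idempotents: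
  fixes L :: "('k::field_char_0^'n^'n) set"
  assumes "two_blocks p q L"
  obtains e f where "blocks e f" "e + f = mat 1" "rk e = p" "rk f = q"
    "L = {x \<in> sl. e ** x ** f = 0 \<and> f ** x ** e = 0}"
proof -
  obtain T :: "'k^'n^'n" and S :: "'n set" where T: "invertible T" and S: "card S = p" "card (- S) = q"
    and L: "L = (\<lambda>A. T ** A ** matrix_inv T) ` {A \<in> sl. \<forall>i j. (i \<in> S) \<noteq> (j \<in> S) \<longrightarrow> A $ i $ j = 0}"
    using assms unfolding two_blocks_def by blast
  define T' where "T' = matrix_inv T"
  have "T ** T' = mat 1 \<and> T' ** T = mat 1"
    unfolding T'_def matrix_inv_def by (rule someI_ex) (use T in \<open>simp add: invertible_def\<close>)
  then have TT: "T ** T' = mat 1" "T' ** T = mat 1" by auto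
  have TX: "T ** (T' ** X) = X" "T' ** (T ** X) = X" for X
    using mult_assoc_eq[OF TT(1), of X] mult_assoc_eq[OF TT(2), of X] by simp_all
  define conj where "conj A = T ** A ** T'" for A
  have conj_mult: "conj A ** conj B = conj (A ** B)" for A B
    by (simp add: conj_def matring TX)
  have conj_0: "conj A = 0 \<longleftrightarrow> A = 0" for A
  proof
    assume "conj A = 0"
    then have "T' ** conj A ** T = 0" by simp
    then show "A = 0" by (simp add: conj_def matring TX TT)
  qed (simp add: conj_def)
  have conj_tr: "trace (conj A) = trace A" for A
    unfolding conj_def by (subst trace_mul_sym) (simp add: matrix_mul_assoc TT)
  have proj: "coord_proj U ** coord_proj V = (coord_proj (U \<inter> V) :: 'k^'n^'n)" for U V :: "'n set"
    by (simp add: vec_eq_iff coord_proj_mult_nth) (simp add: coord_proj_def)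
  have proj0: "(coord_proj {} :: 'k^'n^'n) = 0" by (simp add: coord_proj_def vec_eq_iff)
  have trp: "trace (coord_proj U :: 'k^'n^'n) = of_nat (card U)" for U :: "'n set"
    by (simp add: trace_def coord_proj_def sum.If_cases)
  define e where "e = conj (coord_proj S)"
  define f where "f = conj (coord_proj (- S))"
  have b: "blocks e f" by (simp add: blocks_def e_def f_def conj_mult proj proj0 conj_0)
  have "coord_proj S + coord_proj (- S) = (mat 1 :: 'k^'n^'n)"
    by (simp add: vec_eq_iff coord_proj_def mat_def)
  then have 1: "e + f = mat 1"
    by (simp add: e_def f_def conj_def matrix_add_ldistrib[symmetric] matrix_add_rdistrib[symmetric] TT)
  have rk: "rk e = p" "rk f = q"
    using trace_idempotent[OF blocksD(1)[OF b]] trace_idempotent[OF blocksD(2)[OF b]] S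
    by (simp_all add: e_def f_def conj_tr trp)
  have mem: "conj A \<in> {x \<in> sl. e ** x ** f = 0 \<and> f ** x ** e = 0} \<longleftrightarrow>
    A \<in> {A \<in> sl. \<forall>i j. (i \<in> S) \<noteq> (j \<in> S) \<longrightarrow> A $ i $ j = 0}" for A
    unfolding e_def f_def conj_mult mem_Collect_eq conj_0 sl_def conj_tr
    by (auto simp: vec_eq_iff coord_proj_mult_nth mult_coord_proj_nth)
  have surj: "x = conj (T' ** x ** T)" for x by (simp add: conj_def matring TX TT)
  have "L = {x \<in> sl. e ** x ** f = 0 \<and> f ** x ** e = 0}"
    unfolding L T'_def[symmetric] conj_def[symmetric]
  proof (intro set_eqI iffI)
    fix x assume "x \<in> {x \<in> sl. e ** x ** f = 0 \<and> f ** x ** e = 0}"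
    then show "x \<in> conj ` {A \<in> sl. \<forall>i j. (i \<in> S) \<noteq> (j \<in> S) \<longrightarrow> A $ i $ j = 0}"
      using mem[of "T' ** x ** T"] surj[of x] by (intro image_eqI[of _ _ "T' ** x ** T"]) auto
  next
    fix x assume "x \<in> conj ` {A \<in> sl. \<forall>i j. (i \<in> S) \<noteq> (j \<in> S) \<longrightarrow> A $ i $ j = 0}"
    then show "x \<in> {x \<in> sl. e ** x ** f = 0 \<and> f ** x ** e = 0}" using mem by blast
  qed
  then show ?thesis using that b 1 rk by blast
qed

section \<open>The action of the Levi factor on the off-diagonal blocks\<close>

lemma full_decomp:
  assumes "e + f = mat 1"
  shows "x = e ** x ** e + e ** x ** f + f ** x ** e + f ** x ** (f :: 'k::field^'n^'n)"
  by (rule corner_decomp) (simp add: assms corner_def)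

lemma blocks_swap: "blocks e f \<Longrightarrow> blocks f e"
  by (simp add: blocks_def)

lemma trace_split:
  assumes "e + f = mat 1"
  shows "trace x = trace (e ** x) + trace (f ** (x :: 'k::field^'n^'n))"
  by (simp add: trace_add[symmetric] matrix_add_rdistrib[symmetric] assms)

text \<open>The projections onto the off-diagonal blocks are polynomials in the adjoint action of
  \<open>q e - p f\<close>, whose eigenvalues are \<open>p + q\<close>, \<open>- (p + q)\<close> and \<open>0\<close>.\<close>

lemma off_diagonal_projection:
  fixes e f :: "'k::field_char_0^'n^'n"
  assumes ef: "blocks e f" and 1: "e + f = mat 1" and "rk e > 0"
    and M: "matvs.subspace M" and st: "\<And>l x. l \<in> sl \<Longrightarrow> e ** l ** f = 0 \<Longrightarrow> f ** l ** e = 0 \<Longrightarrow> x \<in> M \<Longrightarrow> bracket l x \<in> M"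
    and x: "x \<in> M"
  shows "e ** x ** f \<in> M" "f ** x ** e \<in> M"
proof -
  define p q n :: 'k where "p = of_nat (rk e)" and "q = of_nat (rk f)" and "n = p + q"
  have "n = of_nat (rk e + rk f)" by (simp add: n_def p_def q_def)
  then have n0: "n \<noteq> 0" using \<open>rk e > 0\<close> by (simp del: of_nat_add)
  define h where "h = mscale q e - mscale p f"
  have h: "h \<in> sl" "e ** h ** f = 0" "f ** h ** e = 0"
    using trace_idempotent[OF blocksD(1)[OF ef]] trace_idempotent[OF blocksD(2)[OF ef]]
    by (simp_all add: h_def sl_def trace_lin p_def q_def matring blocksD[OF ef])
  have br: "bracket h z = mscale n (e ** z ** f) - mscale n (f ** z ** e)" for z
  proof -
    have "bracket h (a + b + c + d) = bracket h a + bracket h b + bracket h c + bracket h d" for a b c d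
      by (simp add: bracket_def matrix_add_ldistrib matrix_add_rdistrib)
    then have "bracket h z = bracket h (e ** z ** e) + bracket h (e ** z ** f) + bracket h (f ** z ** e) + bracket h (f ** z ** f)"
      using full_decomp[OF 1, of z] by metis
    also have "\<dots> = mscale n (e ** z ** f) - mscale n (f ** z ** e)"
      by (simp add: h_def bracket_def matring blocksD[OF ef] n_def matvs.scale_left_distrib)
    finally show ?thesis .
  qed
  have b1: "bracket h x \<in> M" and b2: "bracket h (bracket h x) \<in> M" using st h x by blast+
  have bb: "bracket h (bracket h x) = mscale (n * n) (e ** x ** f) + mscale (n * n) (f ** x ** e)"
    unfolding br[of "bracket h x"] unfolding br[of x] by (simp add: matring blocksD[OF ef])
  have s: "mscale n (bracket h x) + bracket h (bracket h x) = mscale (2 * (n * n)) (e ** x ** f)"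
    "bracket h (bracket h x) - mscale n (bracket h x) = mscale (2 * (n * n)) (f ** x ** e)"
    unfolding bb unfolding br[of x] by (simp_all add: mscale_def vec_eq_iff algebra_simps)
  have "mscale (2 * (n * n)) (e ** x ** f) \<in> M" "mscale (2 * (n * n)) (f ** x ** e) \<in> M"
    unfolding s[symmetric]
    by (intro matvs.subspace_add[OF M] matvs.subspace_scale[OF M] matvs.subspace_diff[OF M] b1 b2)+
  from matvs.subspace_scale[OF M this(1), of "1 / (2 * (n * n))"]
    matvs.subspace_scale[OF M this(2), of "1 / (2 * (n * n))"]
  show "e ** x ** f \<in> M" "f ** x ** e \<in> M" using n0 by simp_all
qed

text \<open>The block \<open>e gl f\<close> is irreducible under the Levi factor. Multiplication by
  \<open>e a e\<close> agrees with a bracket up to a multiple of the vector, once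
  \<open>e a e\<close> is made traceless by a multiple of \<open>f\<close>. Left and right
  multiplication by matrix units then move a nonzero entry of \<open>m\<close> anywhere.\<close>

lemma off_diagonal_irreducible:
  fixes e f :: "'k::field_char_0^'n^'n"
  assumes ef: "blocks e f" and rk: "rk e > 0" "rk f > 0"
    and M: "matvs.subspace M" and st: "\<And>l x. l \<in> sl \<Longrightarrow> e ** l ** f = 0 \<Longrightarrow> f ** l ** e = 0 \<Longrightarrow> x \<in> M \<Longrightarrow> bracket l x \<in> M"
    and m: "m \<in> M" "e ** m = m" "m ** f = m" "m \<noteq> 0"
  shows "e ** x ** f \<in> M"
proof -
  have tre: "trace e \<noteq> 0" "trace f \<noteq> 0"
    using rk trace_idempotent[OF blocksD(1)[OF ef]] trace_idempotent[OF blocksD(2)[OF ef]] by simp_all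
  have left: "(e ** a ** e) ** z \<in> M" if z: "z \<in> M" "e ** z = z" "z ** f = z" for a z
  proof -
    define c where "c = trace (e ** a ** e) / trace f"
    define l where "l = e ** a ** e - mscale c f"
    have "l \<in> sl" using tre by (simp add: l_def sl_def trace_lin c_def)
    moreover have "e ** l ** f = 0" "f ** l ** e = 0"
      by (simp_all add: l_def matring blocksD[OF ef])
    ultimately have lz: "bracket l z \<in> M" using st z by blast
    have z0: "f ** z = 0" "z ** e = 0" using blocks_zero(1)[OF ef z(2)] blocks_zero(4)[OF ef z(3)] by auto
    have "z ** (e ** X) = 0" for X using mult_assoc_eq[OF z0(2), of X] by simp
    then have "bracket l z = (e ** a ** e) ** z + mscale c z"
      by (simp add: l_def bracket_def matring z z0)
    then have "(e ** a ** e) ** z = bracket l z - mscale c z" by simp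
    then show ?thesis using matvs.subspace_diff[OF M lz matvs.subspace_scale[OF M z(1)]] by simp
  qed
  have right: "z ** (f ** a ** f) \<in> M" if z: "z \<in> M" "e ** z = z" "z ** f = z" for a z
  proof -
    define c where "c = trace (f ** a ** f) / trace e"
    define l where "l = mscale c e - f ** a ** f"
    have "l \<in> sl" using tre by (simp add: l_def sl_def trace_lin c_def)
    moreover have "e ** l ** f = 0" "f ** l ** e = 0"
      by (simp_all add: l_def matring blocksD[OF ef])
    ultimately have lz: "bracket l z \<in> M" using st z by blast
    have z0: "f ** z = 0" "z ** e = 0" using blocks_zero(1)[OF ef z(2)] blocks_zero(4)[OF ef z(3)] by auto
    have "bracket l z = z ** (f ** a ** f) + mscale c z"
      by (simp add: l_def bracket_def matring z z0)
    then have "z ** (f ** a ** f) = bracket l z - mscale c z" by simp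
    then show ?thesis using matvs.subspace_diff[OF M lz matvs.subspace_scale[OF M z(1)]] by simp
  qed
  obtain j k where jk: "m $ j $ k \<noteq> 0" using m(4) by (auto simp: vec_eq_iff)
  have unit: "e ** mat_unit i l ** f \<in> M" for i l
  proof -
    let ?z = "(e ** mat_unit i j ** e) ** m"
    have z: "?z \<in> M" "e ** ?z = ?z" "?z ** f = ?z"
      using left[OF m(1-3)] by (simp_all add: matring blocksD[OF ef] m)
    have "?z ** (f ** mat_unit k l ** f) = e ** (mat_unit i j ** m ** mat_unit k l) ** f"
      by (simp add: matring m mult_assoc_eq[OF m(2)] mult_assoc_eq[OF m(3)])
    also have "mat_unit i j ** m ** mat_unit k l = mscale (m $ j $ k) (mat_unit i l)"
      by (simp add: vec_eq_iff mult_mat_unit_nth mat_unit_mult_nth mscale_def mat_unit_nth)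
    finally have "mscale (m $ j $ k) (e ** mat_unit i l ** f) \<in> M"
      using right[OF z, of "mat_unit k l"] by (simp add: mscale_mult_left mscale_mult_right)
    then have "mscale (1 / m $ j $ k) (mscale (m $ j $ k) (e ** mat_unit i l ** f)) \<in> M"
      by (rule matvs.subspace_scale[OF M])
    then show ?thesis using jk by simp
  qed
  have "e ** x ** f = e ** (\<Sum>i\<in>UNIV. \<Sum>l\<in>UNIV. mscale (x $ i $ l) (mat_unit i l)) ** f"
    using matrix_expansion[of x] by simp
  also have "\<dots> = (\<Sum>i\<in>UNIV. \<Sum>l\<in>UNIV. mscale (x $ i $ l) (e ** mat_unit i l ** f))"
    by (simp add: matrix_sum_left matrix_sum_right mscale_mult_left mscale_mult_right)
  also have "\<dots> \<in> M"
    by (intro matvs.subspace_sum[OF M] matvs.subspace_scale[OF M] unit)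
  finally show ?thesis .
qed

lemma exists_unit_vectors:
  fixes e :: "'k::field^'n^'n"
  assumes "e ** e = e" "rk e > 0"
  obtains v w where "e *v v = v" "w v* e = w" "dotp w v = 1"
proof -
  have "e \<noteq> 0" using assms(2) vec.dim_eq_0[of "img e"] by (auto simp: rk_def img_def)
  then show ?thesis using that idempotent_remove_rank_one[OF assms(1)] by metis
qed

section \<open>Derived algebras and the shape of the parabolic\<close>

lemma derived_algebra_mono: "c \<subseteq> d \<Longrightarrow> derived_algebra c \<subseteq> derived_algebra d"
  unfolding derived_algebra_def lie_product_def by (rule matvs.span_mono) auto

lemma derived_algebra_subset:
  assumes "matvs.subspace V" "\<And>x y. x \<in> c \<Longrightarrow> y \<in> c \<Longrightarrow> bracket x y \<in> V"
  shows "derived_algebra c \<subseteq> V"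
  unfolding derived_algebra_def lie_product_def
  by (rule matvs.span_minimal[OF _ assms(1)]) (use assms(2) in auto)

lemma bracket_in_derived_algebra: "x \<in> c \<Longrightarrow> y \<in> c \<Longrightarrow> bracket x y \<in> derived_algebra c"
  unfolding derived_algebra_def lie_product_def by (rule matvs.span_base) blast

lemma subspace_derived_algebra: "matvs.subspace (derived_algebra c)"
  by (simp add: derived_algebra_def lie_product_def)

text \<open>A Borel subalgebra inside the block diagonal matrices could be enlarged by the abelian
  ideal \<open>e gl f\<close>.\<close>

lemma borel_not_block_diagonal:
  fixes e f :: "'k::field_char_0^'n^'n"
  assumes ef: "blocks e f" and rk: "rk e > 0" "rk f > 0"
    and b: "borel_subalgebra b sl"
  shows "\<not> b \<subseteq> {x. e ** x ** f = 0 \<and> f ** x ** e = 0 \<and> x = e ** x ** e + f ** x ** f}" (is "\<not> b \<subseteq> ?D")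
proof
  assume bD: "b \<subseteq> ?D"
  define N where "N = {x. e ** x = x \<and> x ** f = x}"
  define ext where "ext c = {x + y | x y. x \<in> c \<and> y \<in> N}" for c
  have subN: "matvs.subspace N" by (auto simp: N_def matvs.subspace_def matring)
  have N0: "f ** y = 0" "y ** e = 0" if "y \<in> N" for y
    using that blocks_zero(1)[OF ef, of y] blocks_zero(4)[OF ef, of y] by (simp_all add: N_def)
  have NN: "y ** y' = 0" if "y \<in> N" "y' \<in> N" for y y'
  proof -
    have "y ** y' = y ** f ** y'" using that by (simp add: N_def)
    also have "\<dots> = y ** (f ** y')" by (simp add: matrix_mul_assoc)
    finally show ?thesis using N0[OF that(2)] by simp
  qed
  have D: "e ** x = e ** x ** e" "x ** e = e ** x ** e" "f ** x = f ** x ** f" "x ** f = f ** x ** f"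
    if "x \<in> ?D" for x
  proof -
    have x: "x = e ** x ** e + f ** x ** f" using that by blast
    have "e ** (e ** x ** e + f ** x ** f) = e ** x ** e" "(e ** x ** e + f ** x ** f) ** e = e ** x ** e"
      "f ** (e ** x ** e + f ** x ** f) = f ** x ** f" "(e ** x ** e + f ** x ** f) ** f = f ** x ** f"
      by (simp_all add: matring blocksD[OF ef])
    then show "e ** x = e ** x ** e" "x ** e = e ** x ** e" "f ** x = f ** x ** f" "x ** f = f ** x ** f"
      using x by metis+
  qed
  have DN: "x ** y \<in> N" "y ** x \<in> N" if "x \<in> ?D" "y \<in> N" for x y
  proof -
    have y: "e ** y = y" "y ** f = y" using that by (auto simp: N_def)
    have ex: "e ** x = x ** e" and fx: "x ** f = f ** x" using D[OF that(1)] by simp_all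
    have "e ** (x ** y) = e ** x ** y" by (simp add: matrix_mul_assoc)
    also have "\<dots> = x ** y" unfolding ex by (simp add: matrix_mul_assoc[symmetric] y)
    finally have 1: "e ** (x ** y) = x ** y" .
    have "y ** x ** f = y ** (x ** f)" by (simp add: matrix_mul_assoc)
    also have "\<dots> = y ** x" unfolding fx by (simp add: matrix_mul_assoc y)
    finally have 2: "y ** x ** f = y ** x" .
    show "x ** y \<in> N" "y ** x \<in> N"
      using 1 2 y by (simp_all add: N_def matrix_mul_assoc) (simp add: matrix_mul_assoc[symmetric] y)
  qed
  have brD: "bracket x x' \<in> ?D" if "x \<in> ?D" "x' \<in> ?D" for x x'
  proof -
    have c: "e ** x = x ** e" "f ** x = x ** f" "e ** x' = x' ** e" "f ** x' = x' ** f"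
      using D[OF that(1)] D[OF that(2)] by simp_all
    let ?b = "bracket x x'"
    have eb: "e ** ?b = ?b ** e"
      by (simp add: bracket_def matring c mult_assoc_eq[OF c(1)] mult_assoc_eq[OF c(3)])
    have fb: "f ** ?b = ?b ** f"
      by (simp add: bracket_def matring c mult_assoc_eq[OF c(2)] mult_assoc_eq[OF c(4)])
    have "(e + f) ** x = x" "(e + f) ** x' = x'"
      unfolding matrix_add_rdistrib using D(1,3)[OF that(1)] D(1,3)[OF that(2)] that by simp_all
    then have "(e + f) ** ?b = ?b"
      by (simp add: bracket_def matrix_diff_ldistrib matrix_mul_assoc)
    then have s: "e ** ?b + f ** ?b = ?b" by (simp add: matrix_add_rdistrib)
    have "e ** ?b ** f = 0" "f ** ?b ** e = 0" "e ** ?b ** e = e ** ?b" "f ** ?b ** f = f ** ?b"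
      unfolding eb fb by (simp_all add: matrix_mul_assoc[symmetric] blocksD[OF ef])
    then show ?thesis using s by simp
  qed
  have subD: "matvs.subspace ?D"
    by (auto simp: matvs.subspace_def matring mscale_distrib add.commute add.left_commute)
      (metis matvs.scale_right_distrib)
  have sub_ext: "matvs.subspace (ext c)" if "matvs.subspace c" for c
    unfolding ext_def by (rule matvs.subspace_sums[OF that subN])
  have br_ext: "bracket (x + y) (x' + y') = bracket x x' + (x ** y' - y' ** x + (y ** x' - x' ** y))"
    "x ** y' - y' ** x + (y ** x' - x' ** y) \<in> N"
    if "x \<in> ?D" "x' \<in> ?D" "y \<in> N" "y' \<in> N" for x x' y y'
  proof -
    show "bracket (x + y) (x' + y') = bracket x x' + (x ** y' - y' ** x + (y ** x' - x' ** y))"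
      using NN[OF that(3,4)] NN[OF that(4,3)]
      by (simp add: bracket_def matrix_add_ldistrib matrix_add_rdistrib)
    show "x ** y' - y' ** x + (y ** x' - x' ** y) \<in> N"
      using DN that by (intro matvs.subspace_add[OF subN] matvs.subspace_diff[OF subN]) auto
  qed
  \<comment> \<open>\<open>N\<close> is abelian and normalized by block diagonal matrices, so
    deriving \<open>ext c\<close> derives \<open>c\<close> and stays within \<open>N\<close>
    otherwise. When the block diagonal part has become zero, one further derivation kills
    \<open>N\<close>.\<close>
  have der_ext: "derived_algebra (ext c) \<subseteq> ext (derived_algebra c)" if "c \<subseteq> ?D" for c
  proof (rule derived_algebra_subset[OF sub_ext[OF subspace_derived_algebra]])
    fix z z' assume "z \<in> ext c" "z' \<in> ext c"
    then obtain x y x' y' where z: "z = x + y" "z' = x' + y'" "x \<in> c" "x' \<in> c" "y \<in> N" "y' \<in> N"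
      unfolding ext_def by blast
    then have "x \<in> ?D" "x' \<in> ?D" using that by auto
    then show "bracket z z' \<in> ext (derived_algebra c)"
      using br_ext[of x x' y y'] z bracket_in_derived_algebra[of x c x'] unfolding ext_def by blast
  qed
  have derD: "(derived_algebra ^^ k) b \<subseteq> ?D" for k
  proof (induction k)
    case (Suc k)
    then show ?case using derived_algebra_subset[OF subD, of "(derived_algebra ^^ k) b"] brD by auto
  qed (use bD in simp)
  have iter: "(derived_algebra ^^ k) (ext b) \<subseteq> ext ((derived_algebra ^^ k) b)" for k
  proof (induction k)
    case (Suc k)
    have "(derived_algebra ^^ Suc k) (ext b) \<subseteq> derived_algebra (ext ((derived_algebra ^^ k) b))"
      using derived_algebra_mono[OF Suc] by simp
    also have "\<dots> \<subseteq> ext ((derived_algebra ^^ Suc k) b)" using der_ext[OF derD[of k]] by simp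
    finally show ?case .
  qed simp
  have sa: "matvs.subspace b" "b \<subseteq> sl" "\<And>x y. x \<in> b \<Longrightarrow> y \<in> b \<Longrightarrow> bracket x y \<in> b"
    and sol: "lie_solvable b"
    and max: "\<And>c. lie_subalgebra c sl \<Longrightarrow> lie_solvable c \<Longrightarrow> b \<subseteq> c \<Longrightarrow> c = b"
    using b by (auto simp: borel_subalgebra_def lie_subalgebra_def)
  obtain k where k: "(derived_algebra ^^ k) b = {0}" using sol by (auto simp: lie_solvable_def)
  have "(derived_algebra ^^ k) (ext b) \<subseteq> N"
    using iter[of k] unfolding k by (auto simp: ext_def)
  then have "(derived_algebra ^^ Suc k) (ext b) \<subseteq> derived_algebra N"
    using derived_algebra_mono by simp
  also have "\<dots> \<subseteq> {0}"
    by (rule derived_algebra_subset) (auto simp: bracket_def NN)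
  finally have "(derived_algebra ^^ Suc k) (ext b) = {0}"
    using matvs.subspace_0[OF subspace_derived_algebra] by auto
  then have "lie_solvable (ext b)" unfolding lie_solvable_def by blast
  moreover have "lie_subalgebra (ext b) sl"
    unfolding lie_subalgebra_def
  proof (intro conjI ballI)
    show "matvs.subspace (ext b)" by (rule sub_ext[OF sa(1)])
    have "trace y = 0" if "y \<in> N" for y
    proof -
      have "trace y = trace (y ** f)" using that by (simp add: N_def)
      also have "\<dots> = trace (f ** y)" by (rule trace_mul_sym)
      finally show ?thesis using N0[OF that] by simp
    qed
    then show "ext b \<subseteq> sl" using sa(2) by (auto simp: ext_def sl_def trace_add)
    fix z z' assume "z \<in> ext b" "z' \<in> ext b"
    then obtain x y x' y' where z: "z = x + y" "z' = x' + y'" "x \<in> b" "x' \<in> b" "y \<in> N" "y' \<in> N"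
      unfolding ext_def by blast
    then have "x \<in> ?D" "x' \<in> ?D" using bD by auto
    then show "bracket z z' \<in> ext b"
      using br_ext[of x x' y y'] z sa(3)[of x x'] unfolding ext_def by blast
  qed
  moreover have "b \<subseteq> ext b"
  proof
    fix x assume "x \<in> b"
    then have "x + 0 \<in> ext b" using matvs.subspace_0[OF subN] unfolding ext_def by blast
    then show "x \<in> ext b" by simp
  qed
  ultimately have eq: "ext b = b" using max by blast
  obtain v w where v: "e *v v = v" "dotp w v = 1"
    using exists_unit_vectors[OF blocksD(1)[OF ef] rk(1)] by metis
  obtain v' w' where w: "w' v* f = w'" "dotp w' v' = 1"
    using exists_unit_vectors[OF blocksD(2)[OF ef] rk(2)] by metis
  have N: "outer v w' \<in> N" using v w by (simp add: N_def mult_outer outer_mult)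
  have "0 + outer v w' \<in> ext b"
    using matvs.subspace_0[OF sa(1)] N unfolding ext_def by blast
  then have "outer v w' \<in> ?D" using eq bD by auto
  then have "e ** outer v w' ** f = 0" by blast
  then have "outer v w' = 0" using v w by (simp add: mult_outer outer_mult)
  then show False using v w by (auto simp: outer_eq_0_iff)
qed

text \<open>A nonzero component in \<open>e gl f\<close> would put this whole block into the ideal
  \<open>N\<close>. Bracketing with the opposite block, which lies in \<open>P\<close>, would then
  produce a nonzero traceless block diagonal matrix in \<open>N\<close>, contrary to
  \<open>L\<close>.\<close>

lemma ideal_off_diagonal_0:
  fixes e f :: "'k::field_char_0^'n^'n"
  assumes ef: "blocks e f" and 1: "e + f = mat 1" and rk: "rk e > 0" "rk f > 0"
    and N: "matvs.subspace N" and id: "\<And>x y. x \<in> P \<Longrightarrow> y \<in> N \<Longrightarrow> bracket x y \<in> N"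
    and L: "\<And>l. l \<in> sl \<Longrightarrow> e ** l ** f = 0 \<Longrightarrow> f ** l ** e = 0 \<Longrightarrow> l \<in> P \<and> (l \<in> N \<longrightarrow> l = 0)"
    and low: "\<And>x. f ** x ** e \<in> P"
    and m: "m \<in> N"
  shows "e ** m ** f = 0"
proof (rule ccontr)
  assume ne: "e ** m ** f \<noteq> 0"
  have st: "bracket l x \<in> N" if "l \<in> sl" "e ** l ** f = 0" "f ** l ** e = 0" "x \<in> N" for l x
    using that id L by blast
  have mN: "e ** m ** f \<in> N" by (rule off_diagonal_projection(1)[OF ef 1 rk(1) N st m])
  have all: "e ** x ** f \<in> N" for x
    by (rule off_diagonal_irreducible[OF ef rk N st mN _ _ ne])
      (simp_all add: matring blocksD[OF ef])
  obtain v w where v: "e *v v = v" "w v* e = w" "dotp w v = 1"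
    using exists_unit_vectors[OF blocksD(1)[OF ef] rk(1)] by metis
  obtain v' w' where v': "f *v v' = v'" "w' v* f = w'" "dotp w' v' = 1"
    using exists_unit_vectors[OF blocksD(2)[OF ef] rk(2)] by metis
  have "outer v w' \<in> N" using all[of "outer v w'"] v v' by (simp add: mult_outer outer_mult)
  moreover have "outer v' w \<in> P" using low[of "outer v' w"] v v' by (simp add: mult_outer outer_mult)
  ultimately have "bracket (outer v' w) (outer v w') \<in> N" using id by blast
  moreover have "bracket (outer v' w) (outer v w') = outer v' w' - outer v w"
    by (simp add: bracket_def outer_mult_outer v v')
  moreover have cross: "f *v v = 0" "e *v v' = 0"
    using blocks_mv(4)[OF ef, of v] blocks_mv(3)[OF ef, of v'] v v' by simp_all
  then have z: "e ** (outer v' w' - outer v w) ** f = - outer v (w v* f)"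
    "f ** (outer v' w' - outer v w) ** e = outer v' (w' v* e)"
    by (simp_all add: matrix_diff_ldistrib matrix_diff_rdistrib mult_outer outer_mult v v' outer_eq_0_iff
        matrix_neg_left)
  have "w v* f = w v* (e ** f)" "w' v* e = w' v* (f ** e)"
    by (simp_all add: vector_matrix_mul_assoc[symmetric] v v')
  then have "w v* f = 0" "w' v* e = 0" by (simp_all add: blocksD[OF ef])
  then have "outer v' w' - outer v w \<in> sl" "e ** (outer v' w' - outer v w) ** f = 0" "f ** (outer v' w' - outer v w) ** e = 0"
    unfolding z by (simp_all add: sl_def trace_sub trace_outer v v' outer_eq_0_iff)
  ultimately have "outer v' w' - outer v w = 0" using L by metis
  then have "e *v ((outer v' w' - outer v w) *v v) = 0" by simp
  then have "v = 0" by (simp add: algebra_simps outer_mv v mv_scale cross)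
  then show False using v by simp
qed

text \<open>By irreducibility each off-diagonal block lies in \<open>P\<close> as soon as
  \<open>P\<close> has a nonzero component there. If both occur, then \<open>N = {0}\<close> and
  \<open>P = L\<close>, a contradiction; if none occurs, \<open>P\<close> contains no Borel
  subalgebra. Either block may be the one that remains, whence the two assignments of ranks.\<close>

lemma maximal_parabolic_form:
  fixes P L :: "('k::field_char_0^'n^'n) set"
  assumes P: "parabolic_subalgebra P sl" and L: "levi_factor L P" "two_blocks p q L"
    and pq: "p > 0" "q > 0"
  obtains e f where "blocks e f" "e + f = mat 1" "rk e = p \<and> rk f = q \<or> rk e = q \<and> rk f = p"
    "P = {x \<in> sl. f ** x ** e = 0}"
proof -
  obtain e f where ef: "blocks e f" and 1: "e + f = mat 1" and rk: "rk e = p" "rk f = q"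
    and Leq: "L = {x \<in> sl. e ** x ** f = 0 \<and> f ** x ** e = 0}"
    by (rule two_blocks_idempotents[OF L(2)])
  have rk0: "rk e > 0" "rk f > 0" using rk pq by auto
  have fe: "blocks f e" "f + e = mat 1" using ef 1 by (simp_all add: blocks_swap add.commute)
  obtain N where N: "is_nilradical N P" "L \<inter> N = {0}" "P = {x + y | x y. x \<in> L \<and> y \<in> N}"
    using L(1) unfolding levi_factor_def by blast
  have LP: "L \<subseteq> P" using L(1) by (auto simp: levi_factor_def lie_subalgebra_def)
  have Psub: "matvs.subspace P" "P \<subseteq> sl" "\<And>x y. x \<in> P \<Longrightarrow> y \<in> P \<Longrightarrow> bracket x y \<in> P"
    using P by (auto simp: parabolic_subalgebra_def lie_subalgebra_def)
  have Nid: "matvs.subspace N" "N \<subseteq> P" "\<And>x y. x \<in> P \<Longrightarrow> y \<in> N \<Longrightarrow> bracket x y \<in> N"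
    using N(1) by (auto simp: is_nilradical_def lie_ideal_def)
  obtain b where b: "borel_subalgebra b sl" "b \<subseteq> P" using P by (auto simp: parabolic_subalgebra_def)
  have stP: "bracket l x \<in> P" if "l \<in> sl" "e ** l ** f = 0" "f ** l ** e = 0" "x \<in> P" for l x
    using that Psub(3) LP Leq by blast
  have up: "e ** x ** f \<in> P" if m: "m \<in> P" "e ** m ** f \<noteq> 0" for m x
    by (rule off_diagonal_irreducible[OF ef rk0 Psub(1) stP off_diagonal_projection(1)[OF ef 1 rk0(1) Psub(1) stP m(1)] _ _ m(2)])
      (simp_all add: matring blocksD[OF ef])
  have low: "f ** x ** e \<in> P" if m: "m \<in> P" "f ** m ** e \<noteq> 0" for m x
    by (rule off_diagonal_irreducible[OF fe(1) rk0(2,1) Psub(1) stP off_diagonal_projection(2)[OF ef 1 rk0(1) Psub(1) stP m(1)] _ _ m(2)])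
      (simp_all add: matring blocksD[OF ef])
  have form: "P = {x \<in> sl. f' ** x ** e' = 0}"
    if b': "blocks e' f'" "e' + f' = mat 1" and Leq': "L = {x \<in> sl. e' ** x ** f' = 0 \<and> f' ** x ** e' = 0}"
      and u: "\<And>x. e' ** x ** f' \<in> P" and l: "\<And>m. m \<in> P \<Longrightarrow> f' ** m ** e' = 0" for e' f'
  proof
    show "P \<subseteq> {x \<in> sl. f' ** x ** e' = 0}" using Psub(2) l by blast
    show "{x \<in> sl. f' ** x ** e' = 0} \<subseteq> P"
    proof
      fix x assume x: "x \<in> {x \<in> sl. f' ** x ** e' = 0}"
      define d where "d = e' ** x ** e' + f' ** x ** f'"
      have "d + e' ** x ** f' = e' ** x ** e' + e' ** x ** f' + f' ** x ** e' + f' ** x ** f'"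
        using x by (simp add: d_def)
      then have xd: "x = d + e' ** x ** f'"
        by (rule trans[OF full_decomp[OF b'(2)] sym])
      have "trace x = trace d"
        using trace_split[OF b'(2), of x]
        by (simp add: d_def trace_add trace_idem blocksD[OF b'(1)])
      then have "d \<in> L"
        unfolding Leq' using x by (simp add: sl_def d_def matring blocksD[OF b'(1)])
      then have "d + e' ** x ** f' \<in> P" using LP u matvs.subspace_add[OF Psub(1)] by blast
      then show "x \<in> P" using xd by simp
    qed
  qed
  show ?thesis
  proof (cases "\<exists>m\<in>P. e ** m ** f \<noteq> 0")
    case A: True
    show ?thesis
    proof (cases "\<exists>m\<in>P. f ** m ** e \<noteq> 0")
      case B: True
      have Lprop: "l \<in> P \<and> (l \<in> N \<longrightarrow> l = 0)" if "l \<in> sl" "e ** l ** f = 0" "f ** l ** e = 0" for l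
        using that Leq LP N(2) by blast
      have "e ** m ** f = 0" if "m \<in> N" for m
        using ideal_off_diagonal_0[OF ef 1 rk0 Nid(1) Nid(3) Lprop _ that] B low by blast
      moreover have "f ** m ** e = 0" if "m \<in> N" for m
        using ideal_off_diagonal_0[OF fe rk0(2,1) Nid(1) Nid(3) Lprop _ that] A up by blast
      ultimately have "N \<subseteq> L" using Nid(2) Psub(2) unfolding Leq by blast
      then have "N = {0}" using N(2) by blast
      then have "P = L" using N(3) by auto
      then show ?thesis using A Leq by blast
    next
      case False
      then show ?thesis
        using that[OF ef 1] rk form[OF ef 1 Leq] A up by blast
    qed
  next
    case A: False
    show ?thesis
    proof (cases "\<exists>m\<in>P. f ** m ** e \<noteq> 0")
      case True
      have "L = {x \<in> sl. f ** x ** e = 0 \<and> e ** x ** f = 0}" unfolding Leq by blast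
      then show ?thesis
        using that[OF fe] rk form[OF fe] True A low by blast
    next
      case B: False
      have "b \<subseteq> {x. e ** x ** f = 0 \<and> f ** x ** e = 0 \<and> x = e ** x ** e + f ** x ** f}"
      proof
        fix x assume "x \<in> b"
        then have "e ** x ** f = 0" "f ** x ** e = 0" using A B b by auto
        then show "x \<in> {x. e ** x ** f = 0 \<and> f ** x ** e = 0 \<and> x = e ** x ** e + f ** x ** f}"
          using full_decomp[OF 1, of x] by simp
      qed
      then show ?thesis using borel_not_block_diagonal[OF ef rk0 b(1)] by blast
    qed
  qed
qed

text \<open>Adding multiples of \<open>f\<close> makes corner elements traceless without changing
  their brackets. Brackets of rank-one corner elements then give every compressed matrix unit up to
  a multiple of the fixed \<open>outer v w\<close>, and in the expansion of \<open>x\<close> these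
  multiples add up to \<open>trace x = 0\<close>.\<close>

lemma traceless_corner_derived:
  fixes e f :: "'k::field_char_0^'n^'n"
  assumes ef: "blocks e f" and rk: "rk e > 0" "rk f > 0"
    and D: "matvs.subspace D"
    and br: "\<And>x y. x \<in> sl \<Longrightarrow> y \<in> sl \<Longrightarrow> f ** x ** e = 0 \<Longrightarrow> e ** x ** f = 0 \<Longrightarrow> f ** y ** e = 0 \<Longrightarrow> e ** y ** f = 0 \<Longrightarrow> bracket x y \<in> D"
    and x: "corner e x" "trace x = 0"
  shows "x \<in> D"
proof -
  obtain v w where v: "e *v v = v" "w v* e = w" "dotp w v = 1"
    using exists_unit_vectors[OF blocksD(1)[OF ef] rk(1)] by metis
  have trf: "trace f \<noteq> 0" using rk(2) trace_idempotent[OF blocksD(2)[OF ef]] by simp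
  have brc: "bracket y z \<in> D" if y: "corner e y" and z: "corner e z" for y z
  proof -
    define y' where "y' = y - mscale (trace y / trace f) f"
    define z' where "z' = z - mscale (trace z / trace f) f"
    have yz: "e ** y = y" "y ** e = y" "e ** z = z" "z ** e = z" using y z by (simp_all add: corner_def)
    have yz0: "f ** y = 0" "y ** f = 0" "f ** z = 0" "z ** f = 0"
      using blocks_zero(1)[OF ef yz(1)] blocks_zero(3)[OF ef yz(2)]
        blocks_zero(1)[OF ef yz(3)] blocks_zero(3)[OF ef yz(4)] by auto
    have "y' \<in> sl" "z' \<in> sl" using trf by (simp_all add: y'_def z'_def sl_def trace_lin)
    moreover have "f ** y' ** e = 0" "e ** y' ** f = 0" "f ** z' ** e = 0" "e ** z' ** f = 0"
      by (simp_all add: y'_def z'_def matring blocksD[OF ef] yz yz0)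
    ultimately have "bracket y' z' \<in> D" using br by blast
    moreover have "bracket y' z' = bracket y z"
      by (simp add: y'_def z'_def bracket_def matring blocksD[OF ef] yz0)
    ultimately show ?thesis by simp
  qed
  have unit: "e ** mat_unit i j ** e - mscale (trace (e ** mat_unit i j ** e)) (outer v w) \<in> D" for i j
  proof -
    define \<alpha> \<beta> where "\<alpha> = e *v axis i 1" and "\<beta> = axis j 1 v* e"
    have ab: "e *v \<alpha> = \<alpha>" "\<beta> v* e = \<beta>"
      by (simp_all add: \<alpha>_def \<beta>_def matrix_vector_mul_assoc vector_matrix_mul_assoc blocksD[OF ef])
    have eq: "e ** mat_unit i j ** e = outer \<alpha> \<beta>"
      by (simp add: mat_unit_def mult_outer outer_mult \<alpha>_def \<beta>_def)
    have "bracket (outer \<alpha> w) (outer v \<beta>) = outer \<alpha> \<beta> - mscale (dotp \<beta> \<alpha>) (outer v w)"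
      by (simp add: bracket_def outer_mult_outer v)
    moreover have "bracket (outer \<alpha> w) (outer v \<beta>) \<in> D"
      by (rule brc) (simp_all add: corner_def mult_outer outer_mult ab v)
    ultimately show ?thesis by (simp add: eq trace_outer)
  qed
  have xe: "x = e ** x ** e" using x by (simp add: corner_def)
  also have "\<dots> = e ** (\<Sum>i\<in>UNIV. \<Sum>j\<in>UNIV. mscale (x $ i $ j) (mat_unit i j)) ** e"
    using matrix_expansion[of x] by simp
  also have "\<dots> = (\<Sum>i\<in>UNIV. \<Sum>j\<in>UNIV. mscale (x $ i $ j) (e ** mat_unit i j ** e))"
    by (simp add: matrix_sum_left matrix_sum_right mscale_mult_left mscale_mult_right)
  finally have sum: "x = (\<Sum>i\<in>UNIV. \<Sum>j\<in>UNIV. mscale (x $ i $ j) (e ** mat_unit i j ** e))" .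
  have trs: "trace (\<Sum>i\<in>I. F i) = (\<Sum>i\<in>I. trace (F i))" for I :: "'n set" and F :: "'n \<Rightarrow> 'k^'n^'n"
    by (induction I rule: infinite_finite_induct) (simp_all add: trace_add)
  have "trace (\<Sum>i\<in>UNIV. \<Sum>j\<in>UNIV. mscale (x $ i $ j) (e ** mat_unit i j ** e)) = 0"
    unfolding sum[symmetric] by (rule x(2))
  then have tr0: "(\<Sum>i\<in>UNIV. \<Sum>j\<in>UNIV. x $ i $ j * trace (e ** mat_unit i j ** e)) = 0"
    by (simp add: trs trace_scale)
  have "(\<Sum>i\<in>UNIV. \<Sum>j\<in>UNIV. mscale (x $ i $ j) (e ** mat_unit i j ** e - mscale (trace (e ** mat_unit i j ** e)) (outer v w)))
    = (\<Sum>i\<in>UNIV. \<Sum>j\<in>UNIV. mscale (x $ i $ j) (e ** mat_unit i j ** e))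
      - mscale (\<Sum>i\<in>UNIV. \<Sum>j\<in>UNIV. x $ i $ j * trace (e ** mat_unit i j ** e)) (outer v w)"
    by (simp add: matvs.scale_right_diff_distrib sum_subtractf matvs.scale_sum_left)
  also have "\<dots> = x" unfolding tr0 sum[symmetric] by simp
  finally have "x = (\<Sum>i\<in>UNIV. \<Sum>j\<in>UNIV. mscale (x $ i $ j) (e ** mat_unit i j ** e - mscale (trace (e ** mat_unit i j ** e)) (outer v w)))" ..
  also have "\<dots> \<in> D"
    by (intro matvs.subspace_sum[OF D] matvs.subspace_scale[OF D] unit)
  finally show ?thesis .
qed

lemma derived_algebra_parabolic:
  fixes e f :: "'k::field_char_0^'n^'n"
  assumes ef: "blocks e f" and 1: "e + f = mat 1" and rk: "rk e > 0" "rk f > 0"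
  shows "derived_algebra {x \<in> sl. f ** x ** e = 0} =
    {x. f ** x ** e = 0 \<and> trace (e ** x) = 0 \<and> trace (f ** x) = 0}" (is "derived_algebra ?P = ?a")
proof
  have suba: "matvs.subspace ?a" by (auto simp: matvs.subspace_def matring trace_lin)
  show "derived_algebra ?P \<subseteq> ?a"
  proof (rule derived_algebra_subset[OF suba])
    fix x y assume xy: "x \<in> ?P" "y \<in> ?P"
    have c: "corner (e + f) x" by (simp add: 1 corner_def)
    have fx: "f ** x ** e = 0" and fy: "f ** y ** e = 0" using xy by auto
    note bb = bracket_blocks[OF ef c fx, of y]
    have "trace (e ** bracket x y) = trace (e ** bracket x y ** e)" "trace (f ** bracket x y) = trace (f ** bracket x y ** f)"
      by (simp_all add: trace_idem blocksD[OF ef])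
    then show "bracket x y \<in> ?a"
      unfolding mem_Collect_eq bb fy by (simp add: trace_bracket_0 bb(2) fy) 
  qed
  let ?D = "derived_algebra ?P"
  have D: "matvs.subspace ?D" by (rule subspace_derived_algebra)
  have br: "bracket x y \<in> ?D" if "x \<in> ?P" "y \<in> ?P" for x y
    by (rule bracket_in_derived_algebra[OF that])
  show "?a \<subseteq> ?D"
  proof
    fix x assume x: "x \<in> ?a"
    have "e ** x ** e \<in> ?D"
      by (rule traceless_corner_derived[OF ef rk D])
        (use x br in \<open>auto simp: corner_def matring blocksD[OF ef] trace_idem[OF blocksD(1)[OF ef], unfolded matrix_mul_assoc[symmetric]]\<close>)
    moreover have "f ** x ** f \<in> ?D"
      by (rule traceless_corner_derived[OF blocks_swap[OF ef] rk(2,1) D])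
        (use x br in \<open>auto simp: corner_def matring blocksD[OF ef] trace_idem[OF blocksD(2)[OF ef], unfolded matrix_mul_assoc[symmetric]]\<close>)
    moreover have "e ** x ** f \<in> ?D"
    proof -
      define p q :: 'k where "p = of_nat (rk e)" and "q = of_nat (rk f)"
      have "p + q = of_nat (rk e + rk f)" by (simp add: p_def q_def)
      then have n0: "p + q \<noteq> 0" using rk by (simp del: of_nat_add)
      \<comment> \<open>Normalized so that \<open>h\<close> is traceless and its bracket is the
        identity on \<open>e gl f\<close>.\<close>
      define h where "h = mscale (q / (p + q)) e - mscale (p / (p + q)) f"
      have "h \<in> ?P"
        using trace_idempotent[OF blocksD(1)[OF ef]] trace_idempotent[OF blocksD(2)[OF ef]]
        by (simp add: h_def sl_def trace_lin p_def q_def matring blocksD[OF ef])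
      moreover have "e ** x ** f \<in> ?P"
        using trace_mul_sym[of "e ** x" f] by (simp add: sl_def matring blocksD[OF ef])
      ultimately have "bracket h (e ** x ** f) \<in> ?D" by (rule br)
      moreover have "bracket h (e ** x ** f) = mscale (q / (p + q) + p / (p + q)) (e ** x ** f)"
        by (simp add: h_def bracket_def matring blocksD[OF ef] matvs.scale_left_distrib)
      moreover have "q / (p + q) + p / (p + q) = 1" using n0 by (simp add: add_divide_distrib[symmetric] add.commute)
      ultimately show ?thesis by simp
    qed
    ultimately have "e ** x ** e + e ** x ** f + f ** x ** f \<in> ?D"
      by (intro matvs.subspace_add[OF D])
    then show "x \<in> ?D" using full_decomp[OF 1, of x] x by simp
  qed
qed

text \<open>The trace form pairs \<open>e gl f\<close> with \<open>f gl e\<close>, and in a diagonal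
  block the matrices orthogonal to all traceless ones are the scalars. For \<open>M\<close> a
  commutator this yields the conditions of \<open>pstab\<close>; for \<open>M\<close> a difference
  it tells when two matrices define the same functional.\<close>

lemma annihilator_derived_parabolic:
  fixes e f M :: "'k::field_char_0^'n^'n"
  assumes ef: "blocks e f" and 1: "e + f = mat 1" and rk: "rk e > 0" "rk f > 0"
    and a: "a = {x. f ** x ** e = 0 \<and> trace (e ** x) = 0 \<and> trace (f ** x) = 0}"
  shows "(\<forall>z\<in>a. trace (M ** z) = 0) \<longleftrightarrow>
    f ** M ** e = 0 \<and> (\<exists>\<alpha>. e ** M ** e = mscale \<alpha> e) \<and> (\<exists>\<beta>. f ** M ** f = mscale \<beta> f)"
    (is "?l \<longleftrightarrow> ?r")
proof
  have cyc: "trace (M ** (x ** z ** y)) = trace ((y ** M ** x) ** z)" for x y z :: "'k^'n^'n"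
    using trace_mul_sym[of "M ** x ** z" y] by (simp add: matrix_mul_assoc)
  assume ?r
  then obtain \<alpha> \<beta> where M: "f ** M ** e = 0" "e ** M ** e = mscale \<alpha> e" "f ** M ** f = mscale \<beta> f" by blast
  show ?l
  proof
    fix z assume "z \<in> a"
    then have z: "f ** z ** e = 0" "trace (e ** z) = 0" "trace (f ** z) = 0" by (auto simp: a)
    have "trace (M ** z) = trace (M ** (e ** z ** e + e ** z ** f + f ** z ** e + f ** z ** f))"
      using full_decomp[OF 1, of z] by simp
    also have "\<dots> = trace (M ** (e ** z ** e)) + trace (M ** (e ** z ** f)) + trace (M ** (f ** z ** f))"
      by (simp add: z matrix_add_ldistrib trace_add)
    also have "\<dots> = 0"
      unfolding cyc M by (simp add: mscale_mult_left trace_scale z)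
    finally show "trace (M ** z) = 0" .
  qed
next
  have cyc: "trace (M ** (x ** z ** y)) = trace ((y ** M ** x) ** z)" for x y z :: "'k^'n^'n"
    using trace_mul_sym[of "M ** x ** z" y] by (simp add: matrix_mul_assoc)
  assume l: ?l
  have "f ** M ** e = 0"
  proof (rule trace_nondegenerate)
    fix z
    have "e ** z ** f \<in> a"
      using trace_mul_sym[of "e ** z" f] by (simp add: a matring blocksD[OF ef])
    then show "trace ((f ** M ** e) ** z) = 0" using l cyc[of e z f] by auto
  qed
  moreover have scalar: "\<exists>\<alpha>. g ** M ** g = mscale \<alpha> g"
    if g: "g ** g = g" "rk g > 0" and mem: "\<And>z. corner g z \<Longrightarrow> trace z = 0 \<Longrightarrow> z \<in> a" for g
  proof -
    have trg: "trace g \<noteq> 0" using g trace_idempotent[OF g(1)] by simp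
    have gg: "g ** (g ** X) = g ** X" for X using mult_assoc_eq[OF g(1), of X] .
    have "g ** M ** g - mscale (trace (g ** M) / trace g) g = 0"
    proof (rule trace_nondegenerate)
      fix z
      let ?z = "g ** z ** g - mscale (trace (g ** z) / trace g) g"
      have "trace (g ** z ** g) = trace (g ** z)" by (rule trace_idem[OF g(1)])
      then have "?z \<in> a" using trg
        by (intro mem) (simp_all add: corner_def matring g gg trace_lin)
      then have "trace (M ** ?z) = 0" using l by blast
      moreover have "trace (M ** ?z) = trace ((g ** M ** g) ** z) - trace (g ** z) / trace g * trace (g ** M)"
        by (simp add: matrix_diff_ldistrib trace_sub cyc mscale_mult_right trace_scale trace_mul_sym[of M g])
      ultimately show "trace ((g ** M ** g - mscale (trace (g ** M) / trace g) g) ** z) = 0"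
        by (simp add: matrix_diff_rdistrib trace_lin mscale_mult_left)
    qed
    then show ?thesis by auto
  qed
  have "\<exists>\<alpha>. e ** M ** e = mscale \<alpha> e"
  proof (rule scalar)
    fix z assume z: "corner e z" "trace z = 0"
    then have "f ** z = 0" using blocks_zero(1)[OF ef] by (simp add: corner_def)
    then show "z \<in> a" using z by (simp add: a corner_def)
  qed (use rk blocksD[OF ef] in auto)
  moreover have "\<exists>\<beta>. f ** M ** f = mscale \<beta> f"
  proof (rule scalar)
    fix z assume z: "corner f z" "trace z = 0"
    then have "e ** z = 0" "z ** e = 0" using blocks_zero(2,4)[OF ef] by (simp_all add: corner_def)
    then show "z \<in> a" using z by (simp add: a corner_def)
  qed (use rk blocksD[OF ef] in auto)
  ultimately show ?r by blast
qed

lemma thin_iff_dim_le_1: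
  fixes S :: "('k::field^'n^'n) set"
  shows "thin S \<longleftrightarrow> matvs.dim S \<le> 1"
proof (intro iffI)
  assume thin: "thin S"
  show "matvs.dim S \<le> 1"
  proof (rule ccontr)
    assume "\<not> matvs.dim S \<le> 1"
    obtain B where B: "B \<subseteq> S" "matvs.independent B" "S \<subseteq> matvs.span B" "card B = matvs.dim S"
      by (rule matvs.basis_exists)
    then have "\<not> card B \<le> Suc 0" using \<open>\<not> matvs.dim S \<le> 1\<close> by simp
    then obtain x x' where x: "x \<in> B" "x' \<in> B" "x \<noteq> x'"
      using card_le_Suc0_iff_eq[OF matfd.finiteI_independent[OF B(2)]] by blast
    then obtain c d where cd: "c \<noteq> 0 \<or> d \<noteq> 0" "mscale c x + mscale d x' = 0"
      using thin B(1) unfolding thin_def by blast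
    have z: "(\<Sum>v\<in>{x, x'}. mscale (if v = x then c else d) v) = 0" using cd x by simp
    have "(if v = x then c else d) = 0" if "v \<in> {x, x'}" for v
      using matvs.independentD[OF B(2) _ _ z that] x by simp
    from this[of x] this[of x'] show False using cd x by auto
  qed
next
  assume d: "matvs.dim S \<le> 1"
  show "thin S" unfolding thin_def
  proof (intro ballI)
    fix x x' assume x: "x \<in> S" "x' \<in> S"
    show "\<exists>c d. (c \<noteq> 0 \<or> d \<noteq> 0) \<and> mscale c x + mscale d x' = 0"
    proof (cases "x' \<in> matvs.span {x}")
      case True
      then obtain k where "x' = mscale k x" by (auto simp: matvs.span_singleton)
      then show ?thesis by (intro exI[of _ "- k"] exI[of _ 1]) simp
    next
      case False
      have "x = 0"
      proof (rule ccontr)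
        assume "x \<noteq> 0"
        then have "matvs.independent {x', x}" using False by (intro matvs.independent_insertI) (simp_all add: matvs.independent_empty)
        moreover have "x' \<noteq> x" using False matvs.span_base by blast
        ultimately show False using matfd.independent_card_le_dim[of "{x', x}" S] x d by simp
      qed
      then show ?thesis by (intro exI[of _ 1] exI[of _ 0]) simp
    qed
  qed
qed

theorem corollary3p11:
  fixes p q :: nat
    and P L a :: "('k::{alg_closed_field, field_char_0}^'n^'n) set"
    and h :: "'k^'n^'n" and \<eta> :: "'k^'n^'n \<Rightarrow> 'k"
  assumes "p > 0" and "q > 0" and "coprime p q"
    and "CARD('n) = p + q" and "p + q > 2"
    and "parabolic_subalgebra P sl" and "levi_factor L P" and "two_blocks p q L"
    and "a = derived_algebra P"
    and "adapted_pair a h \<eta>"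
  shows "(\<exists>y \<in> nilpotent_cone_reg sl. rho sl a y = \<eta>) \<and>
         (\<forall>y0 \<in> sl. rho sl a y0 = \<eta> \<longrightarrow>
            {y0 + z | z. z \<in> ker_rho sl a} \<inter> nilpotent_cone_reg sl \<noteq> {})"
proof -
  obtain e f where ef: "blocks e f" and 1: "e + f = mat 1"
    and rk_cases: "rk e = p \<and> rk f = q \<or> rk e = q \<and> rk f = p" and P: "P = {x \<in> sl. f ** x ** e = 0}"
    by (rule maximal_parabolic_form[OF assms(6-8,1,2)])
  have rk: "rk e > 0" "rk f > 0" "coprime (rk e) (rk f)" "rk e + rk f = CARD('n)"
    using rk_cases assms(1-4) coprime_commute by (linarith, linarith, metis, linarith)
  have a: "a = {x. f ** x ** e = 0 \<and> trace (e ** x) = 0 \<and> trace (f ** x) = 0}"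
    unfolding assms(9) P by (rule derived_algebra_parabolic[OF ef 1 rk(1,2)])
  have suba: "matvs.subspace a" unfolding a by (auto simp: matvs.subspace_def matring trace_lin)
  have asl: "a \<subseteq> sl"
  proof
    fix x assume "x \<in> a"
    then have "trace (e ** x) + trace (f ** x) = 0" by (simp add: a)
    then show "x \<in> sl" unfolding sl_def using trace_split[OF 1, of x] by simp
  qed
  have aP: "x \<in> P" if "x \<in> a" for x
  proof -
    have "f ** x ** e = 0" using that unfolding a by simp
    then show ?thesis using that asl unfolding P by blast
  qed
  have bra: "bracket x z \<in> a" if "x \<in> a" "z \<in> a" for x z
    unfolding assms(9) by (rule bracket_in_derived_algebra[OF aP[OF that(1)] aP[OF that(2)]])
  have corner1: "corner (e + f) y" for y by (simp add: 1 corner_def)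
  have ann: "(\<forall>z\<in>a. trace (M ** z) = 0) \<longleftrightarrow>
    f ** M ** e = 0 \<and> (\<exists>\<alpha>. e ** M ** e = mscale \<alpha> e) \<and> (\<exists>\<beta>. f ** M ** f = mscale \<beta> f)" for M
    by (rule annihilator_derived_parabolic[OF ef 1 rk(1,2) a])
  have stab: "stabilizer a (\<lambda>z\<in>a. c * trace (Y ** z)) = pstab e f Y" if "c \<noteq> 0" for c Y
  proof -
    have "x \<in> stabilizer a (\<lambda>z\<in>a. c * trace (Y ** z)) \<longleftrightarrow> x \<in> a \<and> (\<forall>z\<in>a. trace (bracket x Y ** z) = 0)" for x
    proof -
      have "bracket Y x = - bracket x Y" by (simp add: bracket_def)
      then show ?thesis
        using stabilizer_trace_functional[OF that bra, of x Y] by (auto simp: matrix_neg_left trace_neg)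
    qed
    then show ?thesis unfolding ann by (auto simp: pstab_def corner1 a)
  qed
  \<comment> \<open>A single thin functional bounds the index by one, so that the stabilizer of
    every regular functional is thin.\<close>
  obtain Y1 where "thin (pstab e f Y1)" using exists_thin[OF ef rk(3,1,2)] by blast
  then have "matvs.dim (stabilizer a (\<lambda>z\<in>a. 1 * trace (Y1 ** z))) \<le> 1"
    unfolding stab[OF one_neq_zero] using thin_iff_dim_le_1 by blast
  moreover have "lie_index a \<le> matvs.dim (stabilizer a (\<lambda>z\<in>a. 1 * trace (Y1 ** z)))"
    unfolding lie_index_def using trace_functional_dual[OF suba, of 1 Y1] by (intro Least_le) blast
  ultimately have index: "lie_index a \<le> 1" by simp
  have \<eta>: "\<eta> \<in> dual a" "matvs.dim (stabilizer a \<eta>) = lie_index a"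
    using assms(10) by (auto simp: adapted_pair_def regular_functional_def)
  define c :: 'k where "c = 2 * of_nat CARD('n)"
  have c0: "c \<noteq> 0" by (simp add: c_def)
  have rho: "rho sl a y = (\<lambda>z\<in>a. c * trace (y ** z))" if "y \<in> sl" for y
    unfolding c_def by (rule rho_sl[OF that asl])
  obtain Y where Y: "\<forall>z\<in>a. \<eta> z = trace (Y ** z)"
    using functional_representation[OF suba \<eta>(1)] by blast
  \<comment> \<open>Division by \<open>c\<close> compensates the factor between Killing form and
    trace form; removing the scalar part moves \<open>Y\<close> into \<open>sl\<close> without
    changing the functional, since \<open>a\<close> is traceless.\<close>
  define Y0 where "Y0 = mscale (1 / c) (Y - mscale (trace Y / of_nat CARD('n)) (mat 1))"
  have Y0sl: "Y0 \<in> sl" by (simp add: Y0_def sl_def trace_lin trace_I)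
  have "\<eta> = (\<lambda>z\<in>a. c * trace (Y0 ** z))"
  proof
    fix z
    show "\<eta> z = (\<lambda>z\<in>a. c * trace (Y0 ** z)) z"
    proof (cases "z \<in> a")
      case True
      then have "trace z = 0" using asl by (auto simp: sl_def)
      then show ?thesis using True Y c0
        by (simp add: Y0_def mscale_mult_left matrix_diff_rdistrib trace_lin)
    next
      case False
      then show ?thesis using \<eta>(1) by (simp add: dual_def extensional_def)
    qed
  qed
  note \<eta>_eq = this
  have "thin (pstab e f Y0)"
    using \<eta>(2) index stab[OF c0, of Y0] thin_iff_dim_le_1[of "pstab e f Y0"]
    unfolding \<eta>_eq by simp
  then obtain z where z: "lifts e f Y0 z"
    using exists_lift[OF ef rk(3,1,2) corner1[of Y0]] Y0sl by (auto simp: sl_def)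
  obtain \<alpha> \<beta> where z_blocks: "f ** z ** e = f ** Y0 ** e" "e ** z ** e = e ** Y0 ** e + mscale \<alpha> e"
    "f ** z ** f = f ** Y0 ** f + mscale \<beta> f"
    using z unfolding lifts_def by blast
  have zsl: "z \<in> sl" using z Y0sl by (simp add: lifts_def sl_def)
  have z_reg: "z \<in> nilpotent_cone_reg sl"
    using z zsl rk(4) by (intro reg_nilpotent_in_cone) (simp_all add: lifts_def sl_def)
  have "\<forall>w\<in>a. trace ((z - Y0) ** w) = 0"
    unfolding ann using z_blocks by (auto simp: matrix_diff_ldistrib matrix_diff_rdistrib)
  then have "rho sl a z = \<eta>"
    unfolding rho[OF zsl] \<eta>_eq by (auto simp: matrix_diff_rdistrib trace_sub fun_eq_iff)
  moreover have "{y0 + u | u. u \<in> ker_rho sl a} \<inter> nilpotent_cone_reg sl \<noteq> {}"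
    if y0: "y0 \<in> sl" "rho sl a y0 = \<eta>" for y0
  proof -
    have d: "z - y0 \<in> sl" using zsl y0 by (simp add: sl_def trace_sub)
    have "c * trace (z ** w) = c * trace (y0 ** w)" if "w \<in> a" for w
      using \<open>rho sl a z = \<eta>\<close> y0(2) that unfolding rho[OF zsl] rho[OF y0(1)] by (metis restrict_apply')
    then have "rho sl a (z - y0) = (\<lambda>x\<in>a. 0)"
      unfolding rho[OF d] using c0 by (auto simp: matrix_diff_rdistrib trace_sub fun_eq_iff)
    then have "z - y0 \<in> ker_rho sl a" using d by (simp add: ker_rho_def)
    then have "y0 + (z - y0) \<in> {y0 + u | u. u \<in> ker_rho sl a}" by blast
    then show ?thesis using z_reg by auto
  qed
  ultimately show ?thesis using z_reg by blast
qed

end
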